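(* Let $p$ be a prime and $r$ an integer with $24\mid r(p^2-1)$. Let $\beta$ be a positive integer, and let $\bar\beta=1$ if $\beta$ is odd and $\bar\beta=0$ if $\beta$ is even. Put $\pi_p=\frac{p-1}{\gcd(12,p-1)}$. For integers $y$ and $n\ge0$ define $a_n^{r,p^\beta,y}$ by $$\eta^r(p^{\bar\beta}\tau)\left(\frac{\eta(p\tau)}{\eta(\tau)}\right)^{\frac{24}{\gcd(12,p-1)}y}=q^{\frac{p^{\bar\beta}r}{24}+\pi_p y}\sum_{n\ge0}a_n^{r,p^\beta,y}q^n .$$ If there is an integer $y$ with $P_r\left(\frac{p^{\beta+\bar\beta}-1}{24}r+p^\beta\pi_py\right)\ne0$, let $y_0$ be the smallest such integer, set $c_y=0$ for $y<y_0$, and define recursively $c_{y_0}=P_r\left(\frac{p^{\beta+\bar\beta}-1}{24}r+p^\beta\pi_py_0\right)$ and, for $y>y_0$, $$c_y=P_r\!\left(\frac{p^{\beta+\bar\beta}-1}{24}r+p^\beta\pi_py\right)-\sum_{y_0\le y'<y}c_{y'}\,a^{r,p^\beta,y'}_{\pi_p(y-y')};$$ if there is no such $y$, set $c_y=0$ for all $y$. Let $y_1$ be the smallest integer that is $\ge y_0$ and $\ge\frac{\gcd(12,p-1)}{24}\cdot\frac{p^{\beta-\bar\beta}-1}{p^{\beta-1}(p-1)}\,r$ if $r\ge0$, respectively $\ge y_0$ and $\ge\frac{\gcd(12,p-1)}{24}\cdot\frac{p^{\beta+1}-p^{1-\bar\beta}}{p-1}(-r)$ if $r<0$. (i) Suppose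 there is an integer $y$ with $P_r\left(\frac{p^{\beta+\bar\beta}-1}{24}r+p^\beta y\right)\ne0$ and the smallest such $y$ is a multiple of $\pi_p$. Then the following are equivalent: (A) $\displaystyle\sum_{m\in\frac{p^{\bar\beta}r}{24}+\mathbb Z}P_r\!\left(p^\beta m-\frac r{24}\right)q^m=\sum_{y\in\mathbb Z}c_y\,\eta^r(p^{\bar\beta}\tau)\left(\frac{\eta(p\tau)}{\eta(\tau)}\right)^{\frac{24}{\gcd(12,p-1)}y}$, where only finitely many $c_y$ are nonzero; (B) for every $n=0,1,2,\dots,\pi_p(y_1-y_0)$, $$P_r\!\left(\frac{p^{\beta+\bar\beta}-1}{24}r+p^\beta\pi_py_0+p^\beta n\right)=\sum_{\substack{y\in\mathbb Z\\ y_0\le y\le y_0+n/\pi_p}}c_y\,a^{r,p^\beta,y}_{n-\pi_p(y-y_0)}.$$ Moreover, if (A) holds then $c_y=0$ unless $y_0\le y\le y_1$. (ii) If $p\in\{2,3,5,7,13\}$, then the identity in (A) holds for every integer $r$ with $24\mid r(p^2-1)$.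
   Context: $q=e^{2\pi i\tau}$ for $\tau$ in the upper half-plane, $\eta(\tau)=q^{1/24}\prod_{n\ge1}(1-q^n)$. $P_r(n)$ is defined by $\eta(\tau)^r=q^{r/24}\sum_{n\ge0}P_r(n)q^n$, and $P_r(x)=0$ for rational $x$ that is not a non-negative integer. *)

theory Defs
  imports "HOL-Complex_Analysis.Complex_Analysis" "HOL-Computational_Algebra.Primes"
begin

text \<open>
  \<open>qpow s \<tau>\<close> is \<open>q\<^sup>s = exp (2 \<pi> \<i> s \<tau>)\<close> for a rational exponent \<open>s\<close>, where
  \<open>q = exp (2 \<pi> \<i> \<tau>)\<close>; this fixes the branch of the fractional powers of \<open>q\<close>.
\<close>

definition qpow :: "rat \<Rightarrow> complex \<Rightarrow> complex" where
  "qpow s \<tau> = exp (2 * of_real pi * \<i> * of_rat s * \<tau>)"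

definition dedekind_eta :: "complex \<Rightarrow> complex" where
  "dedekind_eta \<tau> = qpow (1 / 24) \<tau> * (\<Prod>n. 1 - qpow (of_nat (Suc n)) \<tau>)"

definition has_q_expansion :: "(complex \<Rightarrow> complex) \<Rightarrow> rat \<Rightarrow> (nat \<Rightarrow> complex) \<Rightarrow> bool" where
  "has_q_expansion f s a \<longleftrightarrow>
     (\<forall>\<tau>. Im \<tau> > 0 \<longrightarrow>
        summable (\<lambda>n. a n * qpow (of_nat n) \<tau>) \<and>
        f \<tau> = qpow s \<tau> * (\<Sum>n. a n * qpow (of_nat n) \<tau>))"

text \<open>
  The coefficients of such an expansion are unique by the identity theorem for power series
  in \<open>q\<close>, which makes the following description meaningful whenever an expansion exists. It
  is only used for products of powers of \<open>dedekind_eta \<tau>\<close> and \<open>dedekind_eta (p * \<tau>)\<close>.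
\<close>

definition q_coeffs :: "(complex \<Rightarrow> complex) \<Rightarrow> rat \<Rightarrow> nat \<Rightarrow> complex" where
  "q_coeffs f s = (THE a. has_q_expansion f s a)"

definition P :: "int \<Rightarrow> rat \<Rightarrow> complex" where
  "P r x = (if x \<in> \<nat>
            then q_coeffs (\<lambda>\<tau>. dedekind_eta \<tau> powi r) (of_int r / 24) (nat \<lfloor>x\<rfloor>)
            else 0)"

definition beta_bar :: "nat \<Rightarrow> nat" where
  "beta_bar \<beta> = (if odd \<beta> then 1 else 0)"

definition pi_p :: "nat \<Rightarrow> nat" where
  "pi_p p = (p - 1) div gcd 12 (p - 1)"

definition eta_quotient :: "nat \<Rightarrow> nat \<Rightarrow> int \<Rightarrow> int \<Rightarrow> complex \<Rightarrow> complex" where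
  "eta_quotient p \<beta> r y \<tau> =
     dedekind_eta (of_nat (p ^ beta_bar \<beta>) * \<tau>) powi r *
     (dedekind_eta (of_nat p * \<tau>) / dedekind_eta \<tau>) powi (int (24 div gcd 12 (p - 1)) * y)"

definition a_coeff :: "nat \<Rightarrow> nat \<Rightarrow> int \<Rightarrow> int \<Rightarrow> nat \<Rightarrow> complex" where
  "a_coeff p \<beta> r y =
     q_coeffs (eta_quotient p \<beta> r y)
       (of_nat (p ^ beta_bar \<beta>) * of_int r / 24 + of_nat (pi_p p) * of_int y)"

definition P_shift :: "nat \<Rightarrow> nat \<Rightarrow> int \<Rightarrow> rat" where
  "P_shift p \<beta> r = (of_nat p ^ (\<beta> + beta_bar \<beta>) - 1) / 24 * of_int r"

definition P_prog :: "nat \<Rightarrow> nat \<Rightarrow> int \<Rightarrow> int \<Rightarrow> complex" where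
  "P_prog p \<beta> r y = P r (P_shift p \<beta> r + of_nat (p ^ \<beta>) * of_nat (pi_p p) * of_int y)"

text \<open>
  Only meaningful if \<open>P_prog p \<beta> r y \<noteq> 0\<close> for some \<open>y\<close>; a least such \<open>y\<close> then exists, since
  \<open>P r\<close> vanishes on negative arguments (for \<open>p > 1\<close>, so that \<open>pi_p p > 0\<close>).
\<close>

definition y0 :: "nat \<Rightarrow> nat \<Rightarrow> int \<Rightarrow> int" where
  "y0 p \<beta> r = (LEAST y. P_prog p \<beta> r y \<noteq> 0)"

function c_coeff :: "nat \<Rightarrow> nat \<Rightarrow> int \<Rightarrow> int \<Rightarrow> complex" where
  "c_coeff p \<beta> r y =
     (if (\<forall>z. P_prog p \<beta> r z = 0) \<or> y < y0 p \<beta> r then 0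
      else if y = y0 p \<beta> r then P_prog p \<beta> r y
      else P_prog p \<beta> r y -
        (\<Sum>y' \<in> {y0 p \<beta> r..<y}. c_coeff p \<beta> r y' * a_coeff p \<beta> r y' (pi_p p * nat (y - y'))))"
  by pat_completeness auto
termination
  by (relation "Wellfounded.measure (\<lambda>(p, \<beta>, r, y). nat (y - y0 p \<beta> r))") auto

text \<open>The recursive equation loops as an unconditional rewrite rule.\<close>

declare c_coeff.simps [simp del]

definition y1_bound :: "nat \<Rightarrow> nat \<Rightarrow> int \<Rightarrow> rat" where
  "y1_bound p \<beta> r =
     (if r \<ge> 0
      then of_nat (gcd 12 (p - 1)) / 24 *
           ((of_nat p ^ (\<beta> - beta_bar \<beta>) - 1) / (of_nat p ^ (\<beta> - 1) * (of_nat p - 1))) * of_int r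
      else of_nat (gcd 12 (p - 1)) / 24 *
           ((of_nat p ^ (\<beta> + 1) - of_nat p ^ (1 - beta_bar \<beta>)) / (of_nat p - 1)) * of_int (- r))"

definition y1 :: "nat \<Rightarrow> nat \<Rightarrow> int \<Rightarrow> int" where
  "y1 p \<beta> r = (LEAST y. y \<ge> y0 p \<beta> r \<and> of_int y \<ge> y1_bound p \<beta> r)"

text \<open>
  The left-hand side is a sum over the coset \<open>p ^ beta_bar \<beta> * r / 24 + \<int>\<close> of rational exponents
  \<open>m\<close>; it is stated as an unordered (absolutely convergent) sum.
\<close>

definition eta_identity :: "nat \<Rightarrow> nat \<Rightarrow> int \<Rightarrow> bool" where
  "eta_identity p \<beta> r \<longleftrightarrow>
     finite {y. c_coeff p \<beta> r y \<noteq> 0} \<and>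
     (\<forall>\<tau>. Im \<tau> > 0 \<longrightarrow>
        ((\<lambda>m. P r (of_nat (p ^ \<beta>) * m - of_int r / 24) * qpow m \<tau>) has_sum
         (\<Sum>y | c_coeff p \<beta> r y \<noteq> 0. c_coeff p \<beta> r y * eta_quotient p \<beta> r y \<tau>))
        (range (\<lambda>k::int. of_nat (p ^ beta_bar \<beta>) * of_int r / 24 + of_int k)))"

definition coeff_identities :: "nat \<Rightarrow> nat \<Rightarrow> int \<Rightarrow> bool" where
  "coeff_identities p \<beta> r \<longleftrightarrow>
     (\<forall>n::nat. int n \<le> int (pi_p p) * (y1 p \<beta> r - y0 p \<beta> r) \<longrightarrow>
        P r (P_shift p \<beta> r + of_nat (p ^ \<beta>) * of_nat (pi_p p) * of_int (y0 p \<beta> r)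
               + of_nat (p ^ \<beta>) * of_nat n) =
        (\<Sum>y | y0 p \<beta> r \<le> y \<and> (of_int y :: rat) \<le> of_int (y0 p \<beta> r) + of_nat n / of_nat (pi_p p).
           c_coeff p \<beta> r y * a_coeff p \<beta> r y (n - pi_p p * nat (y - y0 p \<beta> r))))"

end

theory Submission
  imports Defs
begin

text \<open>
  Dividing the left-hand side of the identity by \<open>\<eta>\<^sup>r(p\<^bsup>b\<^esup>\<tau>)\<close>, where \<open>b\<close> is the parity of \<open>\<beta>\<close>, gives
  \<open>F = U\<^bsub>p\<^esub>\<^bsup>\<beta>\<^esup> g\<close> with \<open>g(u) = (\<eta>(u) / \<eta>(p\<^bsup>\<beta>+b\<^esup>u))\<^sup>r\<close>. As \<open>\<beta> + b\<close> is even, \<open>g\<close> is invariant under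
  \<open>\<Gamma>\<^sub>0(p\<^bsup>\<beta>+b\<^esup>)\<close>, hence \<open>F\<close> is a modular function for \<open>\<Gamma>\<^sub>0(p)\<close>, as is \<open>h = (\<eta>(p\<tau>) / \<eta>(\<tau>))\<^bsup>24/gcd(12,p-1)\<^esup>\<close>.
  Both are holomorphic on the upper half-plane; \<open>h\<close> has a zero of order \<open>\<pi>\<^sub>p\<close> at infinity and a pole of
  order \<open>\<pi>\<^sub>p\<close> at the cusp 0, where \<open>F\<close> has a pole of order at most \<open>\<pi>\<^sub>p y\<^sub>1\<close>. If the coefficients of \<open>F\<close> and
  \<open>\<Sum> c\<^sub>y h\<^sup>y\<close> (\<open>y\<^sub>0 \<le> y \<le> y\<^sub>1\<close>) agree up to \<open>q\<close>-exponent \<open>\<pi>\<^sub>p y\<^sub>1\<close>, then the difference divided by \<open>h\<close> to the power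
  \<open>y\<^sub>1\<close> vanishes at infinity and is bounded at 0, so it is 0. The bound \<open>y \<le> y\<^sub>1\<close> on the support of \<open>c\<close>
  follows by comparing coefficients.

  The multiplier system of \<open>\<eta>\<close> is never needed. The odd function \<open>Phi \<tau> z\<close>, a multiple of the theta
  function \<open>\<theta>\<^sub>1(z; \<tau>)\<close> normalised by \<open>Phi' = 1\<close> at 0, is determined by its quasi-periods. This yields the
  transformation law of the Klein forms under all of \<open>SL\<^sub>2(\<int>)\<close> at once. Their product over the 2-torsion
  points is a multiple of \<open>\<eta>(\<tau>)\<^bsup>-6\<^esup>\<close>, whence the law for the discriminant. For odd \<open>p\<close>, with \<open>H(\<tau>)\<close> the product
  over half of the points \<open>k/p\<close>, \<open>\<eta>(p\<tau>)\<close> is a multiple of \<open>H(\<tau>) \<eta>(\<tau>)\<^sup>p\<close>, so \<open>\<eta>(p\<^sup>2\<tau>) / \<eta>(\<tau>)\<close> is a multiple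
  of \<open>H(p\<tau>) H(\<tau>)\<^sup>p\<close> times the power of \<open>\<eta>(\<tau>)\<close> with exponent \<open>p\<^sup>2 - 1\<close>. The sign by which \<open>H\<close> transforms
  depends only on the lower right entry \<open>d\<close> and occurs \<open>p + 1\<close> times, so it cancels.
\<close>

section \<open>Products in q\<close>

text \<open>At the cusp 0 only absolute values of eta are compared: |eta|^4 Im tau is invariant
  under SL_2(Z), so roots of unity never enter. There the j-th term of F at -1/(p tau) involves eta
  at (A tau + B)/D with A D = p^(beta+1) and p | A. With X = A/D its exponential order is r (p^(1-b)
  - X)/24, where p^(1-beta) <= X <= p^(beta+1). The value at the lower end (r >= 0) or at the upper
  end (r < 0), divided by \<open>pi_p p\<close>, is exactly \<open>y1_bound\<close>; this is the
  origin of the two formulas behind y_1.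

  The vanishing step avoids compactified curves and valence formulas: multiplying over the cosets
  gives a level one function with limit 0 at its only cusp, to which maximum modulus applies.

  The pairing of H(tau) with H(p tau) is there because r may be odd. For h at odd p the sign goes
  away more simply, since the exponent 24/gcd(12,p-1) is even.

  The primes in (ii) are those with p - 1 | 12, i.e. pi_p = 1; for them (B) is just the recursion
  that defines c.\<close>

definition qprod :: "complex \<Rightarrow> complex \<Rightarrow> complex" where
  "qprod q x = (\<Prod>n. 1 - q ^ Suc n * x)"

lemma convergent_prod_qprod:
  fixes q x :: complex
  assumes "norm q < 1"
  shows "convergent_prod (\<lambda>n. 1 - q ^ Suc n * x)"
proof -
  have "summable (\<lambda>n. norm q * norm x * norm q ^ n)"
    using assms by (intro summable_mult summable_geometric) auto
  hence "abs_convergent_prod (\<lambda>n. 1 - q ^ Suc n * x)"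
    unfolding abs_convergent_prod_conv_summable by (simp add: norm_mult norm_power mult_ac)
  thus ?thesis by (rule abs_convergent_prod_imp_convergent_prod)
qed

lemma qprod_LIMSEQ:
  assumes "norm q < 1"
  shows "(\<lambda>N. \<Prod>n<N. 1 - q ^ Suc n * x) \<longlonglongrightarrow> qprod q x"
  using convergent_prod_LIMSEQ[OF convergent_prod_qprod[OF assms, of x]]
  unfolding qprod_def LIMSEQ_lessThan_iff_atMost .

lemma qprod_nonzero:
  assumes "norm q < 1" and "\<And>n. q ^ Suc n * x \<noteq> 1"
  shows "qprod q x \<noteq> 0"
  unfolding qprod_def by (rule prodinf_nonzero[OF convergent_prod_qprod[OF assms(1)]]) (use assms(2) in auto)

lemma qprod_1_nonzero:
  assumes "norm q < 1"
  shows "qprod q 1 \<noteq> 0"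
proof (rule qprod_nonzero[OF assms])
  fix n
  have "norm (q ^ Suc n * 1) < 1"
    using assms by (simp add: norm_power power_less_one_iff del: power_Suc)
  thus "q ^ Suc n * 1 \<noteq> 1" by force
qed

lemma qprod_0 [simp]: "qprod 0 x = 1"
  by (simp add: qprod_def)

text \<open>The factor \<open>1 - x\<close> is left out of \<open>qprod\<close>, so that x = 1 gives
  the Euler product of eta; the shift x -> q x therefore releases a factor
  \<open>1 - q * x\<close>.\<close>

lemma qprod_split_head:
  assumes "norm q < 1"
  shows "qprod q x = (1 - q * x) * qprod q (q * x)"
proof (rule LIMSEQ_unique)
  show "(\<lambda>N. \<Prod>n<Suc N. 1 - q ^ Suc n * x) \<longlonglongrightarrow> qprod q x"
    using qprod_LIMSEQ[OF assms] by (rule LIMSEQ_Suc)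
  have "(\<lambda>N. (1 - q * x) * (\<Prod>n<N. 1 - q ^ Suc n * (q * x))) \<longlonglongrightarrow> (1 - q * x) * qprod q (q * x)"
    by (intro tendsto_mult tendsto_const qprod_LIMSEQ assms)
  thus "(\<lambda>N. \<Prod>n<Suc N. 1 - q ^ Suc n * x) \<longlonglongrightarrow> (1 - q * x) * qprod q (q * x)"
    by (simp only: prod.lessThan_Suc_shift) (simp add: mult_ac)
qed

lemma norm_power_lt_1: "norm (q :: complex) < 1 \<Longrightarrow> k > 0 \<Longrightarrow> norm (q ^ k) < 1"
  by (simp add: norm_power power_less_one_iff)

lemma qprod_mult_uminus:
  assumes "norm q < 1"
  shows "qprod q x * qprod q (-x) = qprod (q\<^sup>2) (x\<^sup>2)"
proof (rule LIMSEQ_unique)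
  show "(\<lambda>N. (\<Prod>n<N. 1 - q ^ Suc n * x) * (\<Prod>n<N. 1 - q ^ Suc n * (-x))) \<longlonglongrightarrow> qprod q x * qprod q (-x)"
    by (intro tendsto_mult qprod_LIMSEQ assms)
  have "(\<lambda>N. \<Prod>n<N. 1 - (q\<^sup>2) ^ Suc n * x\<^sup>2) \<longlonglongrightarrow> qprod (q\<^sup>2) (x\<^sup>2)"
    by (intro qprod_LIMSEQ norm_power_lt_1 assms) auto
  moreover have "(1 - q ^ Suc n * x) * (1 - q ^ Suc n * (-x)) = 1 - (q\<^sup>2) ^ Suc n * x\<^sup>2" for n
    by (simp only: power_mult[symmetric] mult.commute[of 2] power_mult power2_eq_square) (simp add: algebra_simps)
  ultimately show "(\<lambda>N. (\<Prod>n<N. 1 - q ^ Suc n * x) * (\<Prod>n<N. 1 - q ^ Suc n * (-x))) \<longlonglongrightarrow> qprod (q\<^sup>2) (x\<^sup>2)"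
    by (simp only: prod.distrib[symmetric])
qed

text \<open>Since \<open>(q\<^sup>2) ^ Suc n * inverse q\<close> is the odd power q^(2n+1), the two
  products on the right run over even and odd exponents.\<close>

lemma qprod_even_odd:
  assumes "norm q < 1" "q \<noteq> 0"
  shows "qprod q 1 = qprod (q\<^sup>2) 1 * qprod (q\<^sup>2) (inverse q)"
proof (rule LIMSEQ_unique)
  show "(\<lambda>N. \<Prod>n<2 * N. 1 - q ^ Suc n * 1) \<longlonglongrightarrow> qprod q 1"
    using LIMSEQ_subseq_LIMSEQ[OF qprod_LIMSEQ[OF assms(1), of 1], of "\<lambda>n. 2 * n"]
    by (simp add: o_def strict_mono_def)
  have "(\<lambda>N. (\<Prod>n<N. 1 - (q\<^sup>2) ^ Suc n * 1) * (\<Prod>n<N. 1 - (q\<^sup>2) ^ Suc n * inverse q))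
     \<longlonglongrightarrow> qprod (q\<^sup>2) 1 * qprod (q\<^sup>2) (inverse q)"
    by (intro tendsto_mult qprod_LIMSEQ norm_power_lt_1 assms) auto
  moreover have "(\<Prod>n<2 * N. 1 - q ^ Suc n * 1) =
      (\<Prod>n<N. 1 - (q\<^sup>2) ^ Suc n * 1) * (\<Prod>n<N. 1 - (q\<^sup>2) ^ Suc n * inverse q)" for N
  proof (induction N)
    case (Suc N)
    have *: "2 * Suc N = Suc (Suc (2 * N))" by simp
    show ?case unfolding * prod.lessThan_Suc Suc.IH
      using assms(2) by (simp add: power_mult power2_eq_square field_simps power_mult_distrib)
  qed auto
  ultimately show "(\<lambda>N. \<Prod>n<2 * N. 1 - q ^ Suc n * 1) \<longlonglongrightarrow> qprod (q\<^sup>2) 1 * qprod (q\<^sup>2) (inverse q)"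
    by simp
qed

text \<open>Weber's relation f f_1 f_2 = sqrt 2 at q = r^2, stripped of constants and powers of q:
  the factors are the products of 1 + q^n, 1 - q^(n-1/2) and 1 + q^(n-1/2). Multiplied by
  \<open>qprod (r\<^sup>2) 1\<close> they recombine, through q^2, into that same product.\<close>

lemma qprod_weber:
  assumes "norm r < 1" "r \<noteq> 0"
  shows "qprod (r\<^sup>2) (-1) * qprod (r\<^sup>2) (inverse r) * qprod (r\<^sup>2) (- inverse r) = 1"
proof -
  have q: "norm (r\<^sup>2) < 1" using norm_power_lt_1[OF assms(1)] by simp
  have 1: "qprod (r\<^sup>2) 1 * qprod (r\<^sup>2) (-1) = qprod ((r\<^sup>2)\<^sup>2) 1"
    using qprod_mult_uminus[OF q, of 1] by simp
  have 2: "qprod (r\<^sup>2) (inverse r) * qprod (r\<^sup>2) (- inverse r) = qprod ((r\<^sup>2)\<^sup>2) (inverse (r\<^sup>2))"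
    using qprod_mult_uminus[OF q, of "inverse r"] by (simp add: power_inverse)
  have 3: "qprod (r\<^sup>2) 1 = qprod ((r\<^sup>2)\<^sup>2) 1 * qprod ((r\<^sup>2)\<^sup>2) (inverse (r\<^sup>2))"
    using qprod_even_odd[OF q] assms by simp
  have "qprod (r\<^sup>2) 1 * (qprod (r\<^sup>2) (-1) * qprod (r\<^sup>2) (inverse r) * qprod (r\<^sup>2) (- inverse r)) = qprod (r\<^sup>2) 1 * 1"
    using 1 2 3 by (metis mult.assoc mult_1_right)
  thus ?thesis using qprod_1_nonzero[OF q] by simp
qed

lemma qprod_holomorphic:
  assumes "open S" "f holomorphic_on S" "g holomorphic_on S" "\<And>z. z \<in> S \<Longrightarrow> norm (f z) < 1"
  shows "(\<lambda>z. qprod (f z) (g z)) holomorphic_on S"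
proof (rule holomorphic_uniform_sequence[OF assms(1)])
  show "(\<lambda>z. \<Prod>n<N. 1 - f z ^ Suc n * g z) holomorphic_on S" for N
    by (intro holomorphic_intros assms)
  fix z assume "z \<in> S"
  then obtain d where d: "d > 0" "cball z d \<subseteq> S" using assms(1) open_contains_cball by blast
  have cf: "continuous_on (cball z d) f" and cg: "continuous_on (cball z d) g"
    using assms(2,3) d(2) by (meson continuous_on_subset holomorphic_on_imp_continuous_on)+
  \<comment> \<open>The maximum of |f| over the closed disc is attained, hence still below 1; it
    becomes the ratio of the geometric majorant.\<close>
  have "continuous_on (cball z d) (\<lambda>w. norm (f w))" by (intro continuous_intros cf)
  then obtain w0 where w0: "w0 \<in> cball z d" "\<And>w. w \<in> cball z d \<Longrightarrow> norm (f w) \<le> norm (f w0)"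
    using continuous_attains_sup[of "cball z d" "\<lambda>w. norm (f w)"] d by auto
  define \<rho> where "\<rho> = norm (f w0)"
  have \<rho>: "0 \<le> \<rho>" "\<rho> < 1" "\<And>w. w \<in> cball z d \<Longrightarrow> norm (f w) \<le> \<rho>"
    using w0 assms(4) d by (auto simp: \<rho>_def)
  have "continuous_on (cball z d) (\<lambda>w. norm (g w))" by (intro continuous_intros cg)
  then obtain w1 where w1: "w1 \<in> cball z d" "\<And>w. w \<in> cball z d \<Longrightarrow> norm (g w) \<le> norm (g w1)"
    using continuous_attains_sup[of "cball z d" "\<lambda>w. norm (g w)"] d by auto
  define M where "M = norm (g w1)"
  have "uniformly_convergent_on (cball z d) (\<lambda>N w. \<Prod>n<N. 1 - f w ^ Suc n * g w)"
  proof (rule uniformly_convergent_on_prod')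
    show "uniformly_convergent_on (cball z d) (\<lambda>N w. \<Sum>n<N. norm (1 - f w ^ Suc n * g w - 1))"
    proof (rule Weierstrass_m_test')
      fix n w assume w: "w \<in> cball z d"
      have "norm (f w) ^ Suc n * norm (g w) \<le> \<rho> ^ Suc n * M"
        using w \<rho> w1(2)[OF w] by (intro mult_mono power_mono) (auto simp: M_def)
      thus "norm (norm (1 - f w ^ Suc n * g w - 1)) \<le> \<rho> * M * \<rho> ^ n"
        by (simp add: norm_mult norm_power mult_ac)
    next
      show "summable (\<lambda>n. \<rho> * M * \<rho> ^ n)"
        using \<rho> by (intro summable_mult summable_geometric) auto
    qed
  qed (intro continuous_intros cf cg compact_cball)+
  then obtain l where l: "uniform_limit (cball z d) (\<lambda>N w. \<Prod>n<N. 1 - f w ^ Suc n * g w) l sequentially"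
    by (auto simp: uniformly_convergent_on_def)
  have "l w = qprod (f w) (g w)" if "w \<in> cball z d" for w
    using tendsto_uniform_limitI[OF l that] qprod_LIMSEQ[of "f w" "g w"] assms(4) that d
    by (meson LIMSEQ_unique subsetD)
  hence "uniform_limit (cball z d) (\<lambda>N w. \<Prod>n<N. 1 - f w ^ Suc n * g w) (\<lambda>w. qprod (f w) (g w)) sequentially"
    by (intro uniform_limit_cong'[THEN iffD1, OF refl _ l]) auto
  thus "\<exists>d>0. cball z d \<subseteq> S \<and> uniform_limit (cball z d) (\<lambda>N w. \<Prod>n<N. 1 - f w ^ Suc n * g w) (\<lambda>w. qprod (f w) (g w)) sequentially"
    using d by blast
qed

lemma qprod_eq_0_iff:
  assumes "norm q < 1"
  shows "qprod q x = 0 \<longleftrightarrow> (\<exists>n. q ^ Suc n * x = 1)"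
proof
  assume "\<exists>n. q ^ Suc n * x = 1"
  then obtain n where n: "q ^ Suc n * x = 1" by blast
  have "(\<lambda>N. \<Prod>n<N. 1 - q ^ Suc n * x) \<longlonglongrightarrow> 0"
  proof (rule tendsto_eventually, rule eventually_mono[OF eventually_gt_at_top[of n]])
    fix N assume "N > n"
    thus "(\<Prod>n<N. 1 - q ^ Suc n * x) = 0" using n by (intro prod_zero) auto
  qed
  thus "qprod q x = 0" using qprod_LIMSEQ[OF assms] LIMSEQ_unique by blast
qed (use qprod_nonzero[OF assms] in blast)

section \<open>The theta function\<close>

definition ee :: "complex \<Rightarrow> complex" where
  "ee z = exp (2 * of_real pi * \<i> * z)"

lemma ee_0 [simp]: "ee 0 = 1" and ee_nonzero [simp]: "ee z \<noteq> 0"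
  by (simp_all add: ee_def)

lemma ee_add: "ee (a + b) = ee a * ee b"
  by (simp add: ee_def exp_add ring_distribs)

lemma ee_minus: "ee (- a) = inverse (ee a)"
  by (simp add: ee_def exp_minus)

lemma ee_diff: "ee (a - b) = ee a / ee b"
  using ee_add[of a "-b"] by (simp add: ee_minus field_simps)

lemma ee_of_int [simp]: "ee (of_int n) = 1"
  using exp_integer_2pi[of "of_int n :: real"] by (simp add: ee_def mult_ac)

lemma ee_of_nat [simp]: "ee (of_nat n) = 1"
  using ee_of_int[of "int n"] by simp

lemma ee_1 [simp]: "ee 1 = 1"
  using ee_of_int[of 1] by simp

lemma ee_half [simp]: "ee (1 / 2) = - 1"
  by (simp add: ee_def)

lemma ee_power: "ee z ^ n = ee (of_nat n * z)"
  by (simp add: ee_def exp_of_nat_mult[symmetric] mult_ac)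

lemma ee_powi: "ee z powi n = ee (of_int n * z)"
proof (cases "n \<ge> 0")
  case True
  thus ?thesis by (simp add: power_int_def ee_power)
next
  case False
  hence "ee z powi n = inverse (ee (of_nat (nat (- n)) * z))"
    by (simp add: power_int_def ee_power power_inverse)
  thus ?thesis using False by (simp flip: ee_minus)
qed

lemma ee_eq_1_iff: "ee z = 1 \<longleftrightarrow> (\<exists>n::int. z = of_int n)"
proof
  assume "ee z = 1"
  then obtain n :: int where n: "2 * complex_of_real pi * \<i> * z = of_real (2 * of_int n * pi) * \<i>"
    unfolding ee_def exp_eq_1 by (auto simp: complex_eq_iff algebra_simps)
  have "(2 * complex_of_real pi * \<i>) * z = (2 * complex_of_real pi * \<i>) * of_int n"
    using n by (simp add: algebra_simps)
  thus "\<exists>n::int. z = of_int n" by (subst (asm) mult_cancel_left) auto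
qed auto

lemma norm_ee: "norm (ee z) = exp (- 2 * pi * Im z)"
  by (simp add: ee_def)

lemma norm_ee_less_1 [simp]: "Im \<tau> > 0 \<Longrightarrow> norm (ee \<tau>) < 1"
  by (simp add: norm_ee)

lemma ee_holomorphic [holomorphic_intros]: "f holomorphic_on S \<Longrightarrow> (\<lambda>z. ee (f z)) holomorphic_on S"
  unfolding ee_def by (intro holomorphic_intros)

text \<open>By the Jacobi triple product this is theta_1 as a function of q = e(tau) and x = e(z),
  up to elementary factors and \<open>qprod q 1\<close>.\<close>

definition qtheta :: "complex \<Rightarrow> complex \<Rightarrow> complex" where
  "qtheta q x = (1 - x) * qprod q x * qprod q (inverse x)"

lemma qtheta_mult:
  assumes "norm q < 1" "q \<noteq> 0" "x \<noteq> 0"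
  shows "qtheta q (q * x) = - inverse x * qtheta q x"
proof -
  have "q * inverse (q * x) = inverse x" using assms by simp
  hence "qprod q (inverse (q * x)) = (1 - inverse x) * qprod q (inverse x)"
    using qprod_split_head[OF assms(1), of "inverse (q * x)"] by (simp only:)
  moreover have "qprod q x = (1 - q * x) * qprod q (q * x)"
    by (rule qprod_split_head[OF assms(1)])
  ultimately have "qtheta q (q * x) = qprod q x * ((1 - inverse x) * qprod q (inverse x))"
    by (simp add: qtheta_def)
  also have "\<dots> = ((1 - inverse x) * qprod q x) * qprod q (inverse x)" by simp
  also have "1 - inverse x = - inverse x * (1 - x)" using assms(3) by (simp add: field_simps)
  finally show ?thesis by (simp add: qtheta_def)
qed

lemma qtheta_inverse: "x \<noteq> 0 \<Longrightarrow> qtheta q (inverse x) = - inverse x * qtheta q x"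
  by (simp add: qtheta_def field_simps)

text \<open>The factor \<open>ee (- z / 2)\<close> makes the function odd. The denominator is fixed
  by the slope at 0: there \<open>1 - ee z\<close> behaves like -2 pi i z and each of the two
  products equals \<open>qprod (ee \<tau>) 1\<close>.\<close>

definition Phi :: "complex \<Rightarrow> complex \<Rightarrow> complex" where
  "Phi \<tau> z = - ee (- z / 2) * qtheta (ee \<tau>) (ee z) / (2 * of_real pi * \<i> * qprod (ee \<tau>) 1 ^ 2)"

definition quasi_periodic :: "complex \<Rightarrow> (complex \<Rightarrow> complex) \<Rightarrow> bool" where
  "quasi_periodic \<tau> N \<longleftrightarrow> (\<forall>z. N (z + 1) = - N z) \<and> (\<forall>z. N (z + \<tau>) = - ee (- z - \<tau> / 2) * N z)"

lemma Phi_uminus: "Phi \<tau> (- z) = - Phi \<tau> z"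
proof -
  have "ee (z / 2) = ee (- (z / 2)) * ee z"
    by (simp flip: ee_add)
  thus ?thesis by (simp add: Phi_def ee_minus[of z] qtheta_inverse)
qed

lemma Phi_0 [simp]: "Phi \<tau> 0 = 0"
  by (simp add: Phi_def qtheta_def)

lemma quasi_periodic_Phi:
  assumes "Im \<tau> > 0"
  shows "quasi_periodic \<tau> (Phi \<tau>)"
  unfolding quasi_periodic_def
proof (intro conjI allI)
  fix z
  have "ee (- (z + 1) / 2) = ee (- z / 2 - 1 / 2)" by (simp add: diff_divide_distrib)
  also have "\<dots> = - ee (- z / 2)" by (simp add: ee_diff)
  finally show "Phi \<tau> (z + 1) = - Phi \<tau> z" by (simp add: Phi_def ee_add)
  have "ee (- (z + \<tau>) / 2) * inverse (ee z) = ee (- z - \<tau> / 2) * ee (- z / 2)"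
    by (subst ee_minus[symmetric], subst ee_add[symmetric], subst ee_add[symmetric],
        rule arg_cong[where f = ee], simp add: field_simps)
  hence "ee (- (z + \<tau>) / 2) = ee z * ee (- z - \<tau> / 2) * ee (- z / 2)"
    by (simp add: field_simps)
  moreover have "qtheta (ee \<tau>) (ee (z + \<tau>)) = - inverse (ee z) * qtheta (ee \<tau>) (ee z)"
    using qtheta_mult[of "ee \<tau>" "ee z"] assms by (simp add: ee_add mult.commute)
  ultimately show "Phi \<tau> (z + \<tau>) = - ee (- z - \<tau> / 2) * Phi \<tau> z"
    by (simp add: Phi_def)
qed

text \<open>Iterating the rule for tau, the exponents -z - k tau - tau/2 for k < m add up to an
  expression quadratic in m.\<close>

lemma quasi_periodic_lattice:
  assumes "quasi_periodic \<tau> N"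
  shows "N (z + of_int m * \<tau> + of_int n) =
    ee (of_int (m + n) / 2 - of_int m * z - of_int m ^ 2 * \<tau> / 2) * N z"
proof -
  have 1: "N (z + 1) = - N z" and 2: "N (z + \<tau>) = - ee (- z - \<tau> / 2) * N z" for z
    using assms by (auto simp: quasi_periodic_def)
  have A: "N (z + of_int n) = ee (of_int n / 2) * N z" for z
  proof (induction n rule: int_induct[where k = 0])
    case (step1 i)
    have "N (z + of_int (i + 1)) = - N (z + of_int i)" using 1[of "z + of_int i"] by (simp add: add_ac)
    thus ?case by (simp add: step1 add_divide_distrib ee_add)
  next
    case (step2 i)
    have "N (z + of_int i) = - N (z + of_int (i - 1))" using 1[of "z + of_int (i - 1)"] by (simp add: add_ac)
    thus ?case using step2 by (simp add: diff_divide_distrib ee_diff)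
  qed simp
  have B: "N (z + of_int m * \<tau>) = ee (of_int m / 2 - of_int m * z - of_int m ^ 2 * \<tau> / 2) * N z"
  proof (induction m rule: int_induct[where k = 0])
    case (step1 i)
    have "N (z + of_int (i + 1) * \<tau>) = - ee (- z - of_int i * \<tau> - \<tau> / 2) * N (z + of_int i * \<tau>)"
      using 2[of "z + of_int i * \<tau>"] by (simp add: algebra_simps)
    also have "\<dots> = (ee (1 / 2) * ee (- z - of_int i * \<tau> - \<tau> / 2) *
        ee (of_int i / 2 - of_int i * z - of_int i ^ 2 * \<tau> / 2)) * N z" by (simp add: step1)
    also have "ee (1 / 2) * ee (- z - of_int i * \<tau> - \<tau> / 2) *
        ee (of_int i / 2 - of_int i * z - of_int i ^ 2 * \<tau> / 2) =
        ee (of_int (i + 1) / 2 - of_int (i + 1) * z - of_int (i + 1) ^ 2 * \<tau> / 2)"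
      by ((subst ee_add[symmetric])+, rule arg_cong[where f = ee], simp add: field_simps power2_eq_square)
    finally show ?case .
  next
    case (step2 i)
    have "N (z + of_int i * \<tau>) = - ee (- z - of_int (i - 1) * \<tau> - \<tau> / 2) * N (z + of_int (i - 1) * \<tau>)"
      using 2[of "z + of_int (i - 1) * \<tau>"] by (simp add: algebra_simps)
    hence "ee (1 / 2) * ee (- z - of_int (i - 1) * \<tau> - \<tau> / 2) * N (z + of_int (i - 1) * \<tau>) =
        ee (of_int i / 2 - of_int i * z - of_int i ^ 2 * \<tau> / 2) * N z" using step2 by simp
    also have "ee (of_int i / 2 - of_int i * z - of_int i ^ 2 * \<tau> / 2) =
      ee (1 / 2) * ee (- z - of_int (i - 1) * \<tau> - \<tau> / 2) *
        ee (of_int (i - 1) / 2 - of_int (i - 1) * z - of_int (i - 1) ^ 2 * \<tau> / 2)"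
      by ((subst ee_add[symmetric])+, rule arg_cong[where f = ee], simp add: field_simps power2_eq_square)
    finally show ?case by simp
  qed simp
  show ?thesis
    by (subst A, subst B, subst mult.assoc[symmetric], subst ee_add[symmetric], rule arg_cong[where f = "\<lambda>x. ee x * N z"])
       (simp add: field_simps)
qed

lemma Phi_holomorphic:
  assumes "Im \<tau> > 0"
  shows "Phi \<tau> holomorphic_on S"
proof -
  have "Phi \<tau> holomorphic_on UNIV"
    unfolding Phi_def qtheta_def using assms qprod_1_nonzero[of "ee \<tau>"]
    by (intro holomorphic_intros qprod_holomorphic) auto
  thus ?thesis by (rule holomorphic_on_subset) auto
qed

lemma Phi_has_field_derivative_0:
  assumes "Im \<tau> > 0"
  shows "(Phi \<tau> has_field_derivative 1) (at 0)"
proof -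
  define C where "C = (\<lambda>z. qprod (ee \<tau>) (ee z) * qprod (ee \<tau>) (inverse (ee z)) / qprod (ee \<tau>) 1 ^ 2)"
  define s where "s = (\<lambda>z. - ee (- z / 2) * (1 - ee z) / (2 * of_real pi * \<i>))"
  have nz: "qprod (ee \<tau>) 1 \<noteq> 0" using qprod_1_nonzero assms by simp
  have "C holomorphic_on UNIV"
    unfolding C_def using assms nz by (intro holomorphic_intros qprod_holomorphic) auto
  then obtain C' where C': "(C has_field_derivative C') (at 0)"
    by (meson UNIV_I field_differentiable_def holomorphic_on_imp_differentiable_at open_UNIV)
  have "(s has_field_derivative 1) (at 0)"
    unfolding s_def ee_def by (rule derivative_eq_intros refl | simp)+
  from DERIV_mult[OF this C'] have "((\<lambda>z. s z * C z) has_field_derivative 1) (at 0)"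
    using nz by (simp add: s_def C_def power2_eq_square)
  moreover have "(\<lambda>z. s z * C z) = Phi \<tau>"
    by (auto simp: s_def C_def Phi_def qtheta_def fun_eq_iff)
  ultimately show ?thesis by simp
qed

lemma Phi_zero_lattice:
  assumes "Im \<tau> > 0" "Phi \<tau> z = 0"
  shows "\<exists>m n :: int. z = of_int m * \<tau> + of_int n"
proof -
  have q: "norm (ee \<tau>) < 1" using assms by simp
  from assms qprod_1_nonzero[OF q] have "qtheta (ee \<tau>) (ee z) = 0" by (simp add: Phi_def)
  then consider "ee z = 1" | n where "ee \<tau> ^ Suc n * ee z = 1" | n where "ee \<tau> ^ Suc n * inverse (ee z) = 1"
    unfolding qtheta_def using q by (auto simp: qprod_eq_0_iff)
  thus ?thesis
  proof cases
    case 1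
    then obtain n :: int where "z = of_int n" using ee_eq_1_iff by blast
    thus ?thesis by (intro exI[of _ 0] exI[of _ n]) auto
  next
    case (2 n)
    hence "ee (of_nat (Suc n) * \<tau> + z) = 1" by (simp only: ee_power ee_add)
    then obtain k :: int where "of_nat (Suc n) * \<tau> + z = of_int k" using ee_eq_1_iff by blast
    hence "z = of_int (- int (Suc n)) * \<tau> + of_int k" by (simp add: algebra_simps)
    thus ?thesis by blast
  next
    case (3 n)
    hence "ee (of_nat (Suc n) * \<tau> + - z) = 1" by (simp only: ee_power ee_add ee_minus)
    then obtain k :: int where "of_nat (Suc n) * \<tau> + - z = of_int k" using ee_eq_1_iff by blast
    hence "z = of_int (int (Suc n)) * \<tau> + of_int (- k)" by (simp add: algebra_simps)
    thus ?thesis by blast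
  qed
qed

lemma lattice_reduce:
  assumes "Im \<tau> > 0"
  obtains m n :: int and s t :: real where "z = of_real s * \<tau> + of_real t + of_int m * \<tau> + of_int n"
    "0 \<le> s" "s \<le> 1" "0 \<le> t" "t \<le> 1"
proof -
  define x where "x = Im z / Im \<tau>"
  define y where "y = Re z - x * Re \<tau>"
  have "z = of_real x * \<tau> + of_real y"
    using assms by (simp add: complex_eq_iff x_def y_def)
  also have "\<dots> = of_real (frac x) * \<tau> + of_real (frac y) + of_int \<lfloor>x\<rfloor> * \<tau> + of_int \<lfloor>y\<rfloor>"
    by (simp add: frac_def algebra_simps)
  finally show ?thesis
    by (intro that[of "frac x" "frac y"]) (auto intro: less_imp_le[OF frac_lt_1])
qed

text \<open>
  The quotient of \<open>N\<close> by \<open>Phi \<tau>\<close> extends to a doubly periodic entire function, hence is constant.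
\<close>

theorem Phi_unique:
  assumes \<tau>: "Im \<tau> > 0" and N: "N holomorphic_on UNIV" "quasi_periodic \<tau> N"
    and N0: "N 0 = 0" "(N has_field_derivative 1) (at 0)"
  shows "N = Phi \<tau>"
proof -
  define L where "L = {z. Phi \<tau> z = 0}"
  \<comment> \<open>The value 1 on the zero set is the limit of N/Phi at 0, where both have
    derivative 1; periodicity carries it to the other lattice points.\<close>
  define Q where "Q = (\<lambda>z. if z \<in> L then 1 else N z / Phi \<tau> z)"
  note qP = quasi_periodic_lattice[OF quasi_periodic_Phi[OF \<tau>]]
  note qN = quasi_periodic_lattice[OF N(2)]
  have L_shift: "z + of_int m * \<tau> + of_int n \<in> L \<longleftrightarrow> z \<in> L" for z m n
    unfolding L_def by (simp add: qP)
  have L_lat: "z \<in> L \<Longrightarrow> \<exists>m n::int. z = of_int m * \<tau> + of_int n" for z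
    unfolding L_def using Phi_zero_lattice[OF \<tau>] by auto
  have Q_shift: "Q (z + of_int m * \<tau> + of_int n) = Q z" for z m n
    unfolding Q_def L_shift by (simp add: qP qN)
  have hPhi: "Phi \<tau> holomorphic_on UNIV" by (rule Phi_holomorphic[OF \<tau>])
  have clL: "closed L"
  proof -
    have "continuous_on UNIV (Phi \<tau>)" using hPhi by (rule holomorphic_on_imp_continuous_on)
    hence "closed (Phi \<tau> -` {0})" by (intro continuous_closed_vimage) (auto simp: continuous_on_eq_continuous_at)
    moreover have "Phi \<tau> -` {0} = L" by (auto simp: L_def)
    ultimately show ?thesis by simp
  qed
  have hol1: "Q holomorphic_on (- L)"
  proof -
    have "(\<lambda>z. N z / Phi \<tau> z) holomorphic_on (- L)"
      using holomorphic_on_subset[OF N(1), of "-L"] holomorphic_on_subset[OF hPhi, of "-L"]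
      by (intro holomorphic_intros) (auto simp: L_def)
    thus ?thesis by (rule holomorphic_transform) (auto simp: Q_def)
  qed
  have limN: "((\<lambda>h. N h / h) \<longlongrightarrow> 1) (at 0)" and limP: "((\<lambda>h. Phi \<tau> h / h) \<longlongrightarrow> 1) (at 0)"
    using N0 Phi_has_field_derivative_0[OF \<tau>] by (auto simp: has_field_derivative_iff)
  have "eventually (\<lambda>h. Phi \<tau> h / h \<noteq> 0) (at 0)"
    using tendsto_imp_eventually_ne[OF limP, of 0] by auto
  hence ev: "eventually (\<lambda>h. h \<notin> L) (at 0)"
    by eventually_elim (auto simp: L_def)
  have Q_lim: "(Q \<longlongrightarrow> 1) (at 0)"
  proof -
    have "((\<lambda>h. (N h / h) / (Phi \<tau> h / h)) \<longlongrightarrow> 1 / 1) (at 0)"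
      by (intro tendsto_divide limN limP) auto
    moreover have "eventually (\<lambda>h. (N h / h) / (Phi \<tau> h / h) = Q h) (at 0)"
      using ev eventually_neq_at_within[of 0 0 UNIV] by eventually_elim (auto simp: Q_def)
    ultimately show ?thesis by (auto intro: Lim_transform_eventually)
  qed
  obtain d where d: "d > 0" "\<And>h. h \<noteq> 0 \<Longrightarrow> dist h 0 < d \<Longrightarrow> h \<notin> L"
    using ev unfolding eventually_at by auto
  have hol0: "Q holomorphic_on ball 0 d"
  proof (rule no_isolated_singularity')
    show "Q holomorphic_on (ball 0 d - {0})"
      by (rule holomorphic_on_subset[OF hol1]) (use d in \<open>auto simp: dist_commute\<close>)
    show "(Q \<longlongrightarrow> Q z) (at z within ball 0 d)" if "z \<in> {0}" for z
      using that Q_lim by (auto simp: Q_def L_def intro: tendsto_within_subset)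
  qed auto
  have diff: "Q field_differentiable at z" for z
  proof (cases "z \<in> L")
    case False
    thus ?thesis using hol1 clL by (auto intro: holomorphic_on_imp_differentiable_at)
  next
    case True
    then obtain m n :: int where mn: "z = of_int m * \<tau> + of_int n" using L_lat by blast
    \<comment> \<open>Translation by a lattice point turns the singularity at z into the one at 0,
      which is already removed.\<close>
    have eq: "Q = Q \<circ> (\<lambda>w. w - z)"
    proof
      fix w show "Q w = (Q \<circ> (\<lambda>w. w - z)) w"
        using Q_shift[of "w - z" m n] mn by (simp add: algebra_simps)
    qed
    have "Q field_differentiable at (z - z)"
      using holomorphic_on_imp_differentiable_at[OF hol0, of 0] d by auto
    moreover have "(\<lambda>w. w - z) field_differentiable at z" by (intro derivative_intros) 
    ultimately show ?thesis by (subst eq, intro field_differentiable_compose) auto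
  qed
  have holQ: "Q holomorphic_on UNIV"
    using diff by (auto simp: holomorphic_on_def field_differentiable_at_within)
  have "bounded (range Q)"
  proof -
    \<comment> \<open>The closed period parallelogram: a bound on it is a global bound by
      periodicity.\<close>
    define K where "K = (\<lambda>(s, t). of_real s * \<tau> + of_real t) ` ({0..1::real} \<times> {0..1::real})"
    have "compact K" unfolding K_def
      by (intro compact_continuous_image compact_Times compact_Icc)
         (auto intro!: continuous_intros simp: case_prod_unfold)
    moreover have "continuous_on K Q"
      using holomorphic_on_imp_continuous_on[OF holQ] continuous_on_subset by blast
    ultimately have "bounded (Q ` K)" by (intro compact_imp_bounded compact_continuous_image)
    moreover have "range Q \<subseteq> Q ` K"
    proof safe
      fix z
      obtain m n :: int and s t :: real where st: "z = of_real s * \<tau> + of_real t + of_int m * \<tau> + of_int n"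
        "0 \<le> s" "s \<le> 1" "0 \<le> t" "t \<le> 1" by (rule lattice_reduce[OF \<tau>, of z])
      hence "Q z = Q (of_real s * \<tau> + of_real t)" by (simp add: Q_shift)
      thus "Q z \<in> Q ` K" using st by (force simp: K_def)
    qed
    ultimately show ?thesis by (rule bounded_subset)
  qed
  with holQ have "Q constant_on UNIV" by (rule Liouville_theorem)
  hence Q1: "Q z = Q 0" for z by (auto simp: constant_on_def)
  show ?thesis
  proof
    fix z
    show "N z = Phi \<tau> z"
    proof (cases "z \<in> L")
      case True
      then obtain m n :: int where mn: "z = of_int m * \<tau> + of_int n" using L_lat by blast
      have "N z = 0" using qN[of 0 m n] N0 mn by simp
      thus ?thesis using True by (simp add: L_def)
    next
      case False
      have "Q z = 1" using Q1[of z] by (simp add: Q_def L_def)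
      thus ?thesis using False by (simp add: Q_def L_def)
    qed
  qed
qed

section \<open>Klein forms and the discriminant\<close>

definition mob :: "int \<Rightarrow> int \<Rightarrow> int \<Rightarrow> int \<Rightarrow> complex \<Rightarrow> complex" where
  "mob a b c d \<tau> = (of_int a * \<tau> + of_int b) / (of_int c * \<tau> + of_int d)"

lemma mob_denom_nonzero:
  assumes "a * d - b * c = 1" "Im \<tau> > 0"
  shows "of_int c * \<tau> + of_int d \<noteq> (0 :: complex)"
proof
  assume *: "of_int c * \<tau> + of_int d = 0"
  hence "of_int c * Im \<tau> = 0" by (metis Im_complex_of_real add.right_neutral complex_Re_of_int
      complex_Im_of_int mult_zero_left plus_complex.simps(2) times_complex.simps(2) zero_complex.simps(2))
  hence "c = 0" using assms(2) by simp
  with * have "d = 0" by simp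
  with \<open>c = 0\<close> assms(1) show False by simp
qed

lemma Im_mob:
  assumes "a * d - b * c = 1" "Im \<tau> > 0"
  shows "Im (mob a b c d \<tau>) = Im \<tau> / norm (of_int c * \<tau> + of_int d) ^ 2"
proof -
  have 1: "(of_int a * of_int d - of_int b * of_int c :: real) = 1"
    using assms(1) by (metis of_int_1 of_int_diff of_int_mult)
  have "Im (of_int a * \<tau> + of_int b) * Re (of_int c * \<tau> + of_int d) - Re (of_int a * \<tau> + of_int b) * Im (of_int c * \<tau> + of_int d)
    = Im \<tau> * (of_int a * of_int d - of_int b * of_int c)"
    by (simp add: algebra_simps)
  hence "Im (of_int a * \<tau> + of_int b) * Re (of_int c * \<tau> + of_int d) - Re (of_int a * \<tau> + of_int b) * Im (of_int c * \<tau> + of_int d) = Im \<tau>"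
    unfolding 1 by simp
  thus ?thesis unfolding mob_def by (simp only: Im_divide cmod_power2)
qed

lemma Im_mob_pos:
  assumes "a * d - b * c = 1" "Im \<tau> > 0"
  shows "Im (mob a b c d \<tau>) > 0"
  using Im_mob[OF assms] mob_denom_nonzero[OF assms] assms(2) by simp

lemma ee_half_int: "ee (of_int n / 2) = (if even n then 1 else - 1)"
proof (cases "even n")
  case True
  then obtain k where "n = 2 * k" by auto
  thus ?thesis by simp
next
  case False
  then obtain k where "n = 2 * k + 1" by (auto elim: oddE)
  thus ?thesis by (simp add: add_divide_distrib ee_add)
qed

text \<open>With the Gaussian moved to the left, both sides have the same quasi-periods in z: 1/J
  and tau/J are integral combinations of 1 and the transformed point, and the Gaussian accounts for
  the change of multipliers. Both are normalised at 0, so \<open>Phi_unique\<close> identifies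
  them.\<close>

lemma Phi_mob:
  fixes a b c d :: int
  assumes det: "a * d - b * c = 1" and \<tau>: "Im \<tau> > 0"
  defines "J \<equiv> of_int c * \<tau> + of_int d"
  shows "J * Phi (mob a b c d \<tau>) (z / J) = ee (of_int c * z ^ 2 / (2 * J)) * Phi \<tau> z"
proof -
  define t where "t = mob a b c d \<tau>"
  define N where "N = (\<lambda>z. J * Phi t (z / J) * ee (- of_int c * z ^ 2 / (2 * J)))"
  have J: "J \<noteq> 0" unfolding J_def by (rule mob_denom_nonzero[OF det \<tau>])
  have t: "Im t > 0" unfolding t_def by (rule Im_mob_pos[OF det \<tau>])
  have det': "of_int a * of_int d - of_int b * of_int c = (1 :: complex)"
    using det by (metis of_int_1 of_int_diff of_int_mult)
  have tJ: "t = (of_int a * \<tau> + of_int b) / J" by (simp add: t_def mob_def J_def)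
  have "1 + of_int c * (of_int a * \<tau> + of_int b) = of_int a * J"
    using det' by (simp add: J_def algebra_simps)
  \<comment> \<open>Read off from the inverse matrix (d, -b; -c, a), as is the formula for tau / J
    below.\<close>
  hence inv: "1 / J = of_int (- c) * t + of_int a"
    using J by (simp add: tJ divide_simps) (simp add: algebra_simps)
  have "\<tau> + of_int b * J = of_int d * (of_int a * \<tau> + of_int b)"
    using arg_cong[OF det', of "\<lambda>x. x * \<tau>"] by (simp add: J_def algebra_simps)
  hence tau: "\<tau> / J = of_int d * t + of_int (- b)"
    using J by (simp add: tJ divide_simps) (simp add: algebra_simps)
  note q = quasi_periodic_lattice[OF quasi_periodic_Phi[OF t]]
  have "N = Phi \<tau>"
  proof (rule Phi_unique[OF \<tau>])
    show "N holomorphic_on UNIV"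
    proof -
      have "(Phi t \<circ> (\<lambda>z. z / J)) holomorphic_on UNIV"
        using J by (intro holomorphic_on_compose Phi_holomorphic t holomorphic_intros) auto
      thus ?thesis unfolding N_def o_def using J by (intro holomorphic_intros) auto
    qed
    show "N 0 = 0" by (simp add: N_def)
    have D1: "((\<lambda>z. Phi t (z / J)) has_field_derivative 1 * (1 / J)) (at 0)"
      by (rule DERIV_chain2[where f = "Phi t" and g = "\<lambda>z. z / J"])
         (use Phi_has_field_derivative_0[OF t] J in \<open>auto intro!: derivative_eq_intros\<close>)
    have D2: "((\<lambda>z. ee (- of_int c * z ^ 2 / (2 * J))) has_field_derivative 0) (at 0)"
      unfolding ee_def using J by (auto intro!: derivative_eq_intros)
    show "(N has_field_derivative 1) (at 0)"
      using DERIV_mult[OF DERIV_cmult[OF D1, of J] D2] J by (simp add: N_def)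
    show "quasi_periodic \<tau> N" unfolding quasi_periodic_def
    proof (intro conjI allI)
      fix z
      \<comment> \<open>These parities give the signs left over after the shifts by 1 and tau. The
        number a - c - a c is even only if a and c both are, which the determinant excludes;
        likewise for d and b.\<close>
      have par: "odd (a - c - a * c)" "odd (d - b - b * d)"
        using det by (metis dvd_diff even_mult_iff odd_add odd_one even_diff)+
      have "Phi t ((z + 1) / J) = Phi t (z / J + of_int (- c) * t + of_int a)"
        by (simp add: add_divide_distrib inv algebra_simps)
      also have "\<dots> = ee (of_int (- c + a) / 2 - of_int (- c) * (z / J) - of_int (- c) ^ 2 * t / 2) * Phi t (z / J)"
        by (rule q)
      finally have 1: "N (z + 1) = J * (ee (of_int (- c + a) / 2 - of_int (- c) * (z / J) - of_int (- c) ^ 2 * t / 2) *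
         ee (- of_int c * (z + 1) ^ 2 / (2 * J))) * Phi t (z / J)" by (simp add: N_def)
      have "of_int (- c + a) / 2 - of_int (- c) * (z / J) - of_int (- c) ^ 2 * t / 2 + - of_int c * (z + 1) ^ 2 / (2 * J)
         = - of_int c * z ^ 2 / (2 * J) + (of_int (a - c) - of_int c * (of_int c * t + 1 / J)) / 2"
        using J by (simp add: field_simps power2_eq_square)
      also have "of_int c * t + 1 / J = of_int a" by (simp add: inv)
      finally have e: "of_int (- c + a) / 2 - of_int (- c) * (z / J) - of_int (- c) ^ 2 * t / 2 + - of_int c * (z + 1) ^ 2 / (2 * J)
         = - of_int c * z ^ 2 / (2 * J) + of_int (a - c - a * c) / 2" by (simp add: mult.commute)
      show "N (z + 1) = - N z" unfolding 1 ee_add[symmetric] e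
        using par by (simp only: ee_add ee_half_int N_def) simp
      have "Phi t ((z + \<tau>) / J) = Phi t (z / J + of_int d * t + of_int (- b))"
        by (simp add: add_divide_distrib tau algebra_simps)
      also have "\<dots> = ee (of_int (d + - b) / 2 - of_int d * (z / J) - of_int d ^ 2 * t / 2) * Phi t (z / J)"
        by (rule q)
      finally have 2: "N (z + \<tau>) = J * (ee (of_int (d + - b) / 2 - of_int d * (z / J) - of_int d ^ 2 * t / 2) *
         ee (- of_int c * (z + \<tau>) ^ 2 / (2 * J))) * Phi t (z / J)" by (simp add: N_def)
      have "of_int (d + - b) / 2 - of_int d * (z / J) - of_int d ^ 2 * t / 2 + - of_int c * (z + \<tau>) ^ 2 / (2 * J)
        = - of_int c * z ^ 2 / (2 * J) + of_int (d - b) / 2 - z * ((of_int c * \<tau> + of_int d) / J)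
          - (of_int d * (of_int d * t) + \<tau> * (of_int c * \<tau> / J)) / 2"
        using J by (simp add: field_simps power2_eq_square)
      also have "of_int d * t = \<tau> / J + of_int b" using tau by simp
      also have "of_int d * (\<tau> / J + of_int b) + \<tau> * (of_int c * \<tau> / J) = \<tau> * ((of_int c * \<tau> + of_int d) / J) + of_int (b * d)"
        by (simp add: add_divide_distrib algebra_simps)
      also have "(of_int c * \<tau> + of_int d) / J = 1" using J by (simp add: J_def)
      finally have e: "of_int (d + - b) / 2 - of_int d * (z / J) - of_int d ^ 2 * t / 2 + - of_int c * (z + \<tau>) ^ 2 / (2 * J)
        = - of_int c * z ^ 2 / (2 * J) + (- z - \<tau> / 2) + of_int (d - b - b * d) / 2"
        by (simp add: field_simps)
      show "N (z + \<tau>) = - ee (- z - \<tau> / 2) * N z" unfolding 2 ee_add[symmetric] e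
        using par by (simp only: ee_add ee_half_int N_def) simp
    qed
  qed
  hence "Phi \<tau> z = N z" by simp
  thus ?thesis unfolding N_def t_def by (simp add: ee_minus)
qed

text \<open>The Klein form of weight -1 at z = x tau + y. With the exponential as correction,
  SL_2(Z) acts by linear substitution on the coordinates (x, y), and shifts of x and y by integers
  only produce constants.\<close>

definition Klein :: "complex \<Rightarrow> complex \<Rightarrow> complex \<Rightarrow> complex" where
  "Klein \<tau> x y = ee (x * (x * \<tau> + y) / 2) * Phi \<tau> (x * \<tau> + y)"

theorem Klein_mob:
  fixes a b c d :: int
  assumes det: "a * d - b * c = 1" and \<tau>: "Im \<tau> > 0"
  shows "(of_int c * \<tau> + of_int d) * Klein (mob a b c d \<tau>) x y =
         Klein \<tau> (x * of_int a + y * of_int c) (x * of_int b + y * of_int d)"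
proof -
  define J where "J = of_int c * \<tau> + of_int d"
  define z where "z = (x * of_int a + y * of_int c) * \<tau> + (x * of_int b + y * of_int d)"
  have J: "J \<noteq> 0" unfolding J_def by (rule mob_denom_nonzero[OF det \<tau>])
  have det': "of_int a * of_int d - of_int b * of_int c = (1 :: complex)"
    using det by (metis of_int_1 of_int_diff of_int_mult)
  have zJ: "x * mob a b c d \<tau> + y = z / J"
    using J by (simp add: mob_def z_def J_def field_simps)
  have "x * (z / J) / 2 + of_int c * z ^ 2 / (2 * J) = z * (x + of_int c * z) / (2 * J)"
    using J by (simp add: divide_simps) (simp add: algebra_simps power2_eq_square)
  \<comment> \<open>Here the determinant enters: x + c z is a multiple of J, which clears the
    denominator of the exponent.\<close>
  also have "x + of_int c * z = x * (of_int a * of_int d - of_int b * of_int c) + of_int c * z"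
    using det' by simp
  also have "\<dots> = (x * of_int a + y * of_int c) * J"
    by (simp add: z_def J_def algebra_simps)
  finally have e: "x * (z / J) / 2 + of_int c * z ^ 2 / (2 * J) = (x * of_int a + y * of_int c) * z / 2"
    using J by simp
  have "J * Klein (mob a b c d \<tau>) x y = ee (x * (z / J) / 2) * (J * Phi (mob a b c d \<tau>) (z / J))"
    by (simp add: Klein_def zJ)
  also have "\<dots> = ee (x * (z / J) / 2 + of_int c * z ^ 2 / (2 * J)) * Phi \<tau> z"
    using Phi_mob[OF det \<tau>, of z] by (simp add: J_def[symmetric] ee_add)
  also have "\<dots> = Klein \<tau> (x * of_int a + y * of_int c) (x * of_int b + y * of_int d)"
    by (subst e) (simp add: Klein_def z_def)
  finally show ?thesis by (simp add: J_def)
qed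

text \<open>All terms of the exponent that involve tau cancel; for rational x and y the multiplier
  is a root of unity.\<close>

lemma Klein_shift:
  assumes "Im \<tau> > 0"
  shows "Klein \<tau> (x + of_int m) (y + of_int n) =
    ee ((of_int (m * n + m + n) + x * of_int n - y * of_int m) / 2) * Klein \<tau> x y"
proof -
  have "Phi \<tau> ((x + of_int m) * \<tau> + (y + of_int n)) = Phi \<tau> (x * \<tau> + y + of_int m * \<tau> + of_int n)"
    by (simp add: algebra_simps)
  also have "\<dots> = ee (of_int (m + n) / 2 - of_int m * (x * \<tau> + y) - of_int m ^ 2 * \<tau> / 2) * Phi \<tau> (x * \<tau> + y)"
    by (rule quasi_periodic_lattice[OF quasi_periodic_Phi[OF assms]])
  finally have *: "Phi \<tau> ((x + of_int m) * \<tau> + (y + of_int n)) = \<dots>" .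
  have e: "(x + of_int m) * ((x + of_int m) * \<tau> + (y + of_int n)) / 2 +
       (of_int (m + n) / 2 - of_int m * (x * \<tau> + y) - of_int m ^ 2 * \<tau> / 2) =
      (of_int (m * n + m + n) + x * of_int n - y * of_int m) / 2 + x * (x * \<tau> + y) / 2"
    by (simp add: field_simps power2_eq_square)
  show ?thesis unfolding Klein_def * mult.assoc[symmetric] ee_add[symmetric] e ..
qed

lemma Klein_uminus: "Klein \<tau> (- x) (- y) = - Klein \<tau> x y"
  using Phi_uminus[of \<tau> "x * \<tau> + y"] by (simp add: Klein_def algebra_simps)

section \<open>The eta function and the transformation law of the discriminant\<close>

lemma dedekind_eta_eq: "dedekind_eta \<tau> = ee (\<tau> / 24) * qprod (ee \<tau>) 1"
proof -
  have "qpow (of_nat (Suc n)) \<tau> = ee \<tau> ^ Suc n * 1" for n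
    unfolding ee_power by (simp only: qpow_def ee_def of_rat_of_nat_eq mult_ac mult_1_right mult_1_left)
  moreover have "qpow (1 / 24) \<tau> = ee (\<tau> / 24)"
    by (simp add: qpow_def ee_def of_rat_divide mult_ac)
  ultimately show ?thesis by (simp only: dedekind_eta_def qprod_def)
qed

lemma dedekind_eta_nonzero: "Im \<tau> > 0 \<Longrightarrow> dedekind_eta \<tau> \<noteq> 0"
  using qprod_1_nonzero[of "ee \<tau>"] by (simp add: dedekind_eta_eq)

text \<open>Each of the three values is, up to constants and powers of q, the square of one of the
  products in \<open>qprod_weber\<close> over \<open>qprod q 1\<close> squared. Weber's relation
  removes the numerators, and the powers of q add up to q^(-1/4), so eta^(-6) remains.\<close>

lemma Klein_two_torsion:
  assumes "Im \<tau> > 0"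
  shows "Klein \<tau> 0 (1/2) * Klein \<tau> (1/2) 0 * Klein \<tau> (1/2) (1/2) * dedekind_eta \<tau> ^ 6 =
    - 2 * ee (- 1 / 4) * ee (- 1 / 8) / (2 * of_real pi * \<i>) ^ 3"
proof -
  define \<rho> where "\<rho> = ee (\<tau> / 2)"
  define E where "E = qprod (\<rho>\<^sup>2)"
  define w where "w = 2 * of_real pi * \<i>"
  have w: "w \<noteq> 0" by (simp add: w_def)
  have \<rho>2: "ee \<tau> = \<rho>\<^sup>2" by (simp add: \<rho>_def ee_power)
  have \<rho>: "\<rho> \<noteq> 0" "norm \<rho> < 1" using assms by (auto simp: \<rho>_def)
  have q: "norm (\<rho>\<^sup>2) < 1" using assms \<rho>2 by (metis norm_ee_less_1)
  have E1: "E 1 \<noteq> 0" using qprod_1_nonzero[OF q] by (simp add: E_def)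
  have ri: "\<rho>\<^sup>2 * inverse \<rho> = \<rho>" using \<rho> by (simp add: power2_eq_square)
  have r1: "E (inverse \<rho>) = (1 - \<rho>) * E \<rho>" "E (- inverse \<rho>) = (1 + \<rho>) * E (- \<rho>)"
    using qprod_split_head[OF q, of "inverse \<rho>"] qprod_split_head[OF q, of "- inverse \<rho>"]
    unfolding E_def by (simp_all only: mult_minus_right ri minus_minus diff_minus_eq_add)
  have web: "E (-1) * E (inverse \<rho>) * E (- inverse \<rho>) = 1"
    unfolding E_def by (rule qprod_weber[OF \<rho>(2,1)])
  have k1: "Klein \<tau> 0 (1/2) = - 2 * ee (- 1 / 4) * E (-1) ^ 2 / (w * E 1 ^ 2)"
    by (simp add: Klein_def Phi_def qtheta_def \<rho>2 E_def w_def power2_eq_square)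
  have k2: "Klein \<tau> (1/2) 0 = - ee (- \<tau> / 8) * E (inverse \<rho>) ^ 2 / (w * E 1 ^ 2)"
  proof -
    have 1: "ee ((1 / 2) * (1 / 2 * \<tau> + 0) / 2) * ee (- (1 / 2 * \<tau> + 0) / 2) = ee (- \<tau> / 8)"
      by (subst ee_add[symmetric], rule arg_cong[where f = ee], simp add: field_simps)
    have 2: "ee (1 / 2 * \<tau> + 0) = \<rho>" by (simp add: \<rho>_def)
    have "Klein \<tau> (1/2) 0 = - (ee ((1 / 2) * (1 / 2 * \<tau> + 0) / 2) * ee (- (1 / 2 * \<tau> + 0) / 2)) *
       (qtheta (\<rho>\<^sup>2) \<rho>) / (w * E 1 ^ 2)"
      unfolding Klein_def Phi_def 2 \<rho>2 E_def w_def by (simp add: mult_ac)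
    also have "qtheta (\<rho>\<^sup>2) \<rho> = E (inverse \<rho>) ^ 2"
      unfolding qtheta_def E_def[symmetric] r1(1)[symmetric] by (simp add: power2_eq_square)
    finally show ?thesis unfolding 1 .
  qed
  have k3: "Klein \<tau> (1/2) (1/2) = - (ee (- \<tau> / 8) * ee (- 1 / 8)) * E (- inverse \<rho>) ^ 2 / (w * E 1 ^ 2)"
  proof -
    have 1: "ee ((1 / 2) * (1 / 2 * \<tau> + 1 / 2) / 2) * ee (- (1 / 2 * \<tau> + 1 / 2) / 2) = ee (- \<tau> / 8) * ee (- 1 / 8)"
      by (subst ee_add[symmetric], subst ee_add[symmetric], rule arg_cong[where f = ee], simp add: field_simps)
    have 2: "ee (1 / 2 * \<tau> + 1 / 2) = - \<rho>" by (simp add: ee_add \<rho>_def)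
    have "Klein \<tau> (1/2) (1/2) = - (ee ((1 / 2) * (1 / 2 * \<tau> + 1 / 2) / 2) * ee (- (1 / 2 * \<tau> + 1 / 2) / 2)) *
       (qtheta (\<rho>\<^sup>2) (- \<rho>)) / (w * E 1 ^ 2)"
      unfolding Klein_def Phi_def 2 \<rho>2 E_def w_def by (simp add: mult_ac)
    also have "qtheta (\<rho>\<^sup>2) (- \<rho>) = E (- inverse \<rho>) ^ 2"
      unfolding qtheta_def E_def[symmetric] using r1(2) by (simp add: power2_eq_square)
    finally show ?thesis unfolding 1 .
  qed
  have eta: "dedekind_eta \<tau> ^ 6 = ee (\<tau> / 4) * E 1 ^ 6"
    by (simp add: dedekind_eta_eq power_mult_distrib \<rho>2 E_def ee_power)
  have e: "ee (- \<tau> / 8) * ee (- \<tau> / 8) * ee (\<tau> / 4) = 1" by (simp flip: ee_add)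
  have "Klein \<tau> 0 (1/2) * Klein \<tau> (1/2) 0 * Klein \<tau> (1/2) (1/2) * dedekind_eta \<tau> ^ 6 =
    - 2 * ee (- 1 / 4) * ee (- 1 / 8) / w ^ 3 * (E (-1) * E (inverse \<rho>) * E (- inverse \<rho>)) ^ 2 *
    (ee (- \<tau> / 8) * ee (- \<tau> / 8) * ee (\<tau> / 4))"
    unfolding k1 k2 k3 eta using w E1 by (simp add: field_simps) (simp add: power2_eq_square power3_eq_cube eval_nat_numeral)
  thus ?thesis unfolding web e by (simp add: w_def)
qed

text \<open>SL_2(Z) permutes the three nonzero 2-torsion classes, so the product of their Klein
  forms to the fourth power has weight -12; by \<open>Klein_two_torsion\<close> it is a constant
  over eta^24.\<close>

theorem dedekind_eta_24_mob:
  fixes a b c d :: int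
  assumes det: "a * d - b * c = 1" and \<tau>: "Im \<tau> > 0"
  shows "dedekind_eta (mob a b c d \<tau>) ^ 24 = (of_int c * \<tau> + of_int d) ^ 12 * dedekind_eta \<tau> ^ 24"
proof -
  \<comment> \<open>For half-integral coordinates the multiplier of \<open>Klein_shift\<close> is a
    fourth root of unity, so the fourth power depends on the parities of x and y alone.\<close>
  define k where "k = (\<lambda>\<tau> (x::int) (y::int). Klein \<tau> (of_int x / 2) (of_int y / 2) ^ 4)"
  define J where "J = of_int c * \<tau> + of_int d"
  define t where "t = mob a b c d \<tau>"
  have t: "Im t > 0" unfolding t_def by (rule Im_mob_pos[OF det \<tau>])
  have J: "J \<noteq> 0" unfolding J_def by (rule mob_denom_nonzero[OF det \<tau>])
  have shift: "k \<tau> (x + 2 * m) (y + 2 * n) = k \<tau> x y" for x y m n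
  proof -
    have "k \<tau> (x + 2 * m) (y + 2 * n) = Klein \<tau> (of_int x / 2 + of_int m) (of_int y / 2 + of_int n) ^ 4"
      by (simp add: k_def add_divide_distrib)
    also have "\<dots> = ee (of_int (2 * (m * n + m + n) + x * n - y * m)) * k \<tau> x y"
      unfolding Klein_shift[OF \<tau>] power_mult_distrib k_def ee_power
      by (rule arg_cong[where f = "\<lambda>z. ee z * _"]) (simp add: field_simps)
    finally show ?thesis by (simp only: ee_of_int mult_1_left)
  qed
  have kmod: "k \<tau> x y = k \<tau> (of_bool (odd x)) (of_bool (odd y))" for x y
  proof -
    have "k \<tau> (x mod 2 + 2 * (x div 2)) (y mod 2 + 2 * (y div 2)) = k \<tau> (x mod 2) (y mod 2)" by (rule shift)
    hence "k \<tau> x y = k \<tau> (x mod 2) (y mod 2)" by (simp only: mod_mult_div_eq)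
    thus ?thesis by (simp only: mod_2_eq_odd)
  qed
  have par: "odd (a * d - b * c)" using det by simp
  \<comment> \<open>Modulo 2 the rows (c, d), (a, b) and their sum are the three nonzero vectors in
    some order.\<close>
  have perm: "k \<tau> c d * k \<tau> a b * k \<tau> (a + c) (b + d) = k \<tau> 0 1 * k \<tau> 1 0 * k \<tau> 1 1"
    unfolding kmod[of c d] kmod[of a b] kmod[of "a + c" "b + d"]
    using par by (cases "even a"; cases "even b"; cases "even c"; cases "even d") (simp_all add: mult_ac)
  have tr: "J ^ 4 * k t 0 1 = k \<tau> c d" "J ^ 4 * k t 1 0 = k \<tau> a b" "J ^ 4 * k t 1 1 = k \<tau> (a + c) (b + d)"
    unfolding k_def t_def J_def power_mult_distrib[symmetric] Klein_mob[OF det \<tau>]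
    by (simp_all add: add_divide_distrib)
  define C where "C = (- 2 * ee (- 1 / 4) * ee (- 1 / 8) / (2 * of_real pi * \<i>) ^ 3) ^ 4"
  have C: "C \<noteq> 0" by (simp add: C_def)
  have D: "k s 0 1 * k s 1 0 * k s 1 1 * dedekind_eta s ^ 24 = C" if "Im s > 0" for s
    using arg_cong[OF Klein_two_torsion[OF that], of "\<lambda>x. x ^ 4"]
    by (simp add: k_def C_def power_mult_distrib flip: power_mult)
  have "J ^ 12 * (k t 0 1 * k t 1 0 * k t 1 1) = (J ^ 4 * k t 0 1) * (J ^ 4 * k t 1 0) * (J ^ 4 * k t 1 1)"
    by (simp add: eval_nat_numeral)
  also have "\<dots> = k \<tau> 0 1 * k \<tau> 1 0 * k \<tau> 1 1" unfolding tr by (rule perm)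
  finally have *: "J ^ 12 * (k t 0 1 * k t 1 0 * k t 1 1) = k \<tau> 0 1 * k \<tau> 1 0 * k \<tau> 1 1" .
  have "C * dedekind_eta t ^ 24 = (J ^ 12 * (k t 0 1 * k t 1 0 * k t 1 1)) * dedekind_eta \<tau> ^ 24 * dedekind_eta t ^ 24"
    unfolding * D[OF \<tau>] ..
  also have "\<dots> = J ^ 12 * dedekind_eta \<tau> ^ 24 * C"
    unfolding D[OF t, symmetric] by (simp add: mult_ac)
  finally show ?thesis using C by (simp add: t_def J_def)
qed

section \<open>Eta quotients of level p\<close>

lemma prod_roots_of_unity:
  fixes x :: complex
  assumes "N > 0"
  shows "(\<Prod>k<N. 1 - x * ee (of_nat k / of_nat N)) = 1 - x ^ N"
proof -
  define P1 where "P1 = (\<Prod>k<N. [:1, - ee (of_nat k / of_nat N):])"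
  define P2 where "P2 = 1 - monom (1::complex) N"
  \<comment> \<open>Both polynomials have degree at most N; the point 0, where both are 1, joins the
    N roots of unity to make N + 1 points of agreement.\<close>
  define A where "A = insert 0 {z :: complex. z ^ N = 1}"
  have N1: "1 \<le> N" using assms by simp
  have cardA: "card A = Suc N"
    unfolding A_def using assms card_complex_roots_unity[OF N1] finite_roots_unity[OF N1, where 'a = complex]
    by (subst card_insert_disjoint) (auto simp: power_0_left)
  have "P1 = P2"
  proof (rule poly_eqI_degree[of A])
    have "degree P1 \<le> (\<Sum>k<N. degree [:1, - ee (of_nat k / of_nat N):])"
      unfolding P1_def by (rule order.trans[OF degree_prod_sum_le]) (auto simp: o_def)
    also have "\<dots> \<le> (\<Sum>k<N. 1)" by (rule sum_mono) auto
    finally show "degree P1 < card A" using cardA by simp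
    have "degree P2 \<le> N" unfolding P2_def by (rule degree_diff_le) (auto simp: degree_monom_le)
    thus "degree P2 < card A" using cardA by simp
    fix z assume "z \<in> A"
    then consider "z = 0" | "z ^ N = 1" by (auto simp: A_def)
    thus "poly P1 z = poly P2 z"
    proof cases
      case 1
      thus ?thesis using assms by (simp add: P1_def P2_def poly_prod poly_monom power_0_left)
    next
      case 2
      hence "inverse z ^ N = 1" by (simp add: power_inverse)
      then obtain j where j: "j < N" "inverse z = exp (2 * of_real pi * \<i> * of_nat j / of_nat N)"
        using complex_roots_unity[OF N1] by auto
      hence "inverse z = ee (of_nat j / of_nat N)" by (simp add: ee_def)
      moreover have "z \<noteq> 0" using 2 assms by (cases "z = 0") (auto simp: power_0_left)
      ultimately have "1 - z * ee (of_nat j / of_nat N) = 0" by (metis right_inverse diff_self)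
      hence "poly P1 z = 0" using j unfolding P1_def poly_prod by (intro prod_zero) (auto intro!: bexI[of _ j])
      thus ?thesis using 2 by (simp add: P2_def poly_monom)
    qed
  qed
  hence "poly P1 x = poly P2 x" by simp
  thus ?thesis by (simp add: P1_def P2_def poly_prod poly_monom)
qed

lemma prod_qprod_roots:
  assumes "norm q < 1" "N > 0"
  shows "(\<Prod>k<N. qprod q (ee (of_nat k / of_nat N))) = qprod (q ^ N) 1"
proof (rule LIMSEQ_unique)
  show "(\<lambda>M. \<Prod>k<N. \<Prod>n<M. 1 - q ^ Suc n * ee (of_nat k / of_nat N)) \<longlonglongrightarrow>
        (\<Prod>k<N. qprod q (ee (of_nat k / of_nat N)))"
    by (intro tendsto_prod qprod_LIMSEQ assms)
  have "(\<lambda>M. \<Prod>n<M. 1 - (q ^ N) ^ Suc n * 1) \<longlonglongrightarrow> qprod (q ^ N) 1"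
    by (intro qprod_LIMSEQ norm_power_lt_1 assms)
  moreover have "(\<Prod>k<N. \<Prod>n<M. 1 - q ^ Suc n * ee (of_nat k / of_nat N)) = (\<Prod>n<M. 1 - (q ^ N) ^ Suc n * 1)" for M
    by (subst prod.swap, subst prod_roots_of_unity[OF assms(2)])
       (simp only: power_mult[symmetric] mult.commute[of N] mult_1_right)
  ultimately show "(\<lambda>M. \<Prod>k<N. \<Prod>n<M. 1 - q ^ Suc n * ee (of_nat k / of_nat N)) \<longlonglongrightarrow> qprod (q ^ N) 1"
    by simp
qed

definition Hprod :: "nat \<Rightarrow> complex \<Rightarrow> complex" where
  "Hprod p \<tau> = (\<Prod>k\<in>{1..(p - 1) div 2}. Klein \<tau> 0 (of_nat k / of_nat p))"

lemma ee_frac_neq_1: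
  assumes "0 < k" "k < p"
  shows "ee (of_nat k / of_nat p) \<noteq> 1"
proof
  assume "ee (of_nat k / of_nat p) = 1"
  then obtain n :: int where "of_nat k / of_nat p = (of_int n :: complex)" using ee_eq_1_iff by blast
  hence "(of_int (int k) :: complex) = of_int (n * int p)" using assms by (simp add: field_simps)
  hence "int k = n * int p" by (simp only: of_int_eq_iff)
  hence "int p dvd int k" by simp
  thus False using assms by (auto dest: dvd_imp_le)
qed

text \<open>In the Klein form at k/p the factor \<open>qprod q (inverse x)\<close> belongs to the
  residue p - k, so half of the points already uses every nonzero residue once. The missing residue
  0 is supplied by one of the p factors eta(tau), and \<open>prod_qprod_roots\<close> assembles
  eta(p tau).\<close>

lemma Hprod_eta:
  assumes "odd p"
  shows "\<exists>C. C \<noteq> 0 \<and> (\<forall>\<tau>. Im \<tau> > 0 \<longrightarrow> Hprod p \<tau> * dedekind_eta \<tau> ^ p = C * dedekind_eta (of_nat p * \<tau>))"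
proof -
  obtain h where h: "p = 2 * h + 1" using assms by (auto elim: oddE)
  define c where "c = (\<lambda>k::nat. - ee (- (of_nat k / of_nat p) / 2) * (1 - ee (of_nat k / of_nat p)) / (2 * of_real pi * \<i>))"
  define C where "C = (\<Prod>k\<in>{1..h}. c k)"
  have "c k \<noteq> 0" if "k \<in> {1..h}" for k
    using that ee_frac_neq_1[of k p] h by (auto simp: c_def)
  hence C: "C \<noteq> 0" by (auto simp: C_def)
  have "Hprod p \<tau> * dedekind_eta \<tau> ^ p = C * dedekind_eta (of_nat p * \<tau>)" if \<tau>: "Im \<tau> > 0" for \<tau>
  proof -
    define q where "q = ee \<tau>"
    define f where "f = (\<lambda>k. qprod q (ee (of_nat k / of_nat p)))"
    have q: "norm q < 1" using \<tau> by (simp add: q_def)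
    have E1: "qprod q 1 \<noteq> 0" by (rule qprod_1_nonzero[OF q])
    have f_refl: "f (2 * h + 1 - k) = qprod q (inverse (ee (of_nat k / of_nat p)))" if "k \<le> h" for k
    proof -
      have "(of_nat (2 * h + 1 - k) :: complex) = of_nat p - of_nat k"
        using that h by (simp add: of_nat_diff)
      moreover have "(of_nat p :: complex) \<noteq> 0" using h by (simp only: of_nat_eq_0_iff)
      ultimately have "of_nat (2 * h + 1 - k) / of_nat p = 1 - (of_nat k / of_nat p :: complex)"
        by (simp only: diff_divide_distrib) simp
      hence "f (2 * h + 1 - k) = qprod q (ee (1 - of_nat k / of_nat p))" by (simp only: f_def)
      thus ?thesis by (simp add: ee_diff inverse_eq_divide)
    qed
    have "Hprod p \<tau> = (\<Prod>k\<in>{1..h}. c k * (f k * f (2 * h + 1 - k)) / qprod q 1 ^ 2)"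
      unfolding Hprod_def
    proof (rule prod.cong)
      show "{1..(p - 1) div 2} = {1..h}" using h by simp
      fix k assume "k \<in> {1..h}"
      hence "k \<le> h" by simp
      from f_refl[OF this] show "Klein \<tau> 0 (of_nat k / of_nat p) = c k * (f k * f (2 * h + 1 - k)) / qprod q 1 ^ 2"
        by (simp only: Klein_def Phi_def qtheta_def c_def q_def[symmetric]) (simp add: f_def)
    qed
    also have "\<dots> = C * ((\<Prod>k\<in>{1..h}. f k) * (\<Prod>k\<in>{1..h}. f (2 * h + 1 - k))) / qprod q 1 ^ (2 * h)"
      by (simp add: prod.distrib prod_dividef C_def power_mult)
    also have "(\<Prod>k\<in>{1..h}. f (2 * h + 1 - k)) = (\<Prod>k\<in>{h+1..2*h}. f k)"
      by (rule prod.reindex_bij_witness[of _ "\<lambda>k. 2 * h + 1 - k" "\<lambda>k. 2 * h + 1 - k"]) auto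
    also have "(\<Prod>k\<in>{1..h}. f k) * (\<Prod>k\<in>{h+1..2*h}. f k) = (\<Prod>k\<in>{1..2*h}. f k)"
      by (subst prod.union_disjoint[symmetric]) (auto intro!: prod.cong)
    finally have 1: "Hprod p \<tau> = C * (\<Prod>k\<in>{1..2*h}. f k) / qprod q 1 ^ (2 * h)" .
    have "qprod (q ^ p) 1 = (\<Prod>k<p. f k)"
      unfolding f_def by (rule prod_qprod_roots[symmetric]) (use q h in auto)
    also have "{..<p} = insert 0 {1..2*h}" using h by auto
    also have "(\<Prod>k\<in>\<dots>. f k) = f 0 * (\<Prod>k\<in>{1..2*h}. f k)" by (subst prod.insert) auto
    also have "f 0 = qprod q 1" by (simp add: f_def)
    finally have 2: "qprod (q ^ p) 1 = qprod q 1 * (\<Prod>k\<in>{1..2*h}. f k)" .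
    have 3: "dedekind_eta \<tau> ^ p = ee (of_nat p * \<tau> / 24) * (qprod q 1 ^ (2 * h) * qprod q 1)"
      unfolding dedekind_eta_eq power_mult_distrib ee_power q_def[symmetric] using h by simp
    have 4: "dedekind_eta (of_nat p * \<tau>) = ee (of_nat p * \<tau> / 24) * qprod (q ^ p) 1"
      unfolding dedekind_eta_eq q_def by (simp add: ee_power)
    show ?thesis unfolding 1 2 3 4 using E1 by simp
  qed
  thus ?thesis using C by blast
qed

text \<open>The argument behind Gauss's lemma: multiplication by d permutes the pairs {k, -k} of
  nonzero residues in question, and each Klein form changes by a sign that does not depend on
  tau.\<close>

lemma Klein_0_perm:
  assumes p: "odd p" "p > 1" and d: "coprime d (int p)"
  shows "\<exists>s. (s = 1 \<or> s = - 1) \<and> (\<forall>\<tau>. Im \<tau> > 0 \<longrightarrow>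
    (\<Prod>k\<in>{1..(p - 1) div 2}. Klein \<tau> 0 (of_nat k * of_int d / of_nat p)) = s * Hprod p \<tau>)"
proof -
  obtain h where h: "p = 2 * h + 1" using p by (auto elim: oddE)
  have p0: "(of_nat p :: complex) \<noteq> 0" using p by simp
  define R where "R = {1..h}"
  define m where "m = (\<lambda>k::nat. nat ((int k * d) mod int p))"
  \<comment> \<open>The representative in 1..h of the class of k d up to sign.\<close>
  define f where "f = (\<lambda>k. if m k \<le> h then m k else p - m k)"
  have m: "int (m k) = (int k * d) mod int p" for k using h by (simp add: m_def)
  have m_lt: "m k < p" for k using m[of k] h by (metis of_nat_less_iff pos_mod_bound of_nat_0_less_iff add_gr_0 zero_less_one)
  have mnz: "m k \<noteq> 0" if "k \<in> R" for k
  proof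
    assume "m k = 0"
    hence "int p dvd int k * d" using m[of k] by auto
    hence "int p dvd int k" using d by (simp add: coprime_commute coprime_dvd_mult_left_iff)
    hence "p dvd k" by (simp only: of_nat_dvd_iff)
    thus False using that h by (auto simp: R_def dest: dvd_imp_le)
  qed
  have fR: "f k \<in> R" if "k \<in> R" for k
    using mnz[OF that] m_lt[of k] h by (auto simp: f_def R_def)
  have inj: "inj_on f R"
  proof (rule inj_onI)
    fix x y assume xy: "x \<in> R" "y \<in> R" "f x = f y"
    have "m x = m y \<or> m x + m y = p"
      using xy(3) m_lt[of x] m_lt[of y] by (auto simp: f_def split: if_splits)
    thus "x = y"
    proof
      assume "m x = m y"
      hence "(int x * d) mod int p = (int y * d) mod int p" using m[of x] m[of y] by simp
      hence "int p dvd (int x - int y) * d" by (simp add: mod_eq_dvd_iff left_diff_distrib)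
      hence "int p dvd int x - int y" using d by (simp add: coprime_commute coprime_dvd_mult_left_iff)
      moreover have "\<bar>int x - int y\<bar> < int p" using xy h by (auto simp: R_def)
      ultimately show "x = y" using zdvd_not_zless[of "\<bar>int x - int y\<bar>" "int p"] by auto
    next
      assume "m x + m y = p"
      hence "((int x * d) mod int p + (int y * d) mod int p) mod int p = 0" using m[of x] m[of y]
        by (metis mod_self of_nat_add)
      hence "int p dvd (int x + int y) * d" by (simp add: mod_add_eq distrib_right mod_eq_0_iff_dvd[symmetric])
      hence "int p dvd int x + int y" using d by (simp add: coprime_commute coprime_dvd_mult_left_iff)
      hence "int p \<le> int x + int y" using xy by (intro zdvd_imp_le) (auto simp: R_def)
      thus "x = y" using xy h by (auto simp: R_def)
    qed
  qed
  have bij: "bij_betw f R R"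
    using inj fR by (intro bij_betw_imageI endo_inj_surj) (auto simp: R_def)
  have "\<exists>s. (s = 1 \<or> s = - 1) \<and> (\<forall>\<tau>. Im \<tau> > 0 \<longrightarrow>
      Klein \<tau> 0 (of_nat k * of_int d / of_nat p) = s * Klein \<tau> 0 (of_nat (f k) / of_nat p))" for k
  proof -
    define l where "l = (int k * d) div int p"
    have "int k * d = l * int p + int (m k)" unfolding m l_def by simp
    hence "(of_int (int k * d) :: complex) = of_int (l * int p + int (m k))" by (simp only:)
    hence e: "of_nat k * of_int d / of_nat p = (of_nat (m k) / of_nat p + of_int l :: complex)"
      using p0 by (simp add: field_simps)
    have 1: "Klein \<tau> 0 (of_nat k * of_int d / of_nat p) = (if even l then 1 else - 1) * Klein \<tau> 0 (of_nat (m k) / of_nat p)"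
      if "Im \<tau> > 0" for \<tau>
      using Klein_shift[OF that, of 0 0 "of_nat (m k) / of_nat p" l] unfolding e by (simp add: ee_half_int)
    show ?thesis
    proof (cases "m k \<le> h")
      case True
      thus ?thesis using 1 by (intro exI[of _ "if even l then 1 else - 1"]) (auto simp: f_def)
    next
      case False
      have e2: "of_nat (m k) / of_nat p = (- (of_nat (f k) / of_nat p) + of_int 1 :: complex)"
        using False m_lt[of k] p0 by (simp add: f_def of_nat_diff field_simps)
      \<comment> \<open>The sign of the shift by 1 cancels the sign from oddness, so passing from m
        k to p - m k costs nothing.\<close>
      have 2: "Klein \<tau> 0 (of_nat (m k) / of_nat p) = Klein \<tau> 0 (of_nat (f k) / of_nat p)"
        if "Im \<tau> > 0" for \<tau>
        using Klein_shift[OF that, of 0 0 "- (of_nat (f k) / of_nat p)" 1] Klein_uminus[of \<tau> 0 "of_nat (f k) / of_nat p"]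
        unfolding e2 by simp
      show ?thesis using 1 2 by (intro exI[of _ "if even l then 1 else - 1"]) auto
    qed
  qed
  then obtain s where s: "\<And>k. s k = 1 \<or> s k = - 1"
    "\<And>k \<tau>. Im \<tau> > 0 \<Longrightarrow> Klein \<tau> 0 (of_nat k * of_int d / of_nat p) = s k * Klein \<tau> 0 (of_nat (f k) / of_nat p)"
    by metis
  have "(\<Prod>k\<in>R. s k) = 1 \<or> (\<Prod>k\<in>R. s k) = - 1"
  proof -
    have "finite R \<Longrightarrow> prod s R = 1 \<or> prod s R = - 1"
    proof (induction R rule: finite_induct)
      case (insert x F)
      thus ?case using s(1)[of x] by auto
    qed auto
    thus ?thesis by (simp add: R_def)
  qed
  moreover have "(\<Prod>k\<in>R. Klein \<tau> 0 (of_nat k * of_int d / of_nat p)) = (\<Prod>k\<in>R. s k) * Hprod p \<tau>"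
    if "Im \<tau> > 0" for \<tau>
  proof -
    have "(\<Prod>k\<in>R. Klein \<tau> 0 (of_nat (f k) / of_nat p)) = (\<Prod>k\<in>R. Klein \<tau> 0 (of_nat k / of_nat p))"
      by (rule prod.reindex_bij_betw[OF bij])
    thus ?thesis using s(2)[OF that] h by (simp add: prod.distrib Hprod_def R_def)
  qed
  moreover have "{1..(p - 1) div 2} = R" using h by (simp add: R_def)
  ultimately show ?thesis by metis
qed

text \<open>The order of quantifiers is the point: the sign s is chosen before a, b, c and tau, so
  the matrices that move tau and p tau, which share d, have the same s. The exponential collects the
  multipliers of \<open>Klein_shift\<close>.\<close>

lemma Hprod_mob:
  assumes p: "odd p" "p > 1" and d: "coprime d (int p)"
  shows "\<exists>s. (s = 1 \<or> s = - 1) \<and> (\<forall>a b c \<tau>. a * d - b * (int p * c) = 1 \<longrightarrow> Im \<tau> > 0 \<longrightarrow>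
    (of_int (int p * c) * \<tau> + of_int d) ^ ((p - 1) div 2) * Hprod p (mob a b (int p * c) d \<tau>) =
    s * ee (of_int (c * (3 - d)) * (of_nat p ^ 2 - 1) / 48) * Hprod p \<tau>)"
proof -
  obtain h where h: "p = 2 * h + 1" using p by (auto elim: oddE)
  have p0: "(of_nat p :: complex) \<noteq> 0" using p by simp
  obtain s where s: "s = 1 \<or> s = - 1" "\<And>\<tau>. Im \<tau> > 0 \<Longrightarrow>
    (\<Prod>k\<in>{1..h}. Klein \<tau> 0 (of_nat k * of_int d / of_nat p)) = s * Hprod p \<tau>"
    using Klein_0_perm[OF assms] h by auto
  have "(of_int (int p * c) * \<tau> + of_int d) ^ h * Hprod p (mob a b (int p * c) d \<tau>) =
    s * ee (of_int (c * (3 - d)) * (of_nat p ^ 2 - 1) / 48) * Hprod p \<tau>"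
    if det: "a * d - b * (int p * c) = 1" and \<tau>: "Im \<tau> > 0" for a b c \<tau>
  proof -
    define J where "J = of_int (int p * c) * \<tau> + of_int d"
    have p0: "(of_nat p :: complex) \<noteq> 0" using p by simp
    have "J ^ h * Hprod p (mob a b (int p * c) d \<tau>) =
      (\<Prod>k\<in>{1..h}. J * Klein (mob a b (int p * c) d \<tau>) 0 (of_nat k / of_nat p))"
      using h by (simp add: Hprod_def prod.distrib)
    also have "\<dots> = (\<Prod>k\<in>{1..h}. ee (of_int c * (of_nat k - of_nat k ^ 2 * of_int d / of_nat p) / 2) *
                       Klein \<tau> 0 (of_nat k * of_int d / of_nat p))"
    proof (rule prod.cong)
      fix k assume "k \<in> {1..h}"
      \<comment> \<open>The second coordinate k/p times the lower left entry p c is the integer k c;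
        it appears as first coordinate and is shifted away.\<close>
      have "J * Klein (mob a b (int p * c) d \<tau>) 0 (of_nat k / of_nat p) =
         Klein \<tau> (0 + of_int (int k * c)) (of_nat k * of_int d / of_nat p + of_int 0)"
        unfolding J_def Klein_mob[OF det \<tau>] using p0 by simp
      also have "\<dots> = ee ((of_int (int k * c) - of_nat k * of_int d / of_nat p * of_int (int k * c)) / 2) *
          Klein \<tau> 0 (of_nat k * of_int d / of_nat p)"
        unfolding Klein_shift[OF \<tau>] by simp
      also have "(of_int (int k * c) - of_nat k * of_int d / of_nat p * of_int (int k * c)) / 2 =
          (of_int c * (of_nat k - of_nat k ^ 2 * of_int d / of_nat p) / 2 :: complex)"
        by (simp add: algebra_simps power2_eq_square)
      finally show "J * Klein (mob a b (int p * c) d \<tau>) 0 (of_nat k / of_nat p) =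
        ee (of_int c * (of_nat k - of_nat k ^ 2 * of_int d / of_nat p) / 2) *
          Klein \<tau> 0 (of_nat k * of_int d / of_nat p)" .
    qed auto
    also have "\<dots> = (\<Prod>k\<in>{1..h}. ee (of_int c * (of_nat k - of_nat k ^ 2 * of_int d / of_nat p) / 2)) * (s * Hprod p \<tau>)"
      unfolding prod.distrib s(2)[OF \<tau>] ..
    also have "(\<Prod>k\<in>{1..h}. ee (of_int c * (of_nat k - of_nat k ^ 2 * of_int d / of_nat p) / 2)) =
       ee (of_int (c * (3 - d)) * (of_nat p ^ 2 - 1) / 48)"
    proof -
      \<comment> \<open>The sums of k and k^2 in closed form, with a general upper limit n for the
        sake of the induction; at n = h the factor 2 h + 1 = p cancels the denominator.\<close>
      have "(\<Prod>k\<in>{1..n}. ee (of_int c * (of_nat k - of_nat k ^ 2 * of_int d / of_nat p) / 2)) =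
         ee (of_int c * (of_nat n * (of_nat n + 1) / 2 - of_nat n * (of_nat n + 1) * (2 * of_nat n + 1) * of_int d / (6 * of_nat p)) / 2)" for n
      proof (induction n)
        case (Suc n)
        have "(\<Prod>k\<in>{1..Suc n}. ee (of_int c * (of_nat k - of_nat k ^ 2 * of_int d / of_nat p) / 2)) =
          ee (of_int c * (of_nat n * (of_nat n + 1) / 2 - of_nat n * (of_nat n + 1) * (2 * of_nat n + 1) * of_int d / (6 * of_nat p)) / 2)
          * ee (of_int c * (of_nat (Suc n) - of_nat (Suc n) ^ 2 * of_int d / of_nat p) / 2)"
          using Suc by (simp add: prod.nat_ivl_Suc')
        also have "\<dots> = ee (of_int c * (of_nat (Suc n) * (of_nat (Suc n) + 1) / 2 - of_nat (Suc n) * (of_nat (Suc n) + 1) * (2 * of_nat (Suc n) + 1) * of_int d / (6 * of_nat p)) / 2)"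
          unfolding ee_add[symmetric]
          by (rule arg_cong[where f = ee]) (use p in \<open>simp add: field_simps power2_eq_square\<close>)
        finally show ?case .
      qed simp
      note this[of h]
      also have "of_int c * (of_nat h * (of_nat h + 1) / 2 - of_nat h * (of_nat h + 1) * (2 * of_nat h + 1) * of_int d / (6 * of_nat p)) / 2
         = (of_int c * (of_nat h * (of_nat h + 1) / 2 - of_nat h * (of_nat h + 1) * (of_nat p * of_int d / of_nat p) / 6) / 2 :: complex)"
        by (simp add: h algebra_simps)
      also have "of_nat p * of_int d / of_nat p = (of_int d :: complex)" using p0 by simp
      also have "of_int c * (of_nat h * (of_nat h + 1) / 2 - of_nat h * (of_nat h + 1) * of_int d / 6) / 2 =
          (of_int (c * (3 - d)) * (of_nat p ^ 2 - 1) / 48 :: complex)"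
        by (simp add: h field_simps power2_eq_square)
      finally show ?thesis .
    qed
    finally show ?thesis by (simp add: J_def mult_ac)
  qed
  thus ?thesis using s(1) h by (intro exI[of _ s]) auto
qed

section \<open>Invariance of eta quotients under congruence subgroups\<close>

lemma mob_mult:
  assumes "n > 0"
  shows "of_nat n * mob a b (int n * c) d \<tau> = mob a (int n * b) c d (of_nat n * \<tau>)"
  by (simp add: mob_def algebra_simps)

lemma dedekind_eta_24_power_mob:
  fixes a b c d :: int
  assumes det: "a * d - b * c = 1" and \<tau>: "Im \<tau> > 0"
  shows "(dedekind_eta (mob a b c d \<tau>) / dedekind_eta \<tau>) ^ 24 = (of_int c * \<tau> + of_int d) ^ 12"
  using dedekind_eta_24_mob[OF det \<tau>] dedekind_eta_nonzero[OF \<tau>] by (simp add: power_divide)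

definition eta_ratio :: "nat \<Rightarrow> complex \<Rightarrow> complex" where
  "eta_ratio n \<tau> = dedekind_eta (of_nat n * \<tau>) / dedekind_eta \<tau>"

lemma eta_ratio_nonzero: "Im \<tau> > 0 \<Longrightarrow> n > 0 \<Longrightarrow> eta_ratio n \<tau> \<noteq> 0"
  using dedekind_eta_nonzero[of \<tau>] dedekind_eta_nonzero[of "of_nat n * \<tau>"] by (simp add: eta_ratio_def)

lemma coprime_of_det:
  assumes "a * d - b * (p * c) = 1"
  shows "coprime d (p :: int)"
proof (rule coprimeI)
  fix x assume "x dvd d" "x dvd p"
  hence "x dvd a * d - b * (p * c)" by auto
  thus "x dvd 1" unfolding assms .
qed

text \<open>The ratio is a constant times H eta^(p-1). Raising to the power s kills the sign because
  s is even, and the exponential because 24 | s (p - 1). For the latter reason eta^((p-1) s) is also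
  a power of eta^24, whose weight cancels that of H^s.\<close>

lemma eta_ratio_mob_odd:
  fixes a b c d :: int
  assumes p: "odd p" "p > 1" and det: "a * d - b * (int p * c) = 1" and \<tau>: "Im \<tau> > 0"
    and s: "24 dvd s * (p - 1)" "even s"
  shows "eta_ratio p (mob a b (int p * c) d \<tau>) ^ s = eta_ratio p \<tau> ^ s"
proof -
  obtain h where h: "p = 2 * h + 1" using p by (auto elim: oddE)
  have hp: "(p - 1) div 2 = h" using h by simp
  obtain m where m: "s * (p - 1) = 24 * m" using s by blast
  define t where "t = mob a b (int p * c) d \<tau>"
  define J where "J = of_int (int p * c) * \<tau> + of_int d"
  define \<epsilon> where "\<epsilon> = ee (of_int (c * (3 - d)) * (of_nat p ^ 2 - 1) / 48)"
  have J: "J \<noteq> 0" unfolding J_def by (rule mob_denom_nonzero[OF det \<tau>])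
  have t: "Im t > 0" unfolding t_def by (rule Im_mob_pos[OF det \<tau>])
  obtain \<sigma> where \<sigma>: "\<sigma> = 1 \<or> \<sigma> = - 1" "J ^ h * Hprod p t = \<sigma> * \<epsilon> * Hprod p \<tau>"
    using Hprod_mob[OF p coprime_of_det[OF det]] det \<tau> unfolding t_def J_def \<epsilon>_def hp by blast
  obtain C where C: "C \<noteq> 0" "\<And>\<tau>. Im \<tau> > 0 \<Longrightarrow> Hprod p \<tau> * dedekind_eta \<tau> ^ p = C * dedekind_eta (of_nat p * \<tau>)"
    using Hprod_eta[OF p(1)] by blast
  have pp: "x ^ p = x ^ (p - 1) * x" for x :: complex
    using p(2) by (cases p) auto
  have R: "C * eta_ratio p \<tau> = Hprod p \<tau> * dedekind_eta \<tau> ^ (p - 1)" if "Im \<tau> > 0" for \<tau>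
    using C(2)[OF that] dedekind_eta_nonzero[OF that] unfolding pp by (simp add: eta_ratio_def field_simps)
  have \<sigma>s: "\<sigma> ^ s = 1" using \<sigma>(1) s(2) by auto
  have \<epsilon>s: "\<epsilon> ^ s = 1"
  proof -
    have ph: "p - 1 = 2 * h" "p = 2 * h + 1" using h by simp_all
    have "s * h = 12 * m" using m unfolding ph(1) by (simp add: mult.commute)
    hence sh: "of_nat s * of_nat h = (12 * of_nat m :: complex)" by (metis of_nat_mult of_nat_numeral)
    have "of_nat s * (of_int (c * (3 - d)) * (of_nat p ^ 2 - 1) / 48) =
        (of_int (c * (3 - d)) * (of_nat s * of_nat h) * (of_nat h + 1) / 12 :: complex)"
      unfolding ph(2) by (simp add: field_simps power2_eq_square)
    also have "\<dots> = of_int (c * (3 - d)) * (12 * of_nat m) * (of_nat h + 1) / 12" unfolding sh ..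
    also have "\<dots> = of_int (c * (3 - d) * int m * (int h + 1))" by simp
    finally show ?thesis unfolding \<epsilon>_def ee_power by (simp only: ee_of_int)
  qed
  have "12 * m = h * s" using m h by simp
  hence Js: "J ^ (12 * m) = (J ^ h) ^ s" by (simp add: power_mult)
  have eta_s: "(dedekind_eta t ^ (p - 1)) ^ s = J ^ (12 * m) * (dedekind_eta \<tau> ^ (p - 1)) ^ s"
  proof -
    have "(dedekind_eta t ^ (p - 1)) ^ s = (dedekind_eta t ^ 24) ^ m"
      by (simp only: power_mult[symmetric] m mult.commute[of _ s])
    also have "\<dots> = J ^ (12 * m) * (dedekind_eta \<tau> ^ 24) ^ m"
      unfolding t_def dedekind_eta_24_mob[OF det \<tau>] J_def by (simp add: power_mult_distrib power_mult)
    also have "(dedekind_eta \<tau> ^ 24) ^ m = (dedekind_eta \<tau> ^ (p - 1)) ^ s"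
      by (simp only: power_mult[symmetric] m mult.commute[of _ s])
    finally show ?thesis .
  qed
  have "(C * eta_ratio p t) ^ s = (J ^ h * Hprod p t) ^ s * (dedekind_eta \<tau> ^ (p - 1)) ^ s"
    unfolding R[OF t] power_mult_distrib eta_s Js by simp
  also have "\<dots> = (C * eta_ratio p \<tau>) ^ s"
    unfolding \<sigma>(2) R[OF \<tau>] power_mult_distrib \<sigma>s \<epsilon>s by simp
  finally show ?thesis using C by (simp add: power_mult_distrib t_def)
qed

text \<open>The exponent 24 allows the discriminant law at both tau and 2 tau; with lower left entry
  2 c the two automorphy factors agree.\<close>

lemma eta_ratio_2_mob:
  fixes a b c d :: int
  assumes det: "a * d - b * (2 * c) = 1" and \<tau>: "Im \<tau> > 0"
  shows "eta_ratio 2 (mob a b (2 * c) d \<tau>) ^ 24 = eta_ratio 2 \<tau> ^ 24"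
proof -
  define J where "J = of_int (2 * c) * \<tau> + of_int d"
  have J: "J \<noteq> 0" unfolding J_def by (rule mob_denom_nonzero[OF det \<tau>])
  have det': "a * d - (2 * b) * c = 1" using det by simp
  have "2 * mob a b (2 * c) d \<tau> = mob a (2 * b) c d (2 * \<tau>)" using mob_mult[of 2] by simp
  hence "dedekind_eta (2 * mob a b (2 * c) d \<tau>) ^ 24 = J ^ 12 * dedekind_eta (2 * \<tau>) ^ 24"
    using dedekind_eta_24_mob[OF det', of "2 * \<tau>"] \<tau> by (simp add: J_def mult_ac)
  moreover have "dedekind_eta (mob a b (2 * c) d \<tau>) ^ 24 = J ^ 12 * dedekind_eta \<tau> ^ 24"
    unfolding J_def by (rule dedekind_eta_24_mob[OF det \<tau>])
  ultimately show ?thesis using J by (simp add: eta_ratio_def power_divide)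
qed

text \<open>The function h of the overview; literally a Hauptmodul only if \<open>pi_p p\<close> is
  1.\<close>

definition hauptmodul :: "nat \<Rightarrow> complex \<Rightarrow> complex" where
  "hauptmodul p \<tau> = eta_ratio p \<tau> ^ (24 div gcd 12 (p - 1))"

theorem hauptmodul_mob:
  fixes a b c d :: int
  assumes p: "prime p" and det: "a * d - b * (int p * c) = 1" and \<tau>: "Im \<tau> > 0"
  shows "hauptmodul p (mob a b (int p * c) d \<tau>) = hauptmodul p \<tau>"
proof (cases "p = 2")
  case True
  thus ?thesis using eta_ratio_2_mob[of a d b c \<tau>] det \<tau> by (simp add: hauptmodul_def)
next
  case False
  define g where "g = gcd 12 (p - 1)"
  have "g dvd 12" "g dvd p - 1" by (auto simp: g_def)
  then obtain k l where kl: "12 = g * k" "p - 1 = g * l" by (metis dvdE)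
  have "g > 0" using kl by (cases g) auto
  \<comment> \<open>With 12 = g k and p - 1 = g l the exponent is 2 k, and 2 k (p - 1) = 24
    l.\<close>
  hence "24 div g = 2 * k" using kl by (metis mult.commute mult.left_commute mult_2_right nonzero_mult_div_cancel_left not_less0 numeral_Bit0 numeral_plus_numeral)
  moreover have "24 dvd (2 * k) * (p - 1)" unfolding kl(2)
    by (rule dvdI[of _ _ l]) (use kl(1) in \<open>simp add: mult_ac\<close>)
  ultimately show ?thesis
    using eta_ratio_mob_odd[OF _ _ det \<tau>, of "2 * k"] False p prime_odd_nat[OF p] prime_gt_1_nat[OF p]
      prime_ge_2_nat[OF p] by (simp add: g_def hauptmodul_def)
qed

text \<open>\<open>Hprod_eta\<close> at p tau, and at tau raised to the power p, leads from eta(tau)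
  to eta(p^2 tau). Since r may be odd, the sign has to cancel before the exponent r is applied; the
  exponential becomes 1 only with it.\<close>

lemma eta_ratio_square_mob_odd:
  fixes a b c d r :: int
  assumes p: "odd p" "p > 1" and det: "a * d - b * (int p ^ 2 * c) = 1" and \<tau>: "Im \<tau> > 0"
    and r: "24 dvd r * (int p ^ 2 - 1)"
  shows "eta_ratio (p ^ 2) (mob a b (int p ^ 2 * c) d \<tau>) powi r = eta_ratio (p ^ 2) \<tau> powi r"
proof -
  obtain h where h: "p = 2 * h + 1" using p by (auto elim: oddE)
  have hp: "(p - 1) div 2 = h" using h by simp
  obtain m where m: "r * (int p ^ 2 - 1) = 24 * m" using r by blast
  define t where "t = mob a b (int p ^ 2 * c) d \<tau>"
  define J where "J = of_int (int p ^ 2 * c) * \<tau> + of_int d"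
  define \<epsilon> where "\<epsilon> = ee (of_int (c * (3 - d)) * (of_nat p ^ 2 - 1) / 48)"
  have J: "J \<noteq> 0" unfolding J_def by (rule mob_denom_nonzero[OF det \<tau>])
  have t: "Im t > 0" unfolding t_def by (rule Im_mob_pos[OF det \<tau>])
  have c2: "int p ^ 2 * c = int p * (int p * c)" by (simp add: power2_eq_square)
  have det1: "a * d - b * (int p * (int p * c)) = 1" and det2: "a * d - (int p * b) * (int p * c) = 1"
    using det by (auto simp: power2_eq_square mult_ac)
  have p\<tau>: "Im (of_nat p * \<tau>) > 0" "Im (of_nat p * t) > 0" using \<tau> t p by auto
  have pt: "of_nat p * t = mob a (int p * b) (int p * c) d (of_nat p * \<tau>)"
    unfolding t_def c2 by (rule mob_mult) (use p in auto)
  obtain \<sigma> where \<sigma>: "\<sigma> = 1 \<or> \<sigma> = - 1" "\<And>a b c \<tau>. a * d - b * (int p * c) = 1 \<Longrightarrow> Im \<tau> > 0 \<Longrightarrow>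
    (of_int (int p * c) * \<tau> + of_int d) ^ h * Hprod p (mob a b (int p * c) d \<tau>) =
    \<sigma> * ee (of_int (c * (3 - d)) * (of_nat p ^ 2 - 1) / 48) * Hprod p \<tau>"
    using Hprod_mob[OF p coprime_of_det[OF det1]] unfolding hp by blast
  \<comment> \<open>For tau the lower left entry is p times p c, so c is replaced by p c and epsilon
    by its p-th power.\<close>
  have H1: "J ^ h * Hprod p t = \<sigma> * \<epsilon> ^ p * Hprod p \<tau>"
    using \<sigma>(2)[OF det1 \<tau>] unfolding c2[symmetric] t_def[symmetric] \<epsilon>_def ee_power
    by (simp add: J_def mult_ac c2)
  have H2: "J ^ h * Hprod p (of_nat p * t) = \<sigma> * \<epsilon> * Hprod p (of_nat p * \<tau>)"
    using \<sigma>(2)[OF det2 p\<tau>(1)] unfolding pt[symmetric] \<epsilon>_def[symmetric]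
    by (simp add: J_def mult_ac power2_eq_square)
  obtain C where C: "C \<noteq> 0" "\<And>\<tau>. Im \<tau> > 0 \<Longrightarrow> Hprod p \<tau> * dedekind_eta \<tau> ^ p = C * dedekind_eta (of_nat p * \<tau>)"
    using Hprod_eta[OF p(1)] by blast
  define n where "n = p ^ 2 - 1"
  have n: "p * p = n + 1" using p by (simp add: n_def power2_eq_square)
  have R: "C ^ (p + 1) * eta_ratio (p ^ 2) \<tau> = Hprod p (of_nat p * \<tau>) * Hprod p \<tau> ^ p * dedekind_eta \<tau> ^ n"
    if "Im \<tau> > 0" for \<tau>
  proof -
    have "Im (of_nat p * \<tau>) > 0" using that p by auto
    from C(2)[OF this] have *: "Hprod p (of_nat p * \<tau>) * dedekind_eta (of_nat p * \<tau>) ^ p = C * dedekind_eta (of_nat (p\<^sup>2) * \<tau>)"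
      by (simp add: power2_eq_square mult_ac)
    have "C ^ (p + 1) * dedekind_eta (of_nat (p\<^sup>2) * \<tau>) = C ^ p * (C * dedekind_eta (of_nat (p\<^sup>2) * \<tau>))"
      by simp
    also have "\<dots> = Hprod p (of_nat p * \<tau>) * (C * dedekind_eta (of_nat p * \<tau>)) ^ p"
      unfolding *[symmetric] by (simp add: power_mult_distrib)
    also have "\<dots> = Hprod p (of_nat p * \<tau>) * Hprod p \<tau> ^ p * dedekind_eta \<tau> ^ (n + 1)"
      unfolding C(2)[OF that, symmetric] power_mult_distrib by (simp add: power_mult[symmetric] n)
    finally show ?thesis using dedekind_eta_nonzero[OF that] by (simp add: eta_ratio_def field_simps)
  qed
  define \<rho> where "\<rho> = dedekind_eta t / dedekind_eta \<tau>"
  have e\<tau>: "dedekind_eta \<tau> \<noteq> 0" using dedekind_eta_nonzero \<tau> by blast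
  have \<rho>24: "\<rho> ^ 24 = J ^ 12" unfolding \<rho>_def t_def J_def by (rule dedekind_eta_24_power_mob[OF det \<tau>])
  have \<sigma>p: "\<sigma> * \<sigma> ^ p = 1" using \<sigma>(1) p by (auto simp: power_Suc[symmetric] simp del: power_Suc)
  have "C ^ (p + 1) * eta_ratio (p ^ 2) t * J ^ (h * (p + 1)) =
      (J ^ h * Hprod p (of_nat p * t)) * (J ^ h * Hprod p t) ^ p * dedekind_eta t ^ n"
    unfolding R[OF t] by (simp add: power_mult_distrib power_add power_mult mult_ac)
  also have "\<dots> = (\<sigma> * \<sigma> ^ p) * (\<epsilon> * \<epsilon> ^ (p * p)) * (Hprod p (of_nat p * \<tau>) * Hprod p \<tau> ^ p * dedekind_eta \<tau> ^ n) * \<rho> ^ n"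
    unfolding H1 H2 \<rho>_def power_divide power_mult_distrib power_mult using e\<tau> by simp
  also have "\<dots> = C ^ (p + 1) * eta_ratio (p ^ 2) \<tau> * (\<epsilon> ^ (p * p + 1) * \<rho> ^ n)"
    unfolding R[OF \<tau>, symmetric] \<sigma>p by simp
  finally have 1: "eta_ratio (p ^ 2) t = eta_ratio (p ^ 2) \<tau> * (\<epsilon> ^ (p * p + 1) * \<rho> ^ n / J ^ (h * (p + 1)))"
    using C J by (simp add: field_simps)
  have \<epsilon>r: "(\<epsilon> ^ (p * p + 1)) powi r = 1"
  proof -
    have "(\<epsilon> ^ (p * p + 1)) powi r = ee (of_int r * (of_nat (p * p + 1) * (of_int (c * (3 - d)) * (of_nat p ^ 2 - 1) / 48)))"
      unfolding \<epsilon>_def ee_power ee_powi ..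
    also have "of_int r * (of_nat (p * p + 1) * (of_int (c * (3 - d)) * (of_nat p ^ 2 - 1) / 48)) =
        (of_int (r * (int p ^ 2 - 1)) * (of_nat (p * p + 1) * of_int (c * (3 - d)) / 48) :: complex)"
      by (simp add: field_simps)
    \<comment> \<open>The exponent has denominator 48, while r (p^2 - 1) only supplies 24; the
      missing factor 2 comes from p^2 + 1.\<close>
    also have "(of_nat (p * p + 1) :: complex) = 2 * of_nat (2 * h * h + 2 * h + 1)" by (simp add: h algebra_simps)
    also have "of_int (r * (int p ^ 2 - 1)) * (2 * of_nat (2 * h * h + 2 * h + 1) * of_int (c * (3 - d)) / 48)
       = (of_int (m * int (2 * h * h + 2 * h + 1) * (c * (3 - d))) :: complex)"
      unfolding m by (simp add: field_simps)
    finally show ?thesis by (simp only: ee_of_int)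
  qed
  have "int n * r = 24 * m" using m n by (simp add: power2_eq_square mult.commute flip: of_nat_mult)
  hence "(\<rho> ^ n) powi r = \<rho> powi (24 * m)" by (simp add: power_int_mult[symmetric] flip: power_int_of_nat)
  also have "\<dots> = (\<rho> ^ 24) powi m" by (simp add: power_int_mult)
  also have "\<dots> = J powi (12 * m)" unfolding \<rho>24 by (simp add: power_int_mult)
  also have "12 * m = int (h * (p + 1)) * r"
    using m by (simp add: h power2_eq_square algebra_simps)
  also have "J powi \<dots> = (J ^ (h * (p + 1))) powi r" by (simp only: power_int_mult power_int_of_nat)
  finally have "(\<epsilon> ^ (p * p + 1) * \<rho> ^ n / J ^ (h * (p + 1))) powi r = 1"
    unfolding power_int_divide_distrib power_int_mult_distrib \<epsilon>r using J by simp
  thus ?thesis unfolding t_def[symmetric] 1 power_int_mult_distrib by simp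
qed

text \<open>The counterpart of \<open>Hprod_eta\<close> for the prime 2: the point 1/2 is its own
  negative modulo the lattice, so its Klein form contains a square and yields eta(2 tau)^2.\<close>

lemma Klein_half_2:
  "\<exists>\<kappa>. \<kappa> \<noteq> 0 \<and> (\<forall>\<tau>. Im \<tau> > 0 \<longrightarrow> Klein \<tau> 0 (1/2) * dedekind_eta \<tau> ^ 4 = \<kappa> * dedekind_eta (2 * \<tau>) ^ 2)"
proof (intro exI conjI allI impI)
  show "- 2 * ee (- 1 / 4) / (2 * of_real pi * \<i>) \<noteq> 0" by simp
  fix \<tau> assume \<tau>: "Im \<tau> > 0"
  define q where "q = ee \<tau>"
  have q: "norm q < 1" using \<tau> by (simp add: q_def)
  have E1: "qprod q 1 \<noteq> 0" by (rule qprod_1_nonzero[OF q])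
  have k1: "Klein \<tau> 0 (1/2) = - 2 * ee (- 1 / 4) / (2 * of_real pi * \<i>) * qprod q (-1) ^ 2 / qprod q 1 ^ 2"
    by (simp add: Klein_def Phi_def qtheta_def q_def power2_eq_square)
  have 1: "dedekind_eta (2 * \<tau>) = ee (\<tau> / 12) * (qprod q 1 * qprod q (-1))"
    using qprod_mult_uminus[OF q, of 1] by (simp add: dedekind_eta_eq q_def ee_power)
  have 2: "dedekind_eta \<tau> ^ 4 = ee (\<tau> / 12) ^ 2 * qprod q 1 ^ 4"
    by (simp add: dedekind_eta_eq q_def power_mult_distrib ee_power)
  show "Klein \<tau> 0 (1/2) * dedekind_eta \<tau> ^ 4 = - 2 * ee (- 1 / 4) / (2 * of_real pi * \<i>) * dedekind_eta (2 * \<tau>) ^ 2"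
    unfolding k1 1 2 using E1 by (simp add: field_simps eval_nat_numeral)
qed

text \<open>The scheme for odd p, with the fourth power K of the Klein form at 1/2 in place of H:
  K(2 tau) K(tau)^2 eta(tau)^24 is a constant times the eighth power of the ratio.\<close>

lemma eta_ratio_4_mob:
  fixes a b c d :: int
  assumes det: "a * d - b * (4 * c) = 1" and \<tau>: "Im \<tau> > 0"
  shows "eta_ratio 4 (mob a b (4 * c) d \<tau>) ^ 8 = eta_ratio 4 \<tau> ^ 8"
proof -
  define t where "t = mob a b (4 * c) d \<tau>"
  define J where "J = of_int (4 * c) * \<tau> + of_int d"
  have J: "J \<noteq> 0" unfolding J_def by (rule mob_denom_nonzero[OF det \<tau>])
  have t: "Im t > 0" unfolding t_def by (rule Im_mob_pos[OF det \<tau>])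
  have det1: "a * d - b * (2 * (2 * c)) = 1" and det2: "a * d - (2 * b) * (2 * c) = 1" using det by auto
  define K where "K = (\<lambda>\<tau>. Klein \<tau> 0 (1/2) ^ 4)"
  have Kt: "(of_int (2 * c) * \<tau> + of_int d) ^ 4 * K (mob a b (2 * c) d \<tau>) = K \<tau>"
    if det: "a * d - b * (2 * c) = 1" and \<tau>: "Im \<tau> > 0" for a b c \<tau>
  proof -
    \<comment> \<open>As d is odd, d/2 is again 1/2 up to an integer e.\<close>
    have "odd (a * d - b * (2 * c))" unfolding that(1) by simp
    hence "odd d" by auto
    then obtain e where e: "d = 2 * e + 1" by (auto elim: oddE)
    have "(of_int (2 * c) * \<tau> + of_int d) ^ 4 * K (mob a b (2 * c) d \<tau>) =
       Klein \<tau> (0 + of_int c) (1 / 2 + of_int e) ^ 4"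
      unfolding K_def power_mult_distrib[symmetric] Klein_mob[OF det \<tau>] by (simp add: e add_divide_distrib add_ac)
    also have "\<dots> = ee (of_nat 4 * ((of_int (c * e + c + e) + 0 * of_int e - 1 / 2 * of_int c) / 2)) * K \<tau>"
      unfolding Klein_shift[OF \<tau>] by (simp only: power_mult_distrib K_def ee_power)
    also have "of_nat 4 * ((of_int (c * e + c + e) + 0 * of_int e - 1 / 2 * of_int c) / 2) =
       (of_int (2 * (c * e + c + e) - c) :: complex)" by (simp add: field_simps)
    finally show ?thesis by (simp only: ee_of_int mult_1_left)
  qed
  have K1: "J ^ 4 * K t = K \<tau>" using Kt[OF det1 \<tau>] by (simp add: J_def t_def)
  have t2: "2 * t = mob a (2 * b) (2 * c) d (2 * \<tau>)" using mob_mult[of 2 a b "2 * c" d \<tau>] by (simp add: t_def)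
  have K2: "J ^ 4 * K (2 * t) = K (2 * \<tau>)" using Kt[OF det2, of "2 * \<tau>"] \<tau> unfolding t2 J_def by (simp add: mult_ac)
  obtain \<kappa> where \<kappa>: "\<kappa> \<noteq> 0" "\<And>\<tau>. Im \<tau> > 0 \<Longrightarrow> Klein \<tau> 0 (1/2) * dedekind_eta \<tau> ^ 4 = \<kappa> * dedekind_eta (2 * \<tau>) ^ 2"
    using Klein_half_2 by blast
  have R: "\<kappa> ^ 12 * eta_ratio 4 \<tau> ^ 8 = K (2 * \<tau>) * K \<tau> ^ 2 * dedekind_eta \<tau> ^ 24" if \<tau>: "Im \<tau> > 0" for \<tau>
  proof -
    define x where "x = dedekind_eta \<tau>"
    define y where "y = dedekind_eta (2 * \<tau>)"
    define z where "z = dedekind_eta (4 * \<tau>)"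
    have nz: "x \<noteq> 0" "y \<noteq> 0" using dedekind_eta_nonzero[of \<tau>] dedekind_eta_nonzero[of "2 * \<tau>"] \<tau>
      by (auto simp: x_def y_def)
    have z: "dedekind_eta (2 * (2 * \<tau>)) = z" by (simp add: z_def)
    have k: "Klein \<tau> 0 (1/2) = \<kappa> * y ^ 2 / x ^ 4" "Klein (2 * \<tau>) 0 (1/2) = \<kappa> * z ^ 2 / y ^ 4"
      using \<kappa>(2)[OF \<tau>] \<kappa>(2)[of "2 * \<tau>"] \<tau> nz unfolding z x_def[symmetric] y_def[symmetric]
      by (auto simp: field_simps)
    have e: "eta_ratio 4 \<tau> = z / x" by (simp add: eta_ratio_def x_def z_def)
    show ?thesis unfolding K_def k e x_def[symmetric] using nz
      by (simp add: power_divide power_mult_distrib field_simps flip: power_mult power_add)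
  qed
  have et: "dedekind_eta t ^ 24 = J ^ 12 * dedekind_eta \<tau> ^ 24"
    unfolding t_def J_def by (rule dedekind_eta_24_mob[OF det \<tau>])
  have J12: "J ^ 12 = J ^ 4 * (J ^ 4) ^ 2" by (simp flip: power_mult power_add)
  have "\<kappa> ^ 12 * eta_ratio 4 t ^ 8 = (J ^ 4 * K (2 * t)) * (J ^ 4 * K t) ^ 2 * dedekind_eta \<tau> ^ 24"
    unfolding R[OF t] et J12 by (simp add: power_mult_distrib)
  also have "\<dots> = \<kappa> ^ 12 * eta_ratio 4 \<tau> ^ 8" unfolding K1 K2 R[OF \<tau>] ..
  finally show ?thesis using \<kappa>(1) by (simp add: t_def)
qed

theorem eta_ratio_square_mob:
  fixes a b c d r :: int
  assumes p: "prime p" and det: "a * d - b * (int p ^ 2 * c) = 1" and \<tau>: "Im \<tau> > 0"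
    and r: "24 dvd r * (int p ^ 2 - 1)"
  shows "eta_ratio (p ^ 2) (mob a b (int p ^ 2 * c) d \<tau>) powi r = eta_ratio (p ^ 2) \<tau> powi r"
proof (cases "p = 2")
  case True
  have "r * (int p ^ 2 - 1) = r * 3" by (simp add: True)
  with r have "24 dvd r * 3" by simp
  hence "8 dvd r" by presburger
  then obtain k where k: "r = 8 * k" by blast
  have "x powi r = (x ^ 8) powi k" for x :: complex
    unfolding k by (simp add: power_int_mult)
  thus ?thesis using eta_ratio_4_mob[of a d b c \<tau>] det \<tau> True by simp
next
  case False
  thus ?thesis using eta_ratio_square_mob_odd[OF _ _ det \<tau> r] p prime_odd_nat[OF p] prime_gt_1_nat[OF p]
    prime_ge_2_nat[OF p] by simp
qed

section \<open>A vanishing theorem for level p\<close>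

lemma upper_half_plane: "open {\<tau>. Im \<tau> > 0}" "connected {\<tau>. Im \<tau> > 0}" "\<i> \<in> {\<tau>. Im \<tau> > 0}"
  by (auto simp: open_halfspace_Im_gt intro!: convex_connected convex_halfspace_Im_gt)

abbreviation fricke :: "nat \<Rightarrow> complex \<Rightarrow> complex" where
  "fricke p \<tau> \<equiv> - 1 / (of_nat p * \<tau>)"

text \<open>Uniform in the real part, so that a whole half-plane Im tau >= Y is controlled at once
  in the maximum modulus argument.\<close>

definition tends_to_0_at_cusp :: "(complex \<Rightarrow> complex) \<Rightarrow> bool" where
  "tends_to_0_at_cusp g \<longleftrightarrow> (\<forall>\<epsilon>>0. \<exists>Y. \<forall>\<tau>. Im \<tau> \<ge> Y \<longrightarrow> norm (g \<tau>) < \<epsilon>)"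

text \<open>A coarse substitute for the standard fundamental domain: if |Re t| <= 1/2 and Im t <
  1/2, then |t|^2 <= 1/2 and inversion at least doubles Im t. The number of doublings needed is
  bounded in advance, which gives the induction.\<close>

lemma level_one_reduce:
  assumes T: "\<And>\<tau>. Im \<tau> > 0 \<Longrightarrow> g (\<tau> + 1) = g \<tau>" and S: "\<And>\<tau>. Im \<tau> > 0 \<Longrightarrow> g (- 1 / \<tau>) = g \<tau>"
    and \<tau>: "Im \<tau> > 0"
  shows "\<exists>\<tau>'. \<bar>Re \<tau>'\<bar> \<le> 1 / 2 \<and> Im \<tau>' \<ge> 1 / 2 \<and> g \<tau>' = g \<tau>"
proof -
  have shift: "g (\<tau> + of_int n) = g \<tau>" if "Im \<tau> > 0" for \<tau> n
  proof (induction n rule: int_induct[where k = 0])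
    case (step1 i)
    thus ?case using T[of "\<tau> + of_int i"] that by (simp add: add_ac)
  next
    case (step2 i)
    thus ?case using T[of "\<tau> + of_int (i - 1)"] that by (simp add: add_ac)
  qed simp
  have red: "\<exists>\<tau>'. \<bar>Re \<tau>'\<bar> \<le> 1 / 2 \<and> Im \<tau>' = Im \<tau> \<and> g \<tau>' = g \<tau>" if "Im \<tau> > 0" for \<tau>
  proof (intro exI conjI)
    show "g (\<tau> + of_int (- round (Re \<tau>))) = g \<tau>" by (rule shift[OF that])
    show "\<bar>Re (\<tau> + of_int (- round (Re \<tau>)))\<bar> \<le> 1 / 2"
      using of_int_round_abs_le[of "Re \<tau>"] by (simp add: abs_minus_commute)
  qed auto
  have main: "Im \<tau> > 0 \<Longrightarrow> Im \<tau> \<ge> (1 / 2) ^ n / 2 \<Longrightarrow> \<exists>\<tau>'. \<bar>Re \<tau>'\<bar> \<le> 1 / 2 \<and> Im \<tau>' \<ge> 1 / 2 \<and> g \<tau>' = g \<tau>" for n \<tau>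
  proof (induction n arbitrary: \<tau>)
    case 0
    thus ?case using red[of \<tau>] by auto
  next
    case (Suc n)
    obtain t where t: "\<bar>Re t\<bar> \<le> 1 / 2" "Im t = Im \<tau>" "g t = g \<tau>" using red[of \<tau>] Suc.prems by auto
    show ?case
    proof (cases "Im t \<ge> 1 / 2")
      case True
      thus ?thesis using t by auto
    next
      case False
      have tp: "Im t > 0" using t Suc.prems by simp
      have "(Re t)\<^sup>2 \<le> (1 / 2)\<^sup>2" using t(1) by (simp add: abs_le_square_iff[symmetric])
      moreover have "(Im t)\<^sup>2 \<le> (1 / 2)\<^sup>2" using False tp by (intro power_mono) auto
      ultimately have n: "(Re t)\<^sup>2 + (Im t)\<^sup>2 \<le> 1 / 2" by (simp add: power2_eq_square)
      have pos: "(Re t)\<^sup>2 + (Im t)\<^sup>2 > 0" using tp by (simp add: add_nonneg_pos)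
      have im: "Im (- 1 / t) = Im t / ((Re t)\<^sup>2 + (Im t)\<^sup>2)" by (simp add: Im_divide)
      have "2 * Im t * ((Re t)\<^sup>2 + (Im t)\<^sup>2) \<le> 2 * Im t * (1 / 2)" using n tp by (intro mult_left_mono) auto
      hence "Im (- 1 / t) \<ge> 2 * Im t" unfolding im using pos by (simp add: pos_le_divide_eq)
      moreover have "2 * Im t \<ge> (1 / 2) ^ n / 2" using Suc.prems t by simp
      ultimately have "\<exists>\<tau>'. \<bar>Re \<tau>'\<bar> \<le> 1 / 2 \<and> Im \<tau>' \<ge> 1 / 2 \<and> g \<tau>' = g (- 1 / t)"
        using tp by (intro Suc.IH) auto
      thus ?thesis using S[OF tp] t by simp
    qed
  qed
  obtain n where "(1 / 2 :: real) ^ n < Im \<tau>" using real_arch_pow_inv[of "Im \<tau>" "1/2"] \<tau> by auto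
  hence "Im \<tau> \<ge> (1 / 2) ^ n / 2" using zero_less_power[of "1/2 :: real" n] by linarith
  thus ?thesis using main \<tau> by blast
qed

text \<open>If g is nonzero at tau, then |g| reaches its supremum over the half-plane on a compact
  box: above the box it is smaller than |g tau|, and every orbit meets the strip. Hence g is
  constant, and the cusp contradicts a nonzero constant.\<close>

lemma level_one_zero:
  assumes hol: "g holomorphic_on {\<tau>. Im \<tau> > 0}"
    and T: "\<And>\<tau>. Im \<tau> > 0 \<Longrightarrow> g (\<tau> + 1) = g \<tau>" and S: "\<And>\<tau>. Im \<tau> > 0 \<Longrightarrow> g (- 1 / \<tau>) = g \<tau>"
    and cusp: "tends_to_0_at_cusp g" and \<tau>: "Im \<tau> > 0"
  shows "g \<tau> = 0"
proof (rule ccontr)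
  assume nz: "g \<tau> \<noteq> 0"
  then obtain Y where Y: "\<And>t. Im t \<ge> Y \<Longrightarrow> norm (g t) < norm (g \<tau>)"
    using cusp unfolding tends_to_0_at_cusp_def by (meson zero_less_norm_iff)
  define Z where "Z = max Y (1 / 2)"
  define K where "K = cbox (Complex (- 1 / 2) (1 / 2)) (Complex (1 / 2) Z)"
  have K: "t \<in> K \<longleftrightarrow> \<bar>Re t\<bar> \<le> 1 / 2 \<and> 1 / 2 \<le> Im t \<and> Im t \<le> Z" for t
    by (auto simp: K_def in_cbox_complex_iff)
  have "continuous_on K (\<lambda>t. norm (g t))"
    using holomorphic_on_imp_continuous_on[OF hol] by (intro continuous_on_norm) (auto elim!: continuous_on_subset simp: K)
  moreover have "compact K" by (simp add: K_def)
  moreover have "Complex 0 (1 / 2) \<in> K" by (simp add: K Z_def)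
  ultimately obtain w where w: "w \<in> K" "\<And>t. t \<in> K \<Longrightarrow> norm (g t) \<le> norm (g w)"
    using continuous_attains_sup[of K "\<lambda>t. norm (g t)"] by blast
  have bound1: "norm (g t) \<le> max (norm (g w)) (norm (g \<tau>))" and
       bound2: "norm (g t) \<ge> norm (g \<tau>) \<Longrightarrow> norm (g t) \<le> norm (g w)" if t: "Im t > 0" for t
  proof -
    obtain t' where t': "\<bar>Re t'\<bar> \<le> 1 / 2" "Im t' \<ge> 1 / 2" "g t' = g t"
      using level_one_reduce[OF T S t] by blast
    show "norm (g t) \<le> max (norm (g w)) (norm (g \<tau>))"
    proof (cases "t' \<in> K")
      case True
      thus ?thesis using w(2)[OF True] t'(3) by simp
    next
      case False
      hence "Im t' \<ge> Y" using t' by (auto simp: K Z_def)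
      thus ?thesis using Y[of t'] t'(3) by simp
    qed
    assume ge: "norm (g t) \<ge> norm (g \<tau>)"
    have "t' \<in> K"
    proof (rule ccontr)
      assume "t' \<notin> K"
      hence "Im t' \<ge> Y" using t' by (auto simp: K Z_def)
      thus False using Y[of t'] t'(3) ge by simp
    qed
    thus "norm (g t) \<le> norm (g w)" using w(2) t'(3) by metis
  qed
  have "norm (g \<tau>) \<le> norm (g w)" using bound2[OF \<tau>] by simp
  hence bound: "norm (g t) \<le> norm (g w)" if "Im t > 0" for t using bound1[OF that] by simp
  have "g constant_on {\<tau>. Im \<tau> > 0}"
    by (rule maximum_modulus_principle[OF hol upper_half_plane(1,2) upper_half_plane(1), of w])
       (use w(1) bound in \<open>auto simp: K\<close>)
  then obtain k where k: "\<And>t. Im t > 0 \<Longrightarrow> g t = k" by (auto simp: constant_on_def)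
  have "norm (g (Complex 0 (max Y 1))) < norm (g \<tau>)" by (rule Y) auto
  thus False using k[of "Complex 0 (max Y 1)"] k[OF \<tau>] by simp
qed

lemma holomorphic_mult_eq_0:
  assumes "open S" "connected S" "f holomorphic_on S" "g holomorphic_on S" "\<And>z. z \<in> S \<Longrightarrow> f z * g z = 0"
  shows "(\<forall>z\<in>S. f z = 0) \<or> (\<forall>z\<in>S. g z = 0)"
proof (rule disjCI, rule ccontr)
  assume "\<not> (\<forall>z\<in>S. g z = 0)" and f: "\<not> (\<forall>z\<in>S. f z = 0)"
  then obtain z where z: "z \<in> S" "g z \<noteq> 0" by blast
  have "isCont g z" using holomorphic_on_imp_continuous_on[OF assms(4)] assms(1) z(1)
    by (simp add: continuous_on_eq_continuous_at)
  then obtain e where e: "e > 0" "\<And>y. dist z y < e \<Longrightarrow> g y \<noteq> 0" using continuous_at_avoid[of z g 0] z(2) by blast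
  obtain d where d: "d > 0" "ball z d \<subseteq> S" using assms(1) z(1) openE by blast
  define U where "U = ball z (min d e)"
  have "f w = 0" if "w \<in> S" for w
  proof (rule analytic_continuation_open[of U S f "\<lambda>_. 0"])
    show "f u = 0" if "u \<in> U" for u using that assms(5)[of u] e d by (auto simp: U_def subset_iff)
  qed (use assms d e that in \<open>auto simp: U_def\<close>)
  thus False using f by blast
qed

lemma holomorphic_prod_eq_0:
  assumes "finite I" "open S" "connected S" "\<And>i. i \<in> I \<Longrightarrow> f i holomorphic_on S" "\<And>z. z \<in> S \<Longrightarrow> (\<Prod>i\<in>I. f i z) = 0" "S \<noteq> {}"
  shows "\<exists>i\<in>I. \<forall>z\<in>S. f i z = 0"
  using assms(1,4,5)
proof (induction I rule: finite_induct)
  case empty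
  thus ?case using assms(6) by auto
next
  case (insert i I)
  have "(\<forall>z\<in>S. f i z = 0) \<or> (\<forall>z\<in>S. (\<Prod>i\<in>I. f i z) = 0)"
    by (rule holomorphic_mult_eq_0[OF assms(2,3)])
       (use insert in \<open>auto intro!: holomorphic_on_prod\<close>)
  thus ?case using insert by auto
qed

text \<open>The inversion tau -> -1/tau permutes the cosets with nonzero j by j -> -1/j mod p; being
  an involution, this map serves as its own inverse in the reindexing.\<close>

lemma neg_inverse_mod_prime:
  fixes p :: nat
  assumes "prime p"
  shows "\<exists>\<sigma>. \<forall>j\<in>{1..<p}. \<sigma> j \<in> {1..<p} \<and> \<sigma> (\<sigma> j) = j \<and> p dvd j * \<sigma> j + 1"
proof -
  have ex: "\<exists>k\<in>{1..<p}. p dvd j * k + 1" if j: "j \<in> {1..<p}" for j :: nat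
  proof -
    have "\<not> p dvd j" using j by (auto dest: dvd_imp_le)
    hence "coprime p j" by (rule prime_imp_coprime[OF assms])
    hence "coprime (int j) (int p)" by (simp add: coprime_commute)
    then obtain u v where uv: "u * int j + v * int p = 1" using bezout_int[of "int j" "int p"] by auto
    define k where "k = nat ((- u) mod int p)"
    have k: "int k = (- u) mod int p" using assms prime_gt_0_nat by (simp add: k_def)
    have "int (j * k + 1) = int j * (- u - int p * ((- u) div int p)) + (u * int j + v * int p)"
      unfolding uv by (simp add: k minus_mult_div_eq_mod)
    also have "\<dots> = int p * (v - int j * ((- u) div int p))" by (simp add: algebra_simps)
    finally have "int p dvd int (j * k + 1)" by simp
    hence d: "p dvd j * k + 1" by (simp only: int_dvd_int_iff)
    have "k < p" using k assms prime_gt_0_nat by (metis of_nat_0_less_iff of_nat_less_iff pos_mod_bound)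
    moreover have "k \<noteq> 0" using d assms by (intro notI) auto
    ultimately show ?thesis using d by auto
  qed
  have uniq: "k = k'" if "j \<in> {1..<p}" "k \<in> {1..<p}" "k' \<in> {1..<p}" "p dvd j * k + 1" "p dvd j * k' + 1" for j k k' :: nat
  proof -
    have "int p dvd int (j * k + 1) - int (j * k' + 1)" using that by (intro dvd_diff) (simp_all only: int_dvd_int_iff)
    also have "int (j * k + 1) - int (j * k' + 1) = int j * (int k - int k')" by (simp add: algebra_simps)
    finally have "int p dvd int j \<or> int p dvd int k - int k'" using assms by (simp add: prime_dvd_mult_iff)
    moreover have "\<not> int p dvd int j" using that(1) by (auto dest: dvd_imp_le)
    ultimately have "int p dvd int k - int k'" by blast
    moreover have "\<bar>int k - int k'\<bar> < int p" using that by auto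
    ultimately show "k = k'" using zdvd_not_zless[of "\<bar>int k - int k'\<bar>" "int p"] by auto
  qed
  obtain \<sigma> where \<sigma>: "\<And>j. j \<in> {1..<p} \<Longrightarrow> \<sigma> j \<in> {1..<p} \<and> p dvd j * \<sigma> j + 1" using ex by metis
  have "\<sigma> (\<sigma> j) = j" if "j \<in> {1..<p}" for j
    using uniq[of "\<sigma> j" "\<sigma> (\<sigma> j)" j] \<sigma>[OF that] \<sigma>[of "\<sigma> j"] that by (simp add: mult.commute)
  thus ?thesis using \<sigma> by blast
qed

text \<open>
  The norm of \<open>G\<close> to level one, i.e. the product over the cosets of \<open>\<Gamma>\<^sub>0(p)\<close>, vanishes by the maximum
  modulus principle.
\<close>

theorem level_p_zero:
  assumes p: "prime p" and hol: "G holomorphic_on {\<tau>. Im \<tau> > 0}"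
    and inv: "\<And>a b c d \<tau>. a * d - b * (int p * c) = 1 \<Longrightarrow> Im \<tau> > 0 \<Longrightarrow> G (mob a b (int p * c) d \<tau>) = G \<tau>"
    and cusp0: "\<And>\<tau>. Im \<tau> \<ge> Y \<Longrightarrow> norm (G (fricke p \<tau>)) \<le> B"
    and cusp_inf: "tends_to_0_at_cusp G" and \<tau>: "Im \<tau> > 0"
  shows "G \<tau> = 0"
proof -
  have p0: "p > 0" using p prime_gt_0_nat by blast
  \<comment> \<open>Together with the identity, S T^j for 0 <= j < p represents the cosets of
    Gamma_0(p), where S is the inversion and T the translation by 1.\<close>
  define f where "f = (\<lambda>\<tau> j. G (- 1 / (\<tau> + of_nat j)))"
  define g where "g = (\<lambda>\<tau>. G \<tau> * (\<Prod>j<p. f \<tau> j))"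
  have Im_inv: "Im (- 1 / t) > 0" if "Im t > 0" for t
  proof -
    have "t \<noteq> 0" using that by auto
    thus ?thesis using that by (simp add: Im_divide add_nonneg_pos)
  qed
  have nz: "t + of_nat j \<noteq> 0" if "Im t > 0" for t j using that by (metis add_cancel_right_right complex_Im_of_nat order_less_irrefl plus_complex.simps(2) zero_complex.simps(2))
  have holf: "(\<lambda>\<tau>. f \<tau> j) holomorphic_on {\<tau>. Im \<tau> > 0}" for j
  proof -
    have "(\<lambda>\<tau>. - 1 / (\<tau> + of_nat j)) holomorphic_on {\<tau>. Im \<tau> > 0}"
      using nz by (intro holomorphic_intros) auto
    moreover have "Im (- 1 / (t + of_nat j)) > 0" if "Im t > 0" for t using Im_inv[of "t + of_nat j"] that by simp
    ultimately show ?thesis unfolding f_def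
      by (intro holomorphic_on_compose_gen[OF _ hol, unfolded o_def]) auto
  qed
  have g0: "g t = 0" if t: "Im t > 0" for t
  proof (rule level_one_zero[OF _ _ _ _ t])
    show "g holomorphic_on {\<tau>. Im \<tau> > 0}"
      unfolding g_def by (intro holomorphic_intros hol holf)
    show "g (t + 1) = g t" if t: "Im t > 0" for t
    proof -
      have "G (t + 1) = G t" using inv[of 1 1 1 0 t] t by (simp add: mob_def)
      moreover have "(\<Prod>j<p. f (t + 1) j) = (\<Prod>j<p. f t j)"
      proof -
        obtain p' where p': "p = Suc p'" using p0 by (cases p) auto
        \<comment> \<open>Translation shifts j to j + 1; the overflowing index p agrees with 0
          through the matrix (1, 0; -p, 1).\<close>
        have "f t p = f t 0"
        proof -
          have t0: "t \<noteq> 0" using t by auto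
          have "mob 1 0 (int p * (- 1)) 1 (- 1 / t) = - 1 / (t + of_nat p)"
            using t0 nz[OF t, of p] by (simp add: mob_def field_simps)
          thus ?thesis using inv[of 1 1 0 "-1" "- 1 / t"] Im_inv[OF t] by (simp add: f_def)
        qed
        moreover have "f (t + 1) j = f t (Suc j)" for j by (simp add: f_def add_ac)
        ultimately show ?thesis unfolding p' by (subst prod.lessThan_Suc_shift, subst prod.lessThan_Suc) (simp add: p')
      qed
      ultimately show ?thesis by (simp add: g_def)
    qed
    show "g (- 1 / t) = g t" if t: "Im t > 0" for t
    proof -
      have t0: "t \<noteq> 0" using t by auto
      obtain \<sigma> where \<sigma>: "\<And>j. j \<in> {1..<p} \<Longrightarrow> \<sigma> j \<in> {1..<p} \<and> \<sigma> (\<sigma> j) = j \<and> p dvd j * \<sigma> j + 1"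
        using neg_inverse_mod_prime[OF p] by blast
      have ins: "{..<p} = insert 0 {1..<p}" using p0 by auto
      \<comment> \<open>The identity coset and j = 0 change places; the others are permuted by
        sigma.\<close>
      have "f (- 1 / t) 0 = G t" by (simp add: f_def)
      moreover have "(\<Prod>j\<in>{1..<p}. f (- 1 / t) j) = (\<Prod>j\<in>{1..<p}. f t j)"
      proof (rule prod.reindex_bij_witness[of _ \<sigma> \<sigma>])
        fix j assume j: "j \<in> {1..<p}"
        define k where "k = \<sigma> j"
        obtain l where l: "j * k + 1 = p * l" using \<sigma>[OF j] unfolding k_def by blast
        have "int j * int k + 1 = int p * int l" using l by (metis of_nat_1 of_nat_add of_nat_mult)
        hence det: "(- int k) * int j - (- 1) * (int p * int l) = 1" by (simp add: algebra_simps)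
        have l': "of_nat p * of_nat l = (of_nat j * of_nat k + 1 :: complex)" using l by (metis of_nat_1 of_nat_add of_nat_mult)
        have nj: "of_nat j * t - 1 \<noteq> 0"
        proof
          assume "of_nat j * t - 1 = 0"
          hence "Im (of_nat j * t - 1) = 0" by simp
          thus False using t j by auto
        qed
        have "mob (- int k) (- 1) (int p * int l) (int j) (- 1 / (t + of_nat k)) =
          (of_nat k / (t + of_nat k) - 1) / (of_nat j - (of_nat j * of_nat k + 1) / (t + of_nat k))"
          by (simp add: mob_def l')
        also have "of_nat k / (t + of_nat k) - 1 = - t / (t + of_nat k)" using nz[OF t, of k] by (simp add: field_simps)
        also have "of_nat j - (of_nat j * of_nat k + 1) / (t + of_nat k) = (of_nat j * t - 1) / (t + of_nat k)"
          using nz[OF t, of k] by (simp add: field_simps)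
        also have "(- t / (t + of_nat k)) / ((of_nat j * t - 1) / (t + of_nat k)) = - t / (of_nat j * t - 1)"
          using nz[OF t, of k] by simp
        also have "\<dots> = - 1 / (- 1 / t + of_nat j)"
          using t0 nj by (simp add: field_simps)
        finally show "f t (\<sigma> j) = f (- 1 / t) j"
          using inv[OF det, of "- 1 / (t + of_nat k)"] Im_inv[of "t + of_nat k"] t by (simp add: f_def k_def)
      qed (use \<sigma> in auto)
      ultimately show ?thesis unfolding g_def ins by (simp add: f_def)
    qed
    show "tends_to_0_at_cusp g" unfolding tends_to_0_at_cusp_def
    proof (intro allI impI)
      fix \<epsilon> :: real assume \<epsilon>: "\<epsilon> > 0"
      define B' where "B' = max B 1"
      have B': "B' > 0" by (simp add: B'_def)
      then obtain Y1 where Y1: "\<And>t. Im t \<ge> Y1 \<Longrightarrow> norm (G t) < \<epsilon> / B' ^ p"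
        using cusp_inf \<epsilon> unfolding tends_to_0_at_cusp_def by (meson divide_pos_pos zero_less_power)
      have "norm (g t) < \<epsilon>" if t: "Im t \<ge> max Y1 (of_nat p * Y)" for t
      proof -
        \<comment> \<open>The point -1/(t + j) is the Fricke image of (t + j)/p, so height p Y for t
          suffices.\<close>
        have "norm (f t j) \<le> B'" for j
        proof -
          have "Im ((t + of_nat j) / of_nat p) \<ge> Y" using t p0 by (simp add: field_simps)
          from cusp0[OF this] show ?thesis using p0 by (simp add: f_def B'_def)
        qed
        hence "norm (\<Prod>j<p. f t j) \<le> (\<Prod>j<p. B')" unfolding prod_norm[symmetric] by (intro prod_mono) auto
        hence "norm (\<Prod>j<p. f t j) \<le> B' ^ p" by simp
        hence "norm (g t) \<le> norm (G t) * B' ^ p" unfolding g_def norm_mult by (intro mult_left_mono) auto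
        also have "\<dots> < \<epsilon> / B' ^ p * B' ^ p" using Y1[of t] t B' by (intro mult_strict_right_mono) auto
        finally show ?thesis using B' by simp
      qed
      thus "\<exists>Y. \<forall>\<tau>. Im \<tau> \<ge> Y \<longrightarrow> norm (g \<tau>) < \<epsilon>" by blast
    qed
  qed
  have "(\<forall>z\<in>{\<tau>. Im \<tau> > 0}. G z = 0) \<or> (\<forall>z\<in>{\<tau>. Im \<tau> > 0}. (\<Prod>j<p. f z j) = 0)"
    by (rule holomorphic_mult_eq_0[OF upper_half_plane(1,2) hol])
       (use g0 in \<open>auto simp: g_def intro!: holomorphic_on_prod holf\<close>)
  thus ?thesis
  proof
    assume "\<forall>z\<in>{\<tau>. Im \<tau> > 0}. (\<Prod>j<p. f z j) = 0"
    hence "\<exists>j\<in>{..<p}. \<forall>z\<in>{\<tau>. Im \<tau> > 0}. f z j = 0"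
      using upper_half_plane by (intro holomorphic_prod_eq_0[where S = "{\<tau>. Im \<tau> > 0}"] holf) (auto intro: exI[of _ \<i>])
    then obtain j where j: "\<And>z. Im z > 0 \<Longrightarrow> f z j = 0" by blast
    \<comment> \<open>The map z -> -1/(z + j) is onto the half-plane, so the vanishing of one factor
      is that of G.\<close>
    have "f (- 1 / \<tau> - of_nat j) j = 0" using Im_inv[OF \<tau>] by (intro j) simp
    thus ?thesis by (simp add: f_def)
  qed (use \<tau> in auto)
qed

section \<open>The operator U and its growth at the cusp 0\<close>

lemma eta_ratio_mult:
  assumes "Im \<tau> > 0" "m > 0"
  shows "eta_ratio (n * m) \<tau> = eta_ratio n (of_nat m * \<tau>) * eta_ratio m \<tau>"
  using dedekind_eta_nonzero[of "of_nat m * \<tau>"] assms by (simp add: eta_ratio_def mult_ac)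

text \<open>The quotient telescopes into steps of p^2, and multiplying tau by p^(2k) turns a matrix
  of level p^(2k+2) into one of level p^2.\<close>

lemma eta_ratio_even_power_mob:
  fixes a b c d r :: int
  assumes p: "prime p" and r: "24 dvd r * (int p ^ 2 - 1)"
    and det: "a * d - b * (int p ^ (2 * k) * c) = 1" and \<tau>: "Im \<tau> > 0"
  shows "eta_ratio (p ^ (2 * k)) (mob a b (int p ^ (2 * k) * c) d \<tau>) powi r = eta_ratio (p ^ (2 * k)) \<tau> powi r"
  using det \<tau>
proof (induction k arbitrary: b c \<tau>)
  case 0
  have "Im (mob a b c d \<tau>) > 0" using Im_mob_pos[of a d b c \<tau>] 0 by simp
  thus ?case using 0 dedekind_eta_nonzero by (simp add: eta_ratio_def)
next
  case (Suc k)
  define m where "m = p ^ (2 * k)"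
  have m: "m > 0" using p prime_gt_0_nat by (simp add: m_def)
  have pm: "p ^ (2 * Suc k) = p\<^sup>2 * m" by (simp add: m_def power2_eq_square)
  have c1: "int p ^ (2 * Suc k) * c = int p ^ (2 * k) * (int p ^ 2 * c)" by (simp add: power2_eq_square mult_ac)
  define t where "t = mob a b (int p ^ (2 * Suc k) * c) d \<tau>"
  have t: "Im t > 0" unfolding t_def by (rule Im_mob_pos[OF Suc.prems])
  have "eta_ratio m t powi r = eta_ratio m \<tau> powi r"
    unfolding t_def c1 m_def by (rule Suc.IH) (use Suc.prems in \<open>simp_all only: c1\<close>)
  moreover have "of_nat m * t = mob a (int m * b) (int p ^ 2 * c) d (of_nat m * \<tau>)"
    unfolding t_def c1 using mob_mult[OF m, of a b "int p ^ 2 * c" d \<tau>] by (simp add: m_def)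
  moreover have "a * d - (int m * b) * (int p ^ 2 * c) = 1"
    using Suc.prems by (simp add: m_def power2_eq_square mult_ac)
  ultimately show ?case
    using eta_ratio_square_mob[OF p, of a d "int m * b" c "of_nat m * \<tau>" r] r m Suc.prems(2)
    unfolding pm t_def[symmetric]
    by (simp add: eta_ratio_mult[OF Suc.prems(2) m] eta_ratio_mult[OF t m] power_int_mult_distrib)
qed

definition U_ratio :: "nat \<Rightarrow> nat \<Rightarrow> int \<Rightarrow> complex \<Rightarrow> complex" where
  "U_ratio p \<beta> r \<tau> =
     (\<Sum>j<p ^ \<beta>. eta_ratio (p ^ (\<beta> + beta_bar \<beta>)) ((\<tau> + of_nat j) / of_nat (p ^ \<beta>)) powi (- r)) / of_nat (p ^ \<beta>)"

lemma even_beta: "\<exists>k. \<beta> + beta_bar \<beta> = 2 * k"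
proof -
  have "even (\<beta> + beta_bar \<beta>)" by (simp add: beta_bar_def)
  thus ?thesis unfolding dvd_def .
qed

text \<open>With u = (tau + j)/p^beta, moving tau by the matrix amounts to replacing j by
  \<open>\<sigma> j\<close> and moving u by a matrix with lower left entry p^beta (p c). This is
  divisible by the level p^(beta + beta_bar) of g, as beta_bar <= 1, and sigma only permutes the
  summands.\<close>

theorem U_ratio_mob:
  fixes a b c d r :: int
  assumes p: "prime p" and r: "24 dvd r * (int p ^ 2 - 1)" and \<beta>: "\<beta> > 0"
    and det: "a * d - b * (int p * c) = 1" and \<tau>: "Im \<tau> > 0"
  shows "U_ratio p \<beta> r (mob a b (int p * c) d \<tau>) = U_ratio p \<beta> r \<tau>"
proof -
  define M where "M = p ^ \<beta>"
  define e where "e = \<beta> + beta_bar \<beta>"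
  obtain k where k: "e = 2 * k" using even_beta e_def by metis
  have M: "M > 0" using p prime_gt_0_nat by (simp add: M_def)
  define C where "C = int p * c"
  have detC: "a * d - b * C = 1" using det by (simp add: C_def)
  define G where "G = (\<lambda>u. eta_ratio (p ^ e) u powi (- r))"
  have cop: "coprime (x + int j * C) (int M)" if "x * y - z * (int p * w) = 1" for x y z w j
  proof -
    have "coprime x (int p)" using coprime_of_det[of y x z "int p" w] that by (simp add: mult.commute)
    moreover have "x + int j * C = (int j * c) * int p + x" by (simp add: C_def)
    ultimately have "coprime (int p) (x + int j * C)"
      using gcd_add_mult[of "int p" "int j * c" x] by (simp only: coprime_iff_gcd_eq_1 gcd.commute[of x])
    hence "coprime (x + int j * C) (int p)" by (simp only: coprime_commute)
    thus ?thesis by (simp add: M_def)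
  qed
  \<comment> \<open>The congruence j' (a + j C) = b + j d modulo M is solvable because a + j C is
    prime to p.\<close>
  have ex: "\<exists>j'<M. int M dvd b + int j * d - int j' * (a + int j * C)" for j
  proof -
    have "coprime (a + int j * C) (int M)" by (rule cop[of a d b c]) (use det in auto)
    then obtain u v where uv: "u * (a + int j * C) + v * int M = 1"
      using bezout_int[of "a + int j * C" "int M"] by auto
    define B where "B = b + int j * d"
    define j' where "j' = nat ((u * B) mod int M)"
    have j': "int j' = (u * B) mod int M" using M by (simp add: j'_def)
    have "B - int j' * (a + int j * C) = B * (u * (a + int j * C) + v * int M) - (u * B - int M * (u * B div int M)) * (a + int j * C)"
      unfolding uv by (simp add: j' minus_mult_div_eq_mod)
    also have "\<dots> = int M * (B * v + (u * B div int M) * (a + int j * C))" by (simp add: algebra_simps)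
    finally have "int M dvd B - int j' * (a + int j * C)" by simp
    moreover have "j' < M" using j' M by (metis of_nat_0_less_iff of_nat_less_iff pos_mod_bound)
    ultimately show ?thesis by (auto simp: B_def)
  qed
  then obtain \<sigma> where \<sigma>: "\<And>j. \<sigma> j < M" "\<And>j. int M dvd b + int j * d - int (\<sigma> j) * (a + int j * C)" by metis
  have inj: "inj_on \<sigma> {..<M}"
  proof (rule inj_onI)
    fix x y assume xy: "x \<in> {..<M}" "y \<in> {..<M}" "\<sigma> x = \<sigma> y"
    have "int M dvd (b + int x * d - int (\<sigma> x) * (a + int x * C)) - (b + int y * d - int (\<sigma> x) * (a + int y * C))"
      using \<sigma>(2)[of x] \<sigma>(2)[of y, folded xy(3)] by (rule dvd_diff)
    also have "(b + int x * d - int (\<sigma> x) * (a + int x * C)) - (b + int y * d - int (\<sigma> x) * (a + int y * C))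
      = (int x - int y) * (d - int (\<sigma> x) * C)" by (simp add: algebra_simps)
    finally have dv: "int M dvd (int x - int y) * (d - int (\<sigma> x) * C)" .
    have "coprime (- d + int (\<sigma> x) * C) (int M)" by (rule cop[of "-d" "- a" b c]) (use det in \<open>simp add: mult.commute\<close>)
    hence "coprime (d - int (\<sigma> x) * C) (int M)"
      by (metis coprime_minus_left_iff minus_diff_eq uminus_add_conv_diff)
    hence "int M dvd int x - int y" using dv by (simp add: coprime_commute coprime_dvd_mult_left_iff)
    moreover have "\<bar>int x - int y\<bar> < int M" using xy by auto
    ultimately show "x = y" using zdvd_not_zless[of "\<bar>int x - int y\<bar>" "int M"] by auto
  qed
  have bij: "bij_betw \<sigma> {..<M} {..<M}"
    using inj \<sigma>(1) by (intro bij_betw_imageI endo_inj_surj) auto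
  have key: "G ((mob a b C d \<tau> + of_nat j) / of_nat M) = G ((\<tau> + of_nat (\<sigma> j)) / of_nat M)" for j
  proof -
    obtain B where B: "b + int j * d - int (\<sigma> j) * (a + int j * C) = int M * B" using \<sigma>(2) by blast
    define u where "u = (\<tau> + of_nat (\<sigma> j)) / of_nat M"
    \<comment> \<open>For even beta the level is p^beta, one factor p less than the lower left entry
      contains; c' absorbs it.\<close>
    define c' where "c' = (if odd \<beta> then c else C)"
    have "int M * C = int p ^ e * c'"
      by (auto simp: M_def C_def e_def c'_def beta_bar_def)
    hence MC: "int M * C = int p ^ (2 * k) * c'" using k by simp
    have "(a + int j * C) * (d - C * int (\<sigma> j)) - B * (int M * C) =
      (a + int j * C) * (d - C * int (\<sigma> j)) - (b + int j * d - int (\<sigma> j) * (a + int j * C)) * C"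
      unfolding B by (simp add: mult_ac)
    also have "\<dots> = 1" using detC by (simp add: algebra_simps)
    finally have det': "(a + int j * C) * (d - C * int (\<sigma> j)) - B * (int p ^ (2 * k) * c') = 1" by (simp only: MC)
    have u: "Im u > 0" using \<tau> M by (simp add: u_def)
    have Mu: "of_nat M * u = \<tau> + of_nat (\<sigma> j)" using M by (simp add: u_def)
    have J: "of_int C * \<tau> + of_int d \<noteq> 0" by (rule mob_denom_nonzero[OF detC \<tau>])
    have "(of_int (int M * C) * u + of_int (d - C * int (\<sigma> j)) :: complex) =
        of_int C * (of_nat M * u) + of_int d - of_int C * of_nat (\<sigma> j)" by (simp add: algebra_simps)
    also have "\<dots> = of_int C * \<tau> + of_int d" unfolding Mu by (simp add: algebra_simps)
    finally have den: "(of_int (int M * C) * u + of_int (d - C * int (\<sigma> j)) :: complex) = of_int C * \<tau> + of_int d" .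
    have "of_nat M * (of_int (a + int j * C) * u + of_int B :: complex) =
      of_int (a + int j * C) * (of_nat M * u) + of_int (int M * B)" by (simp add: algebra_simps)
    also have "\<dots> = (of_int a * \<tau> + of_int b) + of_nat j * (of_int C * \<tau> + of_int d)"
      unfolding Mu B[symmetric] by (simp add: algebra_simps)
    finally have num: "of_int (a + int j * C) * u + of_int B =
       ((of_int a * \<tau> + of_int b) + of_nat j * (of_int C * \<tau> + of_int d)) / of_nat M"
      using M by (simp add: field_simps)
    have "mob (a + int j * C) B (int p ^ (2 * k) * c') (d - C * int (\<sigma> j)) u =
       (mob a b C d \<tau> + of_nat j) / of_nat M"
      unfolding MC[symmetric] unfolding mob_def den num using J M by (simp add: field_simps)
    moreover have "24 dvd (- r) * (int p ^ 2 - 1)" using r by simp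
    ultimately show ?thesis
      using eta_ratio_even_power_mob[OF p _ det' u, of "- r"] by (simp add: G_def u_def k)
  qed
  have "(\<Sum>j<M. G ((mob a b C d \<tau> + of_nat j) / of_nat M)) = (\<Sum>j<M. G ((\<tau> + of_nat (\<sigma> j)) / of_nat M))"
    by (simp only: key)
  also have "\<dots> = (\<Sum>j<M. G ((\<tau> + of_nat j) / of_nat M))"
    by (rule sum.reindex_bij_betw[OF bij])
  finally show ?thesis by (simp add: U_ratio_def G_def M_def e_def C_def)
qed

section \<open>Size of eta and growth at the cusp 0\<close>

definition eta_norm :: "complex \<Rightarrow> real" where
  "eta_norm \<tau> = norm (dedekind_eta \<tau>) ^ 4 * Im \<tau>"

lemma eta_norm_pos: "Im \<tau> > 0 \<Longrightarrow> eta_norm \<tau> > 0"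
  using dedekind_eta_nonzero by (simp add: eta_norm_def)

text \<open>As eta has weight 1/2, |eta|^4 scales by |J|^2, which the imaginary part compensates;
  absolute values remove the 24th root of unity that \<open>dedekind_eta_24_mob\<close> leaves
  open.\<close>

lemma eta_norm_mob:
  fixes a b c d :: int
  assumes det: "a * d - b * c = 1" and \<tau>: "Im \<tau> > 0"
  shows "eta_norm (mob a b c d \<tau>) = eta_norm \<tau>"
proof -
  define J where "J = of_int c * \<tau> + of_int d"
  have J: "J \<noteq> 0" unfolding J_def by (rule mob_denom_nonzero[OF det \<tau>])
  have "norm (dedekind_eta (mob a b c d \<tau>)) ^ 24 = norm J ^ 12 * norm (dedekind_eta \<tau>) ^ 24"
    using arg_cong[OF dedekind_eta_24_mob[OF det \<tau>], of norm] by (simp add: norm_mult norm_power J_def)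
  hence "eta_norm (mob a b c d \<tau>) ^ 6 = norm J ^ 12 * norm (dedekind_eta \<tau>) ^ 24 * (Im \<tau> / norm J ^ 2) ^ 6"
    unfolding eta_norm_def Im_mob[OF det \<tau>] J_def[symmetric] power_mult_distrib by (simp flip: power_mult)
  also have "\<dots> = eta_norm \<tau> ^ 6"
    using J by (simp add: eta_norm_def power_divide power_mult_distrib flip: power_mult)
  finally show ?thesis
    using eta_norm_pos[OF \<tau>] eta_norm_pos[OF Im_mob_pos[OF det \<tau>]] by (simp add: power_eq_iff_eq_base)
qed

text \<open>On Im tau >= epsilon the variable q stays in a closed disc of radius below 1 around 0,
  on which the Euler product is continuous and without zeros.\<close>

lemma dedekind_eta_bounds:
  assumes "\<epsilon> > 0"
  obtains k1 k2 where "k1 > 0" "k2 > 0"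
    "\<And>\<tau>. Im \<tau> \<ge> \<epsilon> \<Longrightarrow> k1 * exp (- pi / 12 * Im \<tau>) \<le> norm (dedekind_eta \<tau>)"
    "\<And>\<tau>. Im \<tau> \<ge> \<epsilon> \<Longrightarrow> norm (dedekind_eta \<tau>) \<le> k2 * exp (- pi / 12 * Im \<tau>)"
proof -
  define \<rho> where "\<rho> = exp (- 2 * pi * \<epsilon>)"
  have \<rho>: "0 < \<rho>" "\<rho> < 1" using assms by (auto simp: \<rho>_def)
  have "(\<lambda>q. qprod q 1) holomorphic_on ball 0 1"
    by (intro qprod_holomorphic holomorphic_intros) auto
  hence "continuous_on (cball 0 \<rho>) (\<lambda>q. qprod q 1)"
    using \<rho> by (intro holomorphic_on_imp_continuous_on) (auto elim!: holomorphic_on_subset)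
  hence cont: "continuous_on (cball 0 \<rho>) (\<lambda>q. norm (qprod q 1))" by (intro continuous_on_norm)
  have ne: "cball (0::complex) \<rho> \<noteq> {}" using \<rho> by simp
  obtain x where x: "x \<in> cball 0 \<rho>" "\<And>q. q \<in> cball 0 \<rho> \<Longrightarrow> norm (qprod x 1) \<le> norm (qprod q 1)"
    using continuous_attains_inf[OF compact_cball ne cont] by blast
  obtain y where y: "y \<in> cball 0 \<rho>" "\<And>q. q \<in> cball 0 \<rho> \<Longrightarrow> norm (qprod q 1) \<le> norm (qprod y 1)"
    using continuous_attains_sup[OF compact_cball ne cont] by blast
  have "norm (qprod x 1) > 0" "norm (qprod y 1) > 0"
    using x y \<rho> qprod_1_nonzero[of x] qprod_1_nonzero[of y] by auto
  moreover have eq: "norm (dedekind_eta \<tau>) = norm (qprod (ee \<tau>) 1) * exp (- pi / 12 * Im \<tau>)" for \<tau>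
    by (simp add: dedekind_eta_eq norm_mult norm_ee)
  moreover have "ee \<tau> \<in> cball 0 \<rho>" if "Im \<tau> \<ge> \<epsilon>" for \<tau>
    using that by (simp add: norm_ee \<rho>_def)
  ultimately show ?thesis using x y
    by (intro that[of "norm (qprod x 1)" "norm (qprod y 1)"]) (auto simp: eq intro!: mult_right_mono)
qed

text \<open>The maximum serves both signs of r at once: for negative r the lower bound k1 becomes
  the relevant one.\<close>

lemma power_int_sandwich:
  fixes x k1 k2 e :: real
  assumes "0 < k1" "0 < e" "k1 * e \<le> x" "x \<le> k2 * e"
  shows "x powi r \<le> max (k1 powi r) (k2 powi r) * e powi r"
proof (cases "r \<ge> 0")
  case True
  then obtain n where n: "r = int n" using nonneg_int_cases by blast
  have "0 \<le> x" using assms by (meson less_le_trans less_imp_le mult_pos_pos)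
  hence "x ^ n \<le> (k2 * e) ^ n" using assms by (intro power_mono) auto
  also have "\<dots> = k2 ^ n * e ^ n" by (simp add: power_mult_distrib)
  also have "\<dots> \<le> max (k1 ^ n) (k2 ^ n) * e ^ n" using assms by (intro mult_right_mono) auto
  finally show ?thesis using n by simp
next
  case False
  then obtain n where n: "r = - int n" by (metis int_cases of_nat_0_le_iff)
  have "0 < k1 * e" using assms by simp
  hence "inverse (x ^ n) \<le> inverse ((k1 * e) ^ n)" using assms by (intro le_imp_inverse_le power_mono) auto
  also have "\<dots> = inverse (k1 ^ n) * inverse (e ^ n)" by (simp add: power_mult_distrib)
  also have "\<dots> \<le> max (inverse (k1 ^ n)) (inverse (k2 ^ n)) * inverse (e ^ n)" using assms by (intro mult_right_mono) auto
  finally show ?thesis using n by (simp add: power_int_minus)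
qed

lemma exp_powi: "exp (x :: real) powi r = exp (of_int r * x)"
proof (cases "r \<ge> 0")
  case True
  thus ?thesis by (simp add: power_int_def flip: exp_of_nat_mult)
next
  case False
  hence "exp x powi r = inverse (exp (of_nat (nat (- r)) * x))"
    by (simp add: power_int_def power_inverse flip: exp_of_nat_mult)
  thus ?thesis using False by (simp flip: exp_minus)
qed

lemma Im_neg_inverse: "Im (- 1 / \<tau>) = Im \<tau> / norm \<tau> ^ 2"
  by (simp add: Im_divide cmod_power2)

lemma eta_norm_translate: "Im \<tau> > 0 \<Longrightarrow> eta_norm (\<tau> + of_int n) = eta_norm \<tau>"
  using eta_norm_mob[of 1 1 n 0 \<tau>] by (simp add: mob_def)

lemma eta_norm_neg_inverse: "Im \<tau> > 0 \<Longrightarrow> eta_norm (- 1 / \<tau>) = eta_norm \<tau>"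
  using eta_norm_mob[of 0 0 "-1" 1 \<tau>] by (simp add: mob_def)

text \<open>
  This writes the integral matrix \<open>(p j, -1; p\<^bsup>\<beta>+1\<^esup>, 0)\<close> as an element of \<open>SL\<^sub>2(\<int>)\<close> times an upper
  triangular matrix.
\<close>

lemma cusp_0_matrix:
  assumes p: "p > 0"
  shows "\<exists>a b c d A B D :: int. a * d - b * c = 1 \<and> A > 0 \<and> D > 0 \<and> A * D = int p ^ (\<beta> + 1) \<and> int p dvd A \<and>
    (\<forall>\<tau>. Im \<tau> > 0 \<longrightarrow> (fricke p \<tau> + of_nat j) / of_nat (p ^ \<beta>) =
           mob a b c d ((of_int A * \<tau> + of_int B) / of_int D))"
proof -
  define x where "x = int p * int j"
  define y where "y = int p ^ (\<beta> + 1)"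
  \<comment> \<open>Dividing the first column (x, y) by its gcd makes it primitive; Bezout completes
    it to a matrix of determinant 1.\<close>
  define A where "A = gcd x y"
  have y: "y > 0" using p by (simp add: y_def)
  hence A: "A > 0" by (simp add: A_def)
  obtain a where a: "x = A * a" by (metis A_def gcd_dvd1 dvdE)
  obtain c where c: "y = A * c" by (metis A_def gcd_dvd2 dvdE)
  have c0: "c > 0" using c y A by (simp add: zero_less_mult_iff)
  obtain u v where uv: "u * x + v * y = A" using bezout_int[of x y] by (auto simp: A_def)
  have "A * (u * a + v * c) = A * 1" using uv unfolding a c by (simp add: algebra_simps)
  hence uv1: "a * u - (- v) * c = 1" using A by (simp add: mult.commute)
  have eq: "(fricke p \<tau> + of_nat j) / of_nat (p ^ \<beta>) =
           mob a (- v) c u ((of_int A * \<tau> + of_int (- u)) / of_int c)" if \<tau>: "Im \<tau> > 0" for \<tau>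
  proof -
    have t0: "\<tau> \<noteq> 0" using \<tau> by auto
    have det: "(of_int a * of_int u + of_int v * of_int c :: complex) = 1"
      using arg_cong[OF uv1, of "of_int :: int \<Rightarrow> complex"] by simp
    have "of_int a * (of_int A * \<tau> - of_int u) - of_int v * of_int c = of_int (A * a) * \<tau> - (1 :: complex)"
      using det by (simp add: algebra_simps)
    hence 1: "of_int a * ((of_int A * \<tau> - of_int u) / of_int c) - of_int v = (of_int x * \<tau> - 1) / of_int c"
      using c0 by (simp add: field_simps a)
    have 2: "of_int c * ((of_int A * \<tau> - of_int u) / of_int c) + of_int u = of_int A * \<tau>"
      using c0 by simp
    have "mob a (- v) c u ((of_int A * \<tau> + of_int (- u)) / of_int c) = ((of_int x * \<tau> - 1) / of_int c) / (of_int A * \<tau>)"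
      unfolding mob_def using 1 2 by simp
    also have "\<dots> = (of_int x * \<tau> - 1) / (of_int y * \<tau>)" by (simp add: c mult_ac)
    also have "\<dots> = (fricke p \<tau> + of_nat j) / of_nat (p ^ \<beta>)"
      using p t0 by (simp add: x_def y_def field_simps)
    finally show ?thesis ..
  qed
  have "int p dvd x" "int p dvd y" by (auto simp: x_def y_def)
  hence "int p dvd A" by (simp add: A_def)
  show ?thesis
  proof (intro exI conjI allI impI)
    show "a * u - (- v) * c = 1" "0 < A" "0 < c" "int p dvd A" by fact+
    show "A * c = int p ^ (\<beta> + 1)" using c by (simp add: y_def)
  qed (rule eq)
qed

lemma norm_powi_ratio:
  "norm (x / y :: complex) powi r = norm (y / x) powi (- r)"
  by (simp add: norm_divide power_int_minus power_int_divide_distrib)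

text \<open>With u the argument, |eta(u)| is compared with |eta(v)| for v = (A tau + B)/D, and
  |eta(p^e u)| with |eta(E tau)|. The imaginary parts X Im tau and E Im tau give the order r (E -
  X)/24; the assumption on M covers every X that the matrix decomposition can produce.\<close>

lemma cusp_0_term:
  assumes p: "prime p" and \<beta>: "\<beta> > 0"
    and M: "\<And>X. real p / real p ^ \<beta> \<le> X \<Longrightarrow> X \<le> real p ^ (\<beta> + 1) \<Longrightarrow> of_int r * (real p ^ (1 - beta_bar \<beta>) - X) / 24 \<le> M"
  shows "\<exists>C. \<forall>\<tau>. Im \<tau> \<ge> 1 \<longrightarrow>
    norm (eta_ratio (p ^ (\<beta> + beta_bar \<beta>)) ((fricke p \<tau> + of_nat j) / of_nat (p ^ \<beta>)) powi (- r))
      \<le> C * exp (2 * pi * M * Im \<tau>)"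
proof -
  define e where "e = \<beta> + beta_bar \<beta>"
  define E where "E = p ^ (1 - beta_bar \<beta>)"
  have p0: "p > 0" using p prime_gt_0_nat by blast
  have E: "E > 0" using p0 by (simp add: E_def)
  obtain a b c d A B D :: int where ABD: "a * d - b * c = 1" "A > 0" "D > 0" "A * D = int p ^ (\<beta> + 1)" "int p dvd A"
    and eq: "\<And>\<tau>. Im \<tau> > 0 \<Longrightarrow> (fricke p \<tau> + of_nat j) / of_nat (p ^ \<beta>) =
           mob a b c d ((of_int A * \<tau> + of_int B) / of_int D)"
    using cusp_0_matrix[OF p0, of \<beta> j] by metis
  define X where "X = real_of_int A / real_of_int D"
  have X: "X > 0" using ABD by (simp add: X_def)
  have "int p \<le> A" using ABD by (intro zdvd_imp_le) auto
  have "int p * D \<le> A * D" using \<open>int p \<le> A\<close> ABD by (intro mult_right_mono) auto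
  \<comment> \<open>Divisibility of A by p is what bounds D by p^beta, and thereby X from
    below.\<close>
  hence "D \<le> int p ^ \<beta>" using p0 unfolding ABD(4) by simp
  hence D: "real_of_int D \<le> real p ^ \<beta>" by (metis of_int_le_iff of_int_of_nat_eq of_int_power)
  have "A * 1 \<le> A * D" using ABD by (intro mult_left_mono) auto
  hence A: "real_of_int A \<le> real p ^ (\<beta> + 1)" unfolding ABD(4) by (metis mult_1_right of_int_le_iff of_int_of_nat_eq of_int_power)
  have "real p \<le> real_of_int A" using \<open>int p \<le> A\<close> by linarith
  hence X1: "real p / real p ^ \<beta> \<le> X" unfolding X_def using D ABD by (intro frac_le) auto
  have "X \<le> real_of_int A / 1" unfolding X_def using ABD by (intro divide_left_mono) auto
  hence X2: "X \<le> real p ^ (\<beta> + 1)" using A by simp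
  have MX: "of_int r * (real E - X) / 24 \<le> M" using M[OF X1 X2] by (simp add: E_def)
  obtain k1 k2 where k: "k1 > 0" "k2 > 0" "\<And>\<tau>. Im \<tau> \<ge> X \<Longrightarrow> k1 * exp (- pi / 12 * Im \<tau>) \<le> norm (dedekind_eta \<tau>)"
    "\<And>\<tau>. Im \<tau> \<ge> X \<Longrightarrow> norm (dedekind_eta \<tau>) \<le> k2 * exp (- pi / 12 * Im \<tau>)"
    using dedekind_eta_bounds[OF X] by metis
  obtain l1 l2 where l: "l1 > 0" "l2 > 0" "\<And>\<tau>. Im \<tau> \<ge> 1 \<Longrightarrow> l1 * exp (- pi / 12 * Im \<tau>) \<le> norm (dedekind_eta \<tau>)"
    "\<And>\<tau>. Im \<tau> \<ge> 1 \<Longrightarrow> norm (dedekind_eta \<tau>) \<le> l2 * exp (- pi / 12 * Im \<tau>)"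
    using dedekind_eta_bounds[of 1] by (metis zero_less_one)
  \<comment> \<open>The factor that the imaginary parts contribute when the invariance of
    \<open>eta_norm\<close> is used at u and at p^e u and fourth roots are taken.\<close>
  define \<kappa> where "\<kappa> = root 4 (real p ^ e * X / real E)"
  have \<kappa>: "\<kappa> > 0" "\<kappa> ^ 4 = real p ^ e * X / real E" using p0 X E by (auto simp: \<kappa>_def)
  define C where "C = max ((\<kappa> * k1 / l2) powi r) ((\<kappa> * k2 / l1) powi r)"
  have "norm (eta_ratio (p ^ e) ((fricke p \<tau> + of_nat j) / of_nat (p ^ \<beta>)) powi (- r)) \<le> C * exp (2 * pi * M * Im \<tau>)"
    if \<tau>1: "Im \<tau> \<ge> 1" for \<tau>
  proof -
    have \<tau>: "Im \<tau> > 0" using \<tau>1 by simp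
    have t0: "\<tau> \<noteq> 0" using \<tau> by auto
    define v where "v = (of_int A * \<tau> + of_int B) / of_int D"
    define u where "u = (fricke p \<tau> + of_nat j) / of_nat (p ^ \<beta>)"
    define w where "w = of_nat (p ^ e) * u"
    have Imv: "Im v = X * Im \<tau>" using ABD by (simp add: v_def X_def)
    have v: "Im v > 0" using Imv X \<tau> by simp
    have uv: "u = mob a b c d v" unfolding u_def v_def by (rule eq[OF \<tau>])
    have u: "Im u > 0" unfolding uv by (rule Im_mob_pos[OF ABD(1) v])
    have Nu: "eta_norm u = eta_norm v" unfolding uv by (rule eta_norm_mob[OF ABD(1) v])
    have E\<tau>: "Im (of_nat E * \<tau>) > 0" using E \<tau> by simp
    \<comment> \<open>Multiplying u by p^e leaves the inversion of E tau plus an integer, so no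
      further matrix decomposition is required for w.\<close>
    have "w = - 1 / (of_nat E * \<tau>) + of_int (int (p ^ beta_bar \<beta> * j))"
      using p0 t0 by (simp add: w_def u_def e_def E_def power_add field_simps beta_bar_def)
    moreover have "Im (- 1 / (of_nat E * \<tau>)) > 0"
      unfolding Im_neg_inverse using E\<tau> t0 E by (intro divide_pos_pos) auto
    ultimately have Nw: "eta_norm w = eta_norm (of_nat E * \<tau>)"
      using eta_norm_translate eta_norm_neg_inverse[OF E\<tau>] by (simp only:)
    have Imw: "Im w = real p ^ e * Im u" by (simp add: w_def flip: of_nat_power)
    have w: "Im w > 0" using Imw u p0 by simp
    have nz: "dedekind_eta u \<noteq> 0" "dedekind_eta v \<noteq> 0" "dedekind_eta w \<noteq> 0" "dedekind_eta (of_nat E * \<tau>) \<noteq> 0"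
      using dedekind_eta_nonzero u v w E\<tau> by blast+
    have 1: "norm (dedekind_eta u) ^ 4 * Im u = norm (dedekind_eta v) ^ 4 * (X * Im \<tau>)"
      using Nu by (simp add: eta_norm_def Imv)
    have 2: "norm (dedekind_eta w) ^ 4 * (real p ^ e * Im u) = norm (dedekind_eta (of_nat E * \<tau>)) ^ 4 * (E * Im \<tau>)"
      using Nw by (simp add: eta_norm_def Imw)
    have "(norm (dedekind_eta u) / norm (dedekind_eta w)) ^ 4 =
       real p ^ e * (norm (dedekind_eta u) ^ 4 * Im u) / (norm (dedekind_eta w) ^ 4 * (real p ^ e * Im u))"
      using u p0 by (simp add: power_divide)
    also have "\<dots> = (\<kappa> * norm (dedekind_eta v) / norm (dedekind_eta (of_nat E * \<tau>))) ^ 4"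
      unfolding 1 2 using \<tau> E by (simp add: power_divide power_mult_distrib \<kappa>(2) mult_ac)
    finally have 3: "norm (dedekind_eta u / dedekind_eta w) = \<kappa> * norm (dedekind_eta v) / norm (dedekind_eta (of_nat E * \<tau>))"
      using \<kappa>(1) by (simp add: norm_divide power_eq_iff_eq_base)
    define ex where "ex = exp (pi / 12 * (real E - X) * Im \<tau>)"
    have ex: "ex = exp (- pi / 12 * Im v) / exp (- pi / 12 * Im (of_nat E * \<tau>))"
      unfolding ex_def exp_diff[symmetric] by (simp add: Imv diff_divide_distrib algebra_simps)
    have "X * 1 \<le> X * Im \<tau>" using X \<tau>1 by (intro mult_left_mono) auto
    hence vX: "Im v \<ge> X" by (simp add: Imv)
    have "1 * 1 \<le> real E * Im \<tau>" using E \<tau>1 by (intro mult_mono) auto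
    hence EX: "Im (of_nat E * \<tau>) \<ge> 1" by simp
    have lo: "(\<kappa> * k1 / l2) * ex \<le> norm (dedekind_eta u / dedekind_eta w)"
    proof -
      have "(\<kappa> * k1 / l2) * ex = (\<kappa> * (k1 * exp (- pi / 12 * Im v))) / (l2 * exp (- pi / 12 * Im (of_nat E * \<tau>)))"
        by (simp add: ex)
      also have "\<dots> \<le> norm (dedekind_eta u / dedekind_eta w)"
        unfolding 3 using k(3)[OF vX] l(4)[OF EX] \<kappa>(1) nz k(1) by (intro frac_le mult_left_mono) auto
      finally show ?thesis .
    qed
    have hi: "norm (dedekind_eta u / dedekind_eta w) \<le> (\<kappa> * k2 / l1) * ex"
    proof -
      have "norm (dedekind_eta u / dedekind_eta w) \<le>
         (\<kappa> * (k2 * exp (- pi / 12 * Im v))) / (l1 * exp (- pi / 12 * Im (of_nat E * \<tau>)))"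
        unfolding 3 using k(4)[OF vX] l(3)[OF EX] \<kappa>(1) nz k(2) l(1) by (intro frac_le mult_left_mono) auto
      also have "\<dots> = (\<kappa> * k2 / l1) * ex" by (simp add: ex)
      finally show ?thesis .
    qed
    have "norm (eta_ratio (p ^ e) u powi (- r)) = norm (dedekind_eta u / dedekind_eta w) powi r"
      unfolding eta_ratio_def w_def[symmetric] norm_power_int norm_powi_ratio[of "dedekind_eta u"] ..
    also have "\<dots> \<le> C * ex powi r" unfolding C_def
      by (rule power_int_sandwich[OF _ _ lo hi]) (use \<kappa> k l in \<open>auto simp: ex_def\<close>)
    also have "ex powi r = exp (2 * pi * (of_int r * (real E - X) / 24) * Im \<tau>)"
      by (simp add: ex_def exp_powi)
    also have "C * \<dots> \<le> C * exp (2 * pi * M * Im \<tau>)"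
    proof (rule mult_left_mono)
      have "(2 * pi * Im \<tau>) * (of_int r * (real E - X) / 24) \<le> (2 * pi * Im \<tau>) * M"
        using MX \<tau> by (intro mult_left_mono) auto
      thus "exp (2 * pi * (of_int r * (real E - X) / 24) * Im \<tau>) \<le> exp (2 * pi * M * Im \<tau>)"
        by (simp add: mult_ac)
      have "(\<kappa> * k1 / l2) powi r > 0" using \<kappa> k l by (intro zero_less_power_int) auto
      thus "0 \<le> C" by (simp add: C_def le_max_iff_disj)
    qed
    finally show ?thesis by (simp add: u_def)
  qed
  thus ?thesis unfolding e_def by blast
qed

lemma pi_p_real: "real (pi_p p) = real (p - 1) / real (gcd 12 (p - 1))"
  unfolding pi_p_def by (rule real_of_nat_div) simp

theorem U_ratio_cusp_0:
  assumes p: "prime p" and \<beta>: "\<beta> > 0"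
  shows "\<exists>C. \<forall>\<tau>. Im \<tau> \<ge> 1 \<longrightarrow> norm (U_ratio p \<beta> r (fricke p \<tau>))
    \<le> C * exp (2 * pi * (real (pi_p p) * real_of_rat (y1_bound p \<beta> r)) * Im \<tau>)"
proof -
  define M where "M = real (pi_p p) * real_of_rat (y1_bound p \<beta> r)"
  define g where "g = gcd 12 (p - 1)"
  have p1: "p > 1" using p prime_gt_1_nat by blast
  have g: "g > 0" using p1 by (simp add: g_def)
  have pp: "real (p - 1) = real p - 1" using p1 by (simp add: of_nat_diff)
  have bb: "beta_bar \<beta> \<le> 1" by (simp add: beta_bar_def)
  have M: "of_int r * (real p ^ (1 - beta_bar \<beta>) - X) / 24 \<le> M"
    if X: "real p / real p ^ \<beta> \<le> X" "X \<le> real p ^ (\<beta> + 1)" for X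
  proof (cases "r \<ge> 0")
    case True
    have "M = of_int r * ((real p ^ (\<beta> - beta_bar \<beta>) - 1) / real p ^ (\<beta> - 1)) / 24"
      using True p1 g by (simp add: M_def y1_bound_def pi_p_real of_rat_mult of_rat_divide of_rat_diff of_rat_power pp g_def[symmetric] mult.commute)
    \<comment> \<open>Splitting the exponent turns the quotient in \<open>y1_bound\<close> into p^(1
      - beta_bar) - p^(1 - beta), the value at the lower end of the range of X.\<close>
    also have "\<beta> - beta_bar \<beta> = (1 - beta_bar \<beta>) + (\<beta> - 1)" using bb \<beta> by simp
    also have "(real p ^ ((1 - beta_bar \<beta>) + (\<beta> - 1)) - 1) / real p ^ (\<beta> - 1) = real p ^ (1 - beta_bar \<beta>) - 1 / real p ^ (\<beta> - 1)"
      using p1 by (simp add: power_add diff_divide_distrib)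
    also have "1 / real p ^ (\<beta> - 1) = real p / real p ^ \<beta>" using p1 \<beta> by (cases \<beta>) auto
    finally have "M = of_int r * (real p ^ (1 - beta_bar \<beta>) - real p / real p ^ \<beta>) / 24" .
    thus ?thesis using X True by (auto intro!: mult_left_mono)
  next
    case False
    have "M = of_int (- r) * (real p ^ (\<beta> + 1) - real p ^ (1 - beta_bar \<beta>)) / 24"
      using False p1 g by (simp add: M_def y1_bound_def pi_p_real of_rat_mult of_rat_divide of_rat_diff of_rat_power of_rat_minus pp g_def[symmetric])
         (use p1 in \<open>simp add: divide_simps\<close>)
    moreover have "of_int (- r) * (X - real p ^ (1 - beta_bar \<beta>)) \<le> of_int (- r) * (real p ^ (\<beta> + 1) - real p ^ (1 - beta_bar \<beta>))"
      using X False by (intro mult_left_mono) auto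
    ultimately show ?thesis by (simp add: algebra_simps)
  qed
  have "\<exists>C. \<forall>\<tau>. Im \<tau> \<ge> 1 \<longrightarrow>
    norm (eta_ratio (p ^ (\<beta> + beta_bar \<beta>)) ((fricke p \<tau> + of_nat j) / of_nat (p ^ \<beta>)) powi (- r))
      \<le> C * exp (2 * pi * M * Im \<tau>)" for j
    by (rule cusp_0_term[OF p \<beta> M])
  then obtain C where C: "\<And>j \<tau>. Im \<tau> \<ge> 1 \<Longrightarrow>
    norm (eta_ratio (p ^ (\<beta> + beta_bar \<beta>)) ((fricke p \<tau> + of_nat j) / of_nat (p ^ \<beta>)) powi (- r))
      \<le> C j * exp (2 * pi * M * Im \<tau>)" by metis
  have "norm (U_ratio p \<beta> r (fricke p \<tau>)) \<le> ((\<Sum>j<p ^ \<beta>. C j) / real (p ^ \<beta>)) * exp (2 * pi * M * Im \<tau>)"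
    if "Im \<tau> \<ge> 1" for \<tau>
  proof -
    have "norm (\<Sum>j<p ^ \<beta>. eta_ratio (p ^ (\<beta> + beta_bar \<beta>)) ((fricke p \<tau> + of_nat j) / of_nat (p ^ \<beta>)) powi (- r))
      \<le> (\<Sum>j<p ^ \<beta>. C j * exp (2 * pi * M * Im \<tau>))"
      by (rule sum_norm_le) (rule C[OF that])
    thus ?thesis unfolding U_ratio_def norm_divide using p1
      by (simp add: sum_distrib_right divide_right_mono norm_power)
  qed
  thus ?thesis unfolding M_def by blast
qed

text \<open>The bounds are two-sided because h is later raised to powers of either sign.\<close>

lemma hauptmodul_cusp_bounds:
  assumes p: "prime p"
  shows "\<exists>k1 k2. k1 > 0 \<and> k2 > 0 \<and> (\<forall>\<tau>. Im \<tau> \<ge> 1 \<longrightarrow>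
    k1 * exp (2 * pi * real (pi_p p) * Im \<tau>) \<le> norm (hauptmodul p (fricke p \<tau>)) \<and>
    norm (hauptmodul p (fricke p \<tau>)) \<le> k2 * exp (2 * pi * real (pi_p p) * Im \<tau>) \<and>
    k1 * exp (- 2 * pi * real (pi_p p) * Im \<tau>) \<le> norm (hauptmodul p \<tau>) \<and>
    norm (hauptmodul p \<tau>) \<le> k2 * exp (- 2 * pi * real (pi_p p) * Im \<tau>))"
proof -
  define s where "s = 24 div gcd 12 (p - 1)"
  define g where "g = gcd 12 (p - 1)"
  have p1: "p > 1" using p prime_gt_1_nat by blast
  have g: "g > 0" using p1 by (simp add: g_def)
  have "g dvd 24" unfolding g_def by (rule dvd_trans[OF gcd_dvd1]) simp
  hence "real s = 24 / real g" unfolding s_def g_def[symmetric] using real_of_nat_div[of g 24] by simp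
  hence sp: "real s * (real p - 1) = 24 * real (pi_p p)"
    using p1 g pi_p_real[of p, folded g_def] by (simp add: of_nat_diff)
  obtain l1 l2 where l: "l1 > 0" "l2 > 0" "\<And>\<tau>. Im \<tau> \<ge> 1 \<Longrightarrow> l1 * exp (- pi / 12 * Im \<tau>) \<le> norm (dedekind_eta \<tau>)"
    "\<And>\<tau>. Im \<tau> \<ge> 1 \<Longrightarrow> norm (dedekind_eta \<tau>) \<le> l2 * exp (- pi / 12 * Im \<tau>)"
    using dedekind_eta_bounds[of 1] by (metis zero_less_one)
  \<comment> \<open>The invariance of \<open>eta_norm\<close>, used at tau and at p tau, shows that
    the Fricke involution turns |eta(p tau)/eta(tau)| into its inverse times p^(-1/2).\<close>
  define c where "c = sqrt (1 / real p)"
  have c: "c > 0" "c ^ 4 = 1 / real p ^ 2" using p1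
    by (auto simp: c_def power_divide real_sqrt_divide power4_eq_xxxx power2_eq_square)
  define k1 where "k1 = min ((c * l1 / l2) ^ s) ((l1 / l2) ^ s)"
  define k2 where "k2 = max ((c * l2 / l1) ^ s) ((l2 / l1) ^ s)"
  have "k1 > 0" "k2 > 0" using c l by (auto simp: k1_def k2_def less_max_iff_disj)
  moreover have "k1 * exp (2 * pi * real (pi_p p) * Im \<tau>) \<le> norm (hauptmodul p (fricke p \<tau>)) \<and>
    norm (hauptmodul p (fricke p \<tau>)) \<le> k2 * exp (2 * pi * real (pi_p p) * Im \<tau>) \<and>
    k1 * exp (- 2 * pi * real (pi_p p) * Im \<tau>) \<le> norm (hauptmodul p \<tau>) \<and>
    norm (hauptmodul p \<tau>) \<le> k2 * exp (- 2 * pi * real (pi_p p) * Im \<tau>)"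
    if \<tau>1: "Im \<tau> \<ge> 1" for \<tau>
  proof -
    have \<tau>: "Im \<tau> > 0" using \<tau>1 by simp
    have t0: "\<tau> \<noteq> 0" using \<tau> by auto
    define x where "x = norm (dedekind_eta \<tau>)"
    define y where "y = norm (dedekind_eta (of_nat p * \<tau>))"
    have "1 * 1 \<le> real p * Im \<tau>" using p1 \<tau>1 by (intro mult_mono) auto
    hence p\<tau>: "Im (of_nat p * \<tau>) \<ge> 1" by simp
    hence p\<tau>0: "Im (of_nat p * \<tau>) > 0" by linarith
    define ex where "ex = exp (pi / 12 * (real p - 1) * Im \<tau>)"
    have ex: "ex = exp (- pi / 12 * Im \<tau>) / exp (- pi / 12 * Im (of_nat p * \<tau>))"
      unfolding ex_def exp_diff[symmetric] by (simp add: diff_divide_distrib algebra_simps)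
    have exs: "ex ^ s = exp (2 * pi * real (pi_p p) * Im \<tau>)"
    proof -
      have "ex ^ s = exp (pi / 12 * (real s * (real p - 1)) * Im \<tau>)"
        unfolding ex_def by (simp add: mult_ac flip: exp_of_nat_mult)
      thus ?thesis unfolding sp by simp
    qed
    have xy: "x > 0" "y > 0" using dedekind_eta_nonzero \<tau> p\<tau>0 by (auto simp: x_def y_def)
    have lo: "l1 / l2 * ex \<le> x / y"
    proof -
      have "l1 / l2 * ex = (l1 * exp (- pi / 12 * Im \<tau>)) / (l2 * exp (- pi / 12 * Im (of_nat p * \<tau>)))" by (simp add: ex)
      also have "\<dots> \<le> x / y" using l(3)[OF \<tau>1] l(4)[OF p\<tau>] xy unfolding x_def y_def by (intro frac_le) auto
      finally show ?thesis .
    qed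
    have hi: "x / y \<le> l2 / l1 * ex"
    proof -
      have "x / y \<le> (l2 * exp (- pi / 12 * Im \<tau>)) / (l1 * exp (- pi / 12 * Im (of_nat p * \<tau>)))"
        using l(4)[OF \<tau>1] l(3)[OF p\<tau>] xy l(1,2) unfolding x_def y_def by (intro frac_le) auto
      also have "\<dots> = l2 / l1 * ex" by (simp add: ex)
      finally show ?thesis .
    qed
    have n2: "norm (eta_ratio p \<tau>) = inverse (x / y)" by (simp add: eta_ratio_def x_def y_def norm_divide)
    have n1: "norm (eta_ratio p (fricke p \<tau>)) = c * (x / y)"
    proof -
      define t where "t = fricke p \<tau>"
      have pt: "of_nat p * t = - 1 / \<tau>" using p1 t0 by (simp add: t_def)
      have t: "Im t > 0" unfolding t_def Im_neg_inverse using p\<tau>0 p1 t0 by simp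
      have Nt: "norm (dedekind_eta t) ^ 4 * Im t = y ^ 4 * (real p * Im \<tau>)"
        using eta_norm_neg_inverse[OF p\<tau>0] by (simp add: eta_norm_def t_def y_def)
      have Npt: "norm (dedekind_eta (of_nat p * t)) ^ 4 * (real p * Im t) = x ^ 4 * Im \<tau>"
        using eta_norm_neg_inverse[OF \<tau>] unfolding pt[symmetric] by (simp add: eta_norm_def x_def)
      have "dedekind_eta t \<noteq> 0" using dedekind_eta_nonzero t by blast
      hence "norm (eta_ratio p t) ^ 4 = (norm (dedekind_eta (of_nat p * t)) ^ 4 * (real p * Im t)) / (real p * (norm (dedekind_eta t) ^ 4 * Im t))"
        using t p1 by (simp add: eta_ratio_def norm_divide power_divide)
      also have "\<dots> = (c * (x / y)) ^ 4"
        unfolding Nt Npt using \<tau> p1 by (simp add: power_mult_distrib power_divide c(2) power2_eq_square)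
      finally show ?thesis using c xy unfolding t_def by (simp add: power_eq_iff_eq_base)
    qed
    have ex0: "ex > 0" by (simp add: ex_def)
    have "k1 * ex ^ s \<le> (c * l1 / l2 * ex) ^ s" unfolding power_mult_distrib k1_def using ex0
      by (intro mult_right_mono) auto
    also have "\<dots> \<le> (c * (x / y)) ^ s" using lo c l ex0 by (intro power_mono) (auto simp flip: times_divide_eq_right)
    finally have 1: "k1 * ex ^ s \<le> (c * (x / y)) ^ s" .
    have "(c * (x / y)) ^ s \<le> (c * l2 / l1 * ex) ^ s" using hi c l ex0 xy by (intro power_mono) (auto simp flip: times_divide_eq_right)
    also have "\<dots> \<le> k2 * ex ^ s" unfolding power_mult_distrib k2_def using ex0
      by (intro mult_right_mono) auto
    finally have 2: "(c * (x / y)) ^ s \<le> k2 * ex ^ s" .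
    have "k1 * inverse (ex ^ s) \<le> (l1 / l2) ^ s * inverse (ex ^ s)" unfolding k1_def using ex0
      by (intro mult_right_mono) auto
    also have "\<dots> = inverse (l2 / l1 * ex) ^ s" by (simp add: power_mult_distrib power_inverse power_divide field_simps)
    also have "\<dots> \<le> inverse (x / y) ^ s" using hi xy ex0 l by (intro power_mono le_imp_inverse_le) auto
    finally have 3: "k1 * inverse (ex ^ s) \<le> inverse (x / y) ^ s" .
    have "inverse (x / y) ^ s \<le> inverse (l1 / l2 * ex) ^ s" using lo xy ex0 l by (intro power_mono le_imp_inverse_le) auto
    also have "\<dots> = (l2 / l1) ^ s * inverse (ex ^ s)" by (simp add: power_mult_distrib power_inverse power_divide field_simps)
    also have "\<dots> \<le> k2 * inverse (ex ^ s)" unfolding k2_def using ex0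
      by (intro mult_right_mono) auto
    finally have 4: "inverse (x / y) ^ s \<le> k2 * inverse (ex ^ s)" .
    show ?thesis using 1 2 3 4 unfolding hauptmodul_def s_def[symmetric] norm_power n1 n2 exs by (simp add: exp_minus)
  qed
  ultimately show ?thesis by blast
qed

section \<open>Expansions in q\<close>

lemma ee_surj:
  assumes "norm q < 1" "q \<noteq> 0"
  shows "\<exists>\<tau>. Im \<tau> > 0 \<and> ee \<tau> = q"
proof (intro exI conjI)
  define \<tau> where "\<tau> = Ln q / (2 * of_real pi * \<i>)"
  show e: "ee \<tau> = q" using assms by (simp add: ee_def \<tau>_def)
  have "exp (- 2 * pi * Im \<tau>) < exp 0" using assms(1) norm_ee[of \<tau>] unfolding e by simp
  hence "- 2 * pi * Im \<tau> < 0" by (simp only: exp_less_cancel_iff)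
  thus "Im \<tau> > 0" by (simp add: zero_less_mult_iff)
qed

lemma powser_zero_coeffs:
  fixes a :: "nat \<Rightarrow> complex"
  assumes "\<And>q. norm q < 1 \<Longrightarrow> q \<noteq> 0 \<Longrightarrow> (\<lambda>n. a n * q ^ n) sums 0"
  shows "a = (\<lambda>_. 0)"
proof (rule ccontr)
  assume "a \<noteq> (\<lambda>_. 0)"
  then obtain m where m: "a m \<noteq> 0" by auto
  \<comment> \<open>No tau reaches q = 0, so nothing is assumed there; an additional factor q makes
    the sum vanish at 0 as well.\<close>
  define b where "b = (\<lambda>n. case n of 0 \<Rightarrow> 0 | Suc n \<Rightarrow> a n)"
  have sums: "(\<lambda>n. b n * (q - 0) ^ n) sums 0" if "norm (q - 0) < 1" for q
  proof (cases "q = 0")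
    case True
    thus ?thesis by (simp add: b_def)
  next
    case False
    hence "(\<lambda>n. q * (a n * q ^ n)) sums (q * 0)" using that by (intro sums_mult assms) auto
    hence "(\<lambda>n. b (Suc n) * q ^ Suc n) sums 0" by (simp add: b_def mult_ac)
    thus ?thesis by (subst (asm) sums_Suc_iff) (simp add: b_def)
  qed
  \<comment> \<open>A nonzero coefficient would give a punctured disc on which the sum, which is the
    zero function, has no zeros.\<close>
  obtain s where s: "0 < s" "\<And>z :: complex. z \<in> cball 0 s - {0} \<Longrightarrow> (0 :: complex) \<noteq> 0"
    by (rule powser_0_nonzero[of 1 0 b "\<lambda>_. 0" "Suc m", OF _ sums]) (use m in \<open>auto simp: b_def\<close>)
  have "complex_of_real s \<in> cball 0 s - {0}" using s(1) by auto
  from s(2)[OF this] show False by simp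
qed

lemma holomorphic_powser_expansion:
  assumes "f holomorphic_on ball 0 1"
  shows "\<exists>a. \<forall>q. norm q < 1 \<longrightarrow> (\<lambda>n. a n * q ^ n) sums f q"
  using holomorphic_power_series[OF assms] by (intro exI[of _ "\<lambda>n. (deriv ^^ n) f 0 / fact n"]) auto

lemma qpow_of_nat: "qpow (of_nat n) \<tau> = ee \<tau> ^ n"
  by (simp add: qpow_def ee_power) (simp add: ee_def mult_ac)

lemma qpow_eq: "qpow s \<tau> = ee (of_rat s * \<tau>)"
  by (simp add: qpow_def ee_def mult_ac)

text \<open>This resolves the definite description in \<open>q_coeffs\<close>: holomorphy on the
  whole unit disc gives an expansion, and every q with 0 < |q| < 1 comes from some tau, so the
  expansion is unique.\<close>

lemma q_coeffs_sums:
  assumes \<phi>: "\<phi> holomorphic_on ball 0 1"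
    and f: "\<And>\<tau>. Im \<tau> > 0 \<Longrightarrow> f \<tau> = qpow s \<tau> * \<phi> (ee \<tau>)" and q: "norm q < 1"
  shows "(\<lambda>n. q_coeffs f s n * q ^ n) sums \<phi> q"
proof -
  obtain a where a: "\<And>q. norm q < 1 \<Longrightarrow> (\<lambda>n. a n * q ^ n) sums \<phi> q"
    using holomorphic_powser_expansion[OF \<phi>] by blast
  have "q_coeffs f s = a" unfolding q_coeffs_def
  proof (rule the_equality)
    show "has_q_expansion f s a" unfolding has_q_expansion_def qpow_of_nat
      using a f norm_ee_less_1 by (metis sums_iff)
    fix b assume b: "has_q_expansion f s b"
    have "(\<lambda>n. b n - a n) = (\<lambda>_. 0)"
    proof (rule powser_zero_coeffs)
      fix q :: complex assume q: "norm q < 1" "q \<noteq> 0"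
      then obtain \<tau> where \<tau>: "Im \<tau> > 0" "ee \<tau> = q" using ee_surj by blast
      have "summable (\<lambda>n. b n * q ^ n)" "f \<tau> = qpow s \<tau> * (\<Sum>n. b n * q ^ n)"
        using b \<tau> unfolding has_q_expansion_def qpow_of_nat by auto
      moreover have "qpow s \<tau> \<noteq> 0" by (simp add: qpow_def)
      ultimately have "(\<lambda>n. b n * q ^ n) sums \<phi> q"
        using f[OF \<tau>(1)] \<tau>(2) by (simp add: sums_iff)
      from sums_diff[OF this a[OF q(1)]] show "(\<lambda>n. (b n - a n) * q ^ n) sums 0" by (simp add: algebra_simps)
    qed
    thus "b = a" by (simp add: fun_eq_iff)
  qed
  thus ?thesis using a q by simp
qed

section \<open>Unordered Laurent expansions in q\<close>

lemma powser_has_sum: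
  fixes a :: "nat \<Rightarrow> complex"
  assumes "\<And>q. norm q < 1 \<Longrightarrow> (\<lambda>n. a n * q ^ n) sums f q" and q: "norm q < 1"
  shows "((\<lambda>n. a n * q ^ n) has_sum f q) UNIV"
proof (rule norm_summable_imp_has_sum)
  obtain r where r: "norm q < r" "r < 1" using dense q by blast
  hence "norm (of_real r :: complex) < 1" "norm q < norm (of_real r :: complex)" using norm_ge_zero[of q] by (auto simp del: norm_ge_zero)
  thus "summable (\<lambda>n. norm (a n * q ^ n))"
    using assms(1) powser_insidea sums_summable by blast
qed (use assms in auto)

text \<open>Indexing by all integers lets expansions with different leading exponents be added
  directly. A lower bound for the support is not built in; uniqueness and growth take it as a
  separate assumption.\<close>

definition laurent :: "(int \<Rightarrow> complex) \<Rightarrow> (complex \<Rightarrow> complex) \<Rightarrow> bool" where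
  "laurent D X \<longleftrightarrow> (\<forall>\<tau>. Im \<tau> > 0 \<longrightarrow> ((\<lambda>k. D k * ee (of_int k * \<tau>)) has_sum X \<tau>) UNIV)"

lemma laurent_powser:
  fixes a :: "nat \<Rightarrow> complex"
  assumes "\<And>q. norm q < 1 \<Longrightarrow> (\<lambda>n. a n * q ^ n) sums f q"
  shows "laurent (\<lambda>k. if k \<ge> K then a (nat (k - K)) else 0) (\<lambda>\<tau>. ee (of_int K * \<tau>) * f (ee \<tau>))"
  unfolding laurent_def
proof (intro allI impI)
  fix \<tau> assume "Im \<tau> > 0"
  hence "((\<lambda>n. ee (of_int K * \<tau>) * (a n * ee \<tau> ^ n)) has_sum (ee (of_int K * \<tau>) * f (ee \<tau>))) UNIV"
    by (intro has_sum_cmult_right powser_has_sum assms) auto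
  also have "?this \<longleftrightarrow> ((\<lambda>k. (if k \<ge> K then a (nat (k - K)) else 0) * ee (of_int k * \<tau>)) has_sum
      (ee (of_int K * \<tau>) * f (ee \<tau>))) {K..}"
    by (rule has_sum_reindex_bij_witness[of _ "\<lambda>k. nat (k - K)" "\<lambda>n. K + int n"])
       (auto simp: ee_power ee_add ring_distribs)
  also have "\<dots> \<longleftrightarrow> ((\<lambda>k. (if k \<ge> K then a (nat (k - K)) else 0) * ee (of_int k * \<tau>)) has_sum
      (ee (of_int K * \<tau>) * f (ee \<tau>))) UNIV"
    by (rule has_sum_cong_neutral) auto
  finally show "((\<lambda>k. (if k \<ge> K then a (nat (k - K)) else 0) * ee (of_int k * \<tau>)) has_sum
      (ee (of_int K * \<tau>) * f (ee \<tau>))) UNIV" .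
qed

lemma laurent_cmult: "laurent D X \<Longrightarrow> laurent (\<lambda>k. c * D k) (\<lambda>\<tau>. c * X \<tau>)"
  unfolding laurent_def by (auto simp: mult.assoc intro!: has_sum_cmult_right)

lemma laurent_add: "laurent D X \<Longrightarrow> laurent D' X' \<Longrightarrow> laurent (\<lambda>k. D k + D' k) (\<lambda>\<tau>. X \<tau> + X' \<tau>)"
  unfolding laurent_def by (auto simp: distrib_right intro!: has_sum_add)

lemma laurent_diff: "laurent D X \<Longrightarrow> laurent D' X' \<Longrightarrow> laurent (\<lambda>k. D k - D' k) (\<lambda>\<tau>. X \<tau> - X' \<tau>)"
  using laurent_add[of D X "\<lambda>k. - 1 * D' k" "\<lambda>\<tau>. - 1 * X' \<tau>"] laurent_cmult[of D' X' "- 1"] by simp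

lemma has_sum_sum:
  fixes f :: "'a \<Rightarrow> 'b \<Rightarrow> 'c :: topological_comm_monoid_add"
  assumes "finite A" "\<And>i. i \<in> A \<Longrightarrow> (f i has_sum S i) B"
  shows "((\<lambda>x. \<Sum>i\<in>A. f i x) has_sum (\<Sum>i\<in>A. S i)) B"
  using assms by (induction A rule: finite_induct) (auto intro: has_sum_add)

lemma laurent_sum:
  assumes "finite A" "\<And>y. y \<in> A \<Longrightarrow> laurent (D y) (X y)"
  shows "laurent (\<lambda>k. \<Sum>y\<in>A. D y k) (\<lambda>\<tau>. \<Sum>y\<in>A. X y \<tau>)"
  using assms
proof (induction A rule: finite_induct)
  case empty
  show ?case by (simp add: laurent_def)
next
  case (insert y A)
  thus ?case by (auto intro: laurent_add)
qed

lemma laurent_zero: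
  assumes "laurent D (\<lambda>_. 0)" "\<And>k. k < K \<Longrightarrow> D k = 0"
  shows "D k = 0"
proof -
  have "(\<lambda>n. D (K + int n)) = (\<lambda>_. 0)"
  proof (rule powser_zero_coeffs)
    fix q :: complex assume "norm q < 1" "q \<noteq> 0"
    then obtain \<tau> where \<tau>: "Im \<tau> > 0" "ee \<tau> = q" using ee_surj by blast
    have "((\<lambda>k. D k * ee (of_int k * \<tau>)) has_sum 0) UNIV" using assms(1) \<tau> by (simp add: laurent_def)
    also have "?this \<longleftrightarrow> ((\<lambda>k. D k * ee (of_int k * \<tau>)) has_sum 0) {K..}"
      by (rule has_sum_cong_neutral) (auto simp: assms(2))
    also have "\<dots> \<longleftrightarrow> ((\<lambda>n. ee (of_int K * \<tau>) * (D (K + int n) * q ^ n)) has_sum 0) UNIV"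
      by (rule has_sum_reindex_bij_witness[of _ "\<lambda>n. K + int n" "\<lambda>k. nat (k - K)"])
         (auto simp: \<tau>(2)[symmetric] ee_power ee_add[symmetric] algebra_simps)
    finally have "((\<lambda>n. inverse (ee (of_int K * \<tau>)) * (ee (of_int K * \<tau>) * (D (K + int n) * q ^ n))) has_sum
        inverse (ee (of_int K * \<tau>)) * 0) UNIV" by (rule has_sum_cmult_right)
    hence "((\<lambda>n. D (K + int n) * q ^ n) has_sum 0) UNIV" by (simp add: mult.assoc[symmetric])
    thus "(\<lambda>n. D (K + int n) * q ^ n) sums 0" by (rule has_sum_imp_sums)
  qed
  hence *: "D (K + int n) = 0" for n by (metis)
  show ?thesis
  proof (cases "k < K")
    case False
    thus ?thesis using *[of "nat (k - K)"] by simp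
  qed (use assms in auto)
qed

lemma laurent_unique:
  assumes "laurent D X" "laurent D' X'" "\<And>\<tau>. Im \<tau> > 0 \<Longrightarrow> X \<tau> = X' \<tau>"
    "\<And>k. k < K \<Longrightarrow> D k = 0" "\<And>k. k < K \<Longrightarrow> D' k = 0"
  shows "D k = D' k"
proof -
  have "laurent (\<lambda>k. D k - D' k) (\<lambda>_. 0)"
    using laurent_diff[OF assms(1,2)] assms(3) by (simp add: laurent_def)
  from laurent_zero[OF this, of K k] show ?thesis using assms(4,5) by simp
qed

text \<open>Comparison with the absolutely convergent series at tau = i: for k >= K and Im tau >= 1
  the k-th term shrinks at least by exp(-2 pi K (Im tau - 1)).\<close>

lemma laurent_bound:
  assumes D: "laurent D X" "\<And>k. k < K \<Longrightarrow> D k = 0"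
  shows "\<exists>C. \<forall>\<tau>. Im \<tau> \<ge> 1 \<longrightarrow> norm (X \<tau>) \<le> C * exp (- 2 * pi * of_int K * Im \<tau>)"
proof -
  define h where "h = (\<lambda>k. norm (D k * ee (of_int k * \<i>)))"
  have "(\<lambda>k. D k * ee (of_int k * \<i>)) summable_on UNIV"
    using D(1) unfolding laurent_def summable_on_def by (metis imaginary_unit.simps(2) zero_less_one)
  hence h: "h summable_on UNIV" unfolding h_def by (simp add: summable_on_iff_abs_summable_on_complex)
  have "norm (X \<tau>) \<le> (infsum h UNIV * exp (2 * pi * of_int K)) * exp (- 2 * pi * of_int K * Im \<tau>)" if \<tau>: "Im \<tau> \<ge> 1" for \<tau>
  proof -
    have "((\<lambda>k. D k * ee (of_int k * \<tau>)) has_sum X \<tau>) UNIV" using D(1) \<tau> by (auto simp: laurent_def)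
    moreover have "((\<lambda>k. h k * exp (- 2 * pi * of_int K * (Im \<tau> - 1))) has_sum (infsum h UNIV * exp (- 2 * pi * of_int K * (Im \<tau> - 1)))) UNIV"
      using h by (intro has_sum_cmult_left has_sum_infsum)
    moreover have "norm (D k * ee (of_int k * \<tau>)) \<le> h k * exp (- 2 * pi * of_int K * (Im \<tau> - 1))" for k
    proof (cases "k < K")
      case True
      thus ?thesis by (simp add: D(2) h_def)
    next
      case False
      have "of_int K * (Im \<tau> - 1) \<le> of_int k * (Im \<tau> - 1)" using False \<tau> by (intro mult_right_mono) auto
      hence "2 * pi * (of_int K * (Im \<tau> - 1)) \<le> 2 * pi * (of_int k * (Im \<tau> - 1))" by (intro mult_left_mono) auto
      hence "exp (- 2 * pi * (of_int k * Im \<tau>)) \<le> exp (- 2 * pi * of_int k + - 2 * pi * of_int K * (Im \<tau> - 1))"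
        by (simp add: algebra_simps)
      hence "norm (D k) * exp (- 2 * pi * (of_int k * Im \<tau>)) \<le> norm (D k) * exp (- 2 * pi * of_int k + - 2 * pi * of_int K * (Im \<tau> - 1))"
        by (rule mult_left_mono) auto
      thus ?thesis unfolding exp_add by (simp add: h_def norm_mult norm_ee mult_ac)
    qed
    ultimately have "norm (X \<tau>) \<le> infsum h UNIV * exp (- 2 * pi * of_int K * (Im \<tau> - 1))"
      by (rule norm_infsum_le)
    thus ?thesis by (simp add: right_diff_distrib exp_diff exp_minus field_simps)
  qed
  thus ?thesis by blast
qed

section \<open>Expansions of eta powers, of eta quotients and of F\<close>

lemma P_sums:
  assumes "norm q < 1"
  shows "(\<lambda>n. P r (of_nat n) * q ^ n) sums (qprod q 1 powi r)"
proof -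
  have "(\<lambda>n. q_coeffs (\<lambda>\<tau>. dedekind_eta \<tau> powi r) (of_int r / 24) n * q ^ n) sums (qprod q 1 powi r)"
  proof (rule q_coeffs_sums[OF _ _ assms])
    show "(\<lambda>q. qprod q 1 powi r) holomorphic_on ball 0 1"
      by (intro holomorphic_intros qprod_holomorphic) (auto simp: qprod_1_nonzero)
    show "dedekind_eta \<tau> powi r = qpow (of_int r / 24) \<tau> * qprod (ee \<tau>) 1 powi r" for \<tau>
      by (simp add: dedekind_eta_eq power_int_mult_distrib ee_powi qpow_eq of_rat_divide)
  qed
  moreover have "P r (of_nat n) = q_coeffs (\<lambda>\<tau>. dedekind_eta \<tau> powi r) (of_int r / 24) n" for n
    by (simp add: P_def)
  ultimately show ?thesis by simp
qed

lemma P_of_int_neg: "k < 0 \<Longrightarrow> P r (of_int k) = 0"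
  by (auto simp: P_def Nats_def)

text \<open>The leading exponent of eta^r(p^beta_bar tau) as a complex number. Taking this power of
  q out leaves integral exponents on both sides of (A).\<close>

definition eta_func :: "nat \<Rightarrow> nat \<Rightarrow> int \<Rightarrow> complex" where
  "eta_func p \<beta> r = of_nat (p ^ beta_bar \<beta>) * of_int r / 24"

lemma gcd_24: "24 div gcd 12 (p - 1) * (p - 1) = 24 * pi_p p"
proof -
  obtain k l where kl: "12 = gcd 12 (p - 1) * k" "p - 1 = gcd 12 (p - 1) * l"
    by (metis gcd_dvd1 gcd_dvd2 dvdE)
  define g where "g = gcd 12 (p - 1)"
  have g: "g > 0" "12 = g * k" "p - 1 = g * l" using kl by (auto simp: g_def)
  have "24 = g * (2 * k)" using g(2) by simp
  hence "24 div g = 2 * k" using g(1) by (metis nonzero_mult_div_cancel_left not_gr_zero)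
  moreover have "pi_p p = (g * l) div g" unfolding pi_p_def g_def[symmetric] unfolding g(3) ..
  hence "pi_p p = l" using g(1) by simp
  ultimately have "24 div g * (g * l) = 24 * pi_p p" using g(2) by simp
  thus ?thesis unfolding g_def[symmetric] unfolding g(3) .
qed

lemma eta_quotient_eq:
  "eta_quotient p \<beta> r y \<tau> = dedekind_eta (of_nat (p ^ beta_bar \<beta>) * \<tau>) powi r *
     (eta_ratio p \<tau> ^ (24 div gcd 12 (p - 1))) powi y"
  by (simp add: eta_quotient_def eta_ratio_def power_int_mult)

text \<open>phi is the quotient without its leading power of q; the value 1 at q = 0 is recorded
  because it gives the normalisation a_0 = 1.\<close>

lemma a_coeff_sums:
  assumes p: "p > 0"
  shows "\<exists>\<phi>. \<phi> 0 = 1 \<and> (\<forall>q. norm q < 1 \<longrightarrow> (\<lambda>n. a_coeff p \<beta> r y n * q ^ n) sums \<phi> q) \<and>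
    (\<forall>\<tau>. Im \<tau> > 0 \<longrightarrow> eta_quotient p \<beta> r y \<tau> = ee (eta_func p \<beta> r * \<tau>) * (ee (of_int (int (pi_p p) * y) * \<tau>) * \<phi> (ee \<tau>)))"
proof -
  define s where "s = 24 div gcd 12 (p - 1)"
  define b where "b = p ^ beta_bar \<beta>"
  have b: "b > 0" using p by (simp add: b_def)
  define \<phi> where "\<phi> = (\<lambda>q. qprod (q ^ b) 1 powi r * (qprod (q ^ p) 1 / qprod q 1) powi (int s * y))"
  have "s * (p - 1) = 24 * pi_p p" unfolding s_def by (rule gcd_24)
  hence "of_nat s * (of_nat p - 1) = (24 * of_nat (pi_p p) :: complex)" using p
    by (metis of_nat_1 of_nat_diff of_nat_mult of_nat_numeral Suc_leI One_nat_def)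
  hence sp: "of_nat s * of_nat p = (24 * of_nat (pi_p p) + of_nat s :: complex)" by (simp add: algebra_simps)
  have eq: "eta_quotient p \<beta> r y \<tau> = ee (eta_func p \<beta> r * \<tau>) * (ee (of_int (int (pi_p p) * y) * \<tau>) * \<phi> (ee \<tau>))"
    if \<tau>: "Im \<tau> > 0" for \<tau>
  proof -
    have "dedekind_eta (of_nat b * \<tau>) powi r = ee (eta_func p \<beta> r * \<tau>) * qprod (ee \<tau> ^ b) 1 powi r"
      by (simp add: dedekind_eta_eq power_int_mult_distrib ee_powi ee_power eta_func_def b_def mult_ac)
    moreover have "(eta_ratio p \<tau> ^ s) powi y = ee (of_int (int (pi_p p) * y) * \<tau>) * (qprod (ee \<tau> ^ p) 1 / qprod (ee \<tau>) 1) powi (int s * y)"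
    proof -
      have "eta_ratio p \<tau> = ee (of_nat p * \<tau> / 24 - \<tau> / 24) * (qprod (ee \<tau> ^ p) 1 / qprod (ee \<tau>) 1)"
        by (simp add: eta_ratio_def dedekind_eta_eq ee_power ee_diff)
      hence "(eta_ratio p \<tau> ^ s) powi y = ee (of_int y * (of_nat s * (of_nat p * \<tau> / 24 - \<tau> / 24))) * (qprod (ee \<tau> ^ p) 1 / qprod (ee \<tau>) 1) powi (int s * y)"
        by (simp only: power_mult_distrib power_int_mult_distrib power_int_mult power_int_of_nat ee_power ee_powi)
      also have "of_nat s * (of_nat p * \<tau> / 24 - \<tau> / 24) = (of_nat s * of_nat p) * \<tau> / 24 - of_nat s * \<tau> / 24"
        by (simp add: algebra_simps)
      also have "\<dots> = of_nat (pi_p p) * \<tau>" unfolding sp by (simp add: add_divide_distrib distrib_right)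
      finally show ?thesis by (simp add: mult_ac)
    qed
    ultimately show ?thesis unfolding eta_quotient_eq s_def[symmetric] b_def[symmetric] by (simp add: \<phi>_def)
  qed
  have "(\<lambda>n. a_coeff p \<beta> r y n * q ^ n) sums \<phi> q" if q: "norm q < 1" for q
    unfolding a_coeff_def
  proof (rule q_coeffs_sums[OF _ _ q])
    show "\<phi> holomorphic_on ball 0 1" unfolding \<phi>_def
      using b p by (intro holomorphic_intros qprod_holomorphic) (auto simp: qprod_1_nonzero norm_power_lt_1)
    show "eta_quotient p \<beta> r y \<tau> = qpow (of_nat (p ^ beta_bar \<beta>) * of_int r / 24 + of_nat (pi_p p) * of_int y) \<tau> * \<phi> (ee \<tau>)"
      if "Im \<tau> > 0" for \<tau>
      unfolding eq[OF that] by (simp add: qpow_eq of_rat_add of_rat_mult of_rat_divide of_rat_power distrib_right ee_add eta_func_def)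
  qed
  moreover have "\<phi> 0 = 1" using b p by (simp add: \<phi>_def power_0_left)
  ultimately show ?thesis using eq by blast
qed

lemma a_coeff_0:
  assumes "p > 0"
  shows "a_coeff p \<beta> r y 0 = 1"
proof -
  obtain \<phi> where \<phi>: "\<phi> 0 = 1" "\<And>q. norm q < 1 \<Longrightarrow> (\<lambda>n. a_coeff p \<beta> r y n * q ^ n) sums \<phi> q"
    using a_coeff_sums[OF assms, of \<beta> r y] by blast
  have "(\<lambda>n. a_coeff p \<beta> r y n * 0 ^ n) sums 1" using \<phi>(2)[of 0] \<phi>(1) by simp
  thus ?thesis by simp
qed

lemma laurent_eta_quotient:
  assumes "p > 0"
  shows "laurent (\<lambda>k. if k \<ge> int (pi_p p) * y then a_coeff p \<beta> r y (nat (k - int (pi_p p) * y)) else 0)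
    (\<lambda>\<tau>. ee (- eta_func p \<beta> r * \<tau>) * eta_quotient p \<beta> r y \<tau>)"
proof -
  obtain \<phi> where \<phi>: "\<And>q. norm q < 1 \<Longrightarrow> (\<lambda>n. a_coeff p \<beta> r y n * q ^ n) sums \<phi> q"
    "\<And>\<tau>. Im \<tau> > 0 \<Longrightarrow> eta_quotient p \<beta> r y \<tau> = ee (eta_func p \<beta> r * \<tau>) * (ee (of_int (int (pi_p p) * y) * \<tau>) * \<phi> (ee \<tau>))"
    using a_coeff_sums[OF assms, of \<beta> r y] by blast
  have "ee (- eta_func p \<beta> r * \<tau>) * eta_quotient p \<beta> r y \<tau> = ee (of_int (int (pi_p p) * y) * \<tau>) * \<phi> (ee \<tau>)"
    if "Im \<tau> > 0" for \<tau> unfolding \<phi>(2)[OF that] by (simp add: ee_minus mult.assoc[symmetric])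
  thus ?thesis using laurent_powser[OF \<phi>(1), of "int (pi_p p) * y"] by (simp add: laurent_def)
qed

lemma sum_roots_of_unity_filter:
  assumes "N > 0"
  shows "(\<Sum>j<N. ee (of_nat j * (of_int m / of_nat N))) = (if int N dvd m then of_nat N else 0)"
proof -
  define x where "x = ee (of_int m / of_nat N)"
  have s: "(\<Sum>j<N. ee (of_nat j * (of_int m / of_nat N))) = (\<Sum>j<N. x ^ j)" by (simp add: x_def ee_power)
  have N0: "(of_nat N :: complex) \<noteq> 0" using assms by simp
  have xN: "x ^ N = 1" using N0 by (simp add: x_def ee_power)
  have "x = 1 \<longleftrightarrow> int N dvd m"
  proof
    assume "x = 1"
    then obtain n :: int where "of_int m / of_nat N = (of_int n :: complex)" unfolding x_def ee_eq_1_iff by blast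
    hence "(of_int m :: complex) = of_int (int N * n)" using N0 by (simp add: field_simps)
    thus "int N dvd m" by (simp only: of_int_eq_iff) simp
  next
    assume "int N dvd m"
    then obtain n where "m = int N * n" by blast
    thus "x = 1" using N0 by (simp add: x_def)
  qed
  moreover have "(\<Sum>j<N. x ^ j) = 0" if "x \<noteq> 1" using that xN by (simp add: sum_gp_strict)
  ultimately show ?thesis unfolding s by auto
qed

lemma dvd_24_power:
  fixes r :: int
  assumes "24 dvd r * (int p ^ 2 - 1)"
  shows "24 dvd r * (int p ^ (\<beta> + beta_bar \<beta>) - 1)"
proof -
  obtain k where "\<beta> + beta_bar \<beta> = 2 * k" using even_beta by blast
  hence "int p ^ (\<beta> + beta_bar \<beta>) - 1 = (int p ^ 2) ^ k - 1" by (simp add: power_mult)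
  moreover have "int p ^ 2 - 1 dvd (int p ^ 2) ^ k - 1" by (metis power_diff_1_eq dvd_triv_left)
  ultimately have "r * (int p ^ 2 - 1) dvd r * (int p ^ (\<beta> + beta_bar \<beta>) - 1)"
    by (simp only: mult_dvd_mono[OF dvd_refl])
  thus ?thesis by (rule dvd_trans[OF assms])
qed

lemma P_shift_int:
  assumes p: "p > 0" and r: "24 dvd r * (int p ^ 2 - 1)"
  shows "\<exists>L::int. P_shift p \<beta> r = of_int L \<and> r * (int p ^ (\<beta> + beta_bar \<beta>) - 1) = 24 * L"
proof -
  obtain L where L: "r * (int p ^ (\<beta> + beta_bar \<beta>) - 1) = 24 * L" using dvd_24_power[OF r] by blast
  have "(of_int (r * (int p ^ (\<beta> + beta_bar \<beta>) - 1)) :: rat) = of_int (24 * L)" unfolding L ..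
  hence "P_shift p \<beta> r = of_int L" by (simp add: P_shift_def field_simps)
  thus ?thesis using L by blast
qed

text \<open>The sum over j is a root of unity filter: after multiplication by eta^r(p^beta_bar tau)
  only the coefficients of eta^r at n = L + p^beta k survive, with L the integer
  \<open>P_shift\<close>, and n contributes to the exponent k.\<close>

theorem laurent_U_ratio:
  assumes p: "p > 0" and r: "24 dvd r * (int p ^ 2 - 1)"
  shows "laurent (\<lambda>k. P r (P_shift p \<beta> r + of_nat (p ^ \<beta>) * of_int k))
    (\<lambda>\<tau>. ee (- eta_func p \<beta> r * \<tau>) * (dedekind_eta (of_nat (p ^ beta_bar \<beta>) * \<tau>) powi r * U_ratio p \<beta> r \<tau>))"
  unfolding laurent_def
proof (intro allI impI)
  fix \<tau> assume \<tau>: "Im \<tau> > 0"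
  define N where "N = p ^ \<beta>"
  define b where "b = p ^ beta_bar \<beta>"
  define e where "e = \<beta> + beta_bar \<beta>"
  have N: "N > 0" and b: "b > 0" using p by (auto simp: N_def b_def)
  have N0: "(of_nat N :: complex) \<noteq> 0" using N by simp
  have pe: "p ^ e = N * b" by (simp add: e_def N_def b_def power_add)
  obtain L where L: "P_shift p \<beta> r = of_int L" "r * (int p ^ e - 1) = 24 * L"
    using P_shift_int[OF p r, of \<beta>] unfolding e_def by blast
  have Lc: "(of_int r * (of_nat N * of_nat b) :: complex) = 24 * of_int L + of_int r"
    using arg_cong[OF L(2), of "of_int :: int \<Rightarrow> complex"] by (simp add: algebra_simps flip: of_nat_mult of_nat_power pe)
  define s where "s = eta_func p \<beta> r"
  have s: "s = of_nat b * of_int r / 24" by (simp add: s_def eta_func_def b_def)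
  \<comment> \<open>The numbers p^beta s and r/24 differ by the integer L; this is how 24 | r (p^2 -
    1) makes the exponents integral.\<close>
  have sN: "s = (of_int L + of_int r / 24) / of_nat N"
  proof -
    have "s = of_int r * (of_nat N * of_nat b) / 24 / of_nat N" using N0 by (simp add: s)
    thus ?thesis unfolding Lc by (simp add: add_divide_distrib)
  qed
  define u where "u = (\<lambda>j::nat. (\<tau> + of_nat j) / of_nat N)"
  have u: "Im (u j) > 0" for j using \<tau> N by (simp add: u_def)
  have eb: "dedekind_eta (of_nat b * \<tau>) \<noteq> 0" using dedekind_eta_nonzero[of "of_nat b * \<tau>"] \<tau> b by simp
  have translate: "dedekind_eta (of_nat b * \<tau> + of_nat n) = ee (of_nat n / 24) * dedekind_eta (of_nat b * \<tau>)" for n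
    by (simp add: dedekind_eta_eq add_divide_distrib ee_add)
  \<comment> \<open>The point p^e u_j is b tau plus the integer b j, so the denominator of g cancels
    eta^r(b tau) up to a root of unity.\<close>
  have eta_term: "dedekind_eta (of_nat b * \<tau>) powi r * eta_ratio (p ^ e) (u j) powi (- r) =
      ee (- of_nat j * s) * dedekind_eta (u j) powi r" for j
  proof -
    have "of_nat (p ^ e) * u j = of_nat b * \<tau> + of_nat (b * j)"
      unfolding pe using N0 by (simp add: u_def field_simps)
    hence "eta_ratio (p ^ e) (u j) = ee (of_nat (b * j) / 24) * dedekind_eta (of_nat b * \<tau>) / dedekind_eta (u j)"
      unfolding eta_ratio_def by (simp only: translate)
    hence "eta_ratio (p ^ e) (u j) powi (- r) = ee (of_int (- r) * (of_nat (b * j) / 24)) *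
       (dedekind_eta (of_nat b * \<tau>) powi (- r)) / dedekind_eta (u j) powi (- r)"
      by (simp only: power_int_divide_distrib power_int_mult_distrib ee_powi)
    also have "of_int (- r) * (of_nat (b * j) / 24) = - of_nat j * s" by (simp add: s)
    finally show ?thesis using eb dedekind_eta_nonzero[OF u[of j]] by (simp add: power_int_minus field_simps)
  qed
  have expand: "((\<lambda>n. P r (of_nat n) * ee ((of_nat n + of_int r / 24) * u j)) has_sum (dedekind_eta (u j) powi r)) UNIV" for j
  proof -
    have ds: "(of_nat n + of_int r / 24) * u j = of_int r / 24 * u j + of_nat n * u j" for n
      by (simp add: distrib_right)
    have "((\<lambda>n. ee (of_int r / 24 * u j) * (P r (of_nat n) * ee (u j) ^ n)) has_sum (ee (of_int r / 24 * u j) * (qprod (ee (u j)) 1 powi r))) UNIV"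
      using u[of j] by (intro has_sum_cmult_right powser_has_sum P_sums) auto
    also have "(\<lambda>n. ee (of_int r / 24 * u j) * (P r (of_nat n) * ee (u j) ^ n)) = (\<lambda>n. P r (of_nat n) * ee ((of_nat n + of_int r / 24) * u j))"
      unfolding ds ee_add ee_power by (simp add: mult_ac)
    also have "ee (of_int r / 24 * u j) * (qprod (ee (u j)) 1 powi r) = dedekind_eta (u j) powi r"
      by (simp add: dedekind_eta_eq power_int_mult_distrib ee_powi)
    finally show ?thesis .
  qed
  have ex: "- of_nat j * s + (of_nat n + of_int r / 24) * u j =
     (of_nat n + of_int r / 24) * \<tau> / of_nat N + of_nat j * (of_int (int n - L) / of_nat N)" for n j
  proof -
    show ?thesis unfolding sN using N0 by (simp add: u_def field_simps)
  qed
  define F where "F = (\<lambda>n. P r (of_nat n) * (ee ((of_nat n + of_int r / 24) * \<tau> / of_nat N) *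
        (if int N dvd int n - L then of_nat N else 0)))"
  have "((\<lambda>n. \<Sum>j<N. ee (- of_nat j * s) * (P r (of_nat n) * ee ((of_nat n + of_int r / 24) * u j))) has_sum
     (\<Sum>j<N. ee (- of_nat j * s) * dedekind_eta (u j) powi r)) UNIV"
    by (intro has_sum_sum has_sum_cmult_right expand) auto
  also have "(\<lambda>n. \<Sum>j<N. ee (- of_nat j * s) * (P r (of_nat n) * ee ((of_nat n + of_int r / 24) * u j))) = F"
  proof
    fix n
    have "(\<Sum>j<N. ee (- of_nat j * s) * (P r (of_nat n) * ee ((of_nat n + of_int r / 24) * u j))) =
       (\<Sum>j<N. P r (of_nat n) * ee (- of_nat j * s + (of_nat n + of_int r / 24) * u j))"
      unfolding ee_add by (simp only: mult_ac)
    also have "\<dots> = (\<Sum>j<N. P r (of_nat n) * (ee ((of_nat n + of_int r / 24) * \<tau> / of_nat N) * ee (of_nat j * (of_int (int n - L) / of_nat N))))"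
      unfolding ex ee_add ..
    also have "\<dots> = F n" unfolding F_def sum_roots_of_unity_filter[OF N, symmetric] by (simp only: sum_distrib_left)
    finally show "(\<Sum>j<N. ee (- of_nat j * s) * (P r (of_nat n) * ee ((of_nat n + of_int r / 24) * u j))) = F n" .
  qed
  also have "(\<Sum>j<N. ee (- of_nat j * s) * dedekind_eta (u j) powi r) = dedekind_eta (of_nat b * \<tau>) powi r * (of_nat N * U_ratio p \<beta> r \<tau>)"
    unfolding U_ratio_def N_def[symmetric] e_def[symmetric] eta_term[symmetric] sum_distrib_left[symmetric] using N0
    by (simp add: u_def)
  finally have "((\<lambda>n. (ee (- s * \<tau>) / of_nat N) * F n) has_sum ((ee (- s * \<tau>) / of_nat N) * (dedekind_eta (of_nat b * \<tau>) powi r * (of_nat N * U_ratio p \<beta> r \<tau>)))) UNIV"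
    by (rule has_sum_cmult_right)
  also have "(ee (- s * \<tau>) / of_nat N) * (dedekind_eta (of_nat b * \<tau>) powi r * (of_nat N * U_ratio p \<beta> r \<tau>)) =
      ee (- s * \<tau>) * (dedekind_eta (of_nat b * \<tau>) powi r * U_ratio p \<beta> r \<tau>)" using N0 by simp
  also have "((\<lambda>n. (ee (- s * \<tau>) / of_nat N) * F n) has_sum \<dots>) UNIV \<longleftrightarrow>
     ((\<lambda>n. (ee (- s * \<tau>) / of_nat N) * F n) has_sum \<dots>) {n. int N dvd int n - L}"
    by (rule has_sum_cong_neutral) (auto simp: F_def)
  also have "\<dots> \<longleftrightarrow> ((\<lambda>k. P r (of_int L + of_nat N * of_int k) * ee (of_int k * \<tau>)) has_sum
      (ee (- s * \<tau>) * (dedekind_eta (of_nat b * \<tau>) powi r * U_ratio p \<beta> r \<tau>))) {k. L + int N * k \<ge> 0}"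
  proof (rule has_sum_reindex_bij_witness[of _ "\<lambda>k. nat (L + int N * k)" "\<lambda>n. (int n - L) div int N"])
    fix n assume "n \<in> {n. int N dvd int n - L}"
    then obtain k where k: "int n - L = int N * k" by blast
    have kd: "(int n - L) div int N = k" unfolding k using N by simp
    have n: "int n = L + int N * k" using k by simp
    show "nat (L + int N * ((int n - L) div int N)) = n" unfolding kd n[symmetric] by simp
    show "(int n - L) div int N \<in> {k. L + int N * k \<ge> 0}" unfolding kd using n by simp
    have nc: "of_nat n = (of_int L + of_nat N * of_int k :: complex)" using arg_cong[OF n, of "of_int :: int \<Rightarrow> complex"] by simp
    have nr: "of_nat n = (of_int L + of_nat N * of_int k :: rat)" using arg_cong[OF n, of "of_int :: int \<Rightarrow> rat"] by simp
    have "- s * \<tau> + (of_nat n + of_int r / 24) * \<tau> / of_nat N = of_int k * \<tau>"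
    proof -
      show ?thesis unfolding sN using N0 by (simp add: nc field_simps)
    qed
    hence "ee (- s * \<tau>) * ee ((of_nat n + of_int r / 24) * \<tau> / of_nat N) = ee (of_int k * \<tau>)" by (simp only: ee_add[symmetric])
    thus "P r (of_int L + of_nat N * of_int ((int n - L) div int N)) * ee (of_int ((int n - L) div int N) * \<tau>) =
        (ee (- s * \<tau>) / of_nat N) * F n"
      unfolding kd F_def nr[symmetric] using N0 k by (simp add: mult_ac)
  next
    fix k assume k: "k \<in> {k. L + int N * k \<ge> 0}"
    hence "int (nat (L + int N * k)) - L = int N * k" by simp
    thus "(int (nat (L + int N * k)) - L) div int N = k" "nat (L + int N * k) \<in> {n. int N dvd int n - L}"
      using N by (simp_all only: mem_Collect_eq) simp_all
  qed (rule refl)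
  also have "\<dots> \<longleftrightarrow> ((\<lambda>k. P r (of_int L + of_nat N * of_int k) * ee (of_int k * \<tau>)) has_sum
      (ee (- s * \<tau>) * (dedekind_eta (of_nat b * \<tau>) powi r * U_ratio p \<beta> r \<tau>))) UNIV"
  proof (rule has_sum_cong_neutral)
    fix k assume "k \<in> UNIV - {k. L + int N * k \<ge> 0}"
    hence "P r (of_int (L + int N * k)) = 0" by (intro P_of_int_neg) auto
    thus "P r (of_int L + of_nat N * of_int k) * ee (of_int k * \<tau>) = 0" by simp
  qed auto
  finally show "((\<lambda>k. P r (P_shift p \<beta> r + of_nat (p ^ \<beta>) * of_int k) * ee (of_int k * \<tau>)) has_sum
      ee (- eta_func p \<beta> r * \<tau>) * (dedekind_eta (of_nat (p ^ beta_bar \<beta>) * \<tau>) powi r * U_ratio p \<beta> r \<tau>)) UNIV"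
    unfolding L(1) N_def[symmetric] b_def[symmetric] s_def[symmetric] .
qed

section \<open>The eta identity\<close>

definition U_coeff :: "nat \<Rightarrow> nat \<Rightarrow> int \<Rightarrow> int \<Rightarrow> complex" where
  "U_coeff p \<beta> r k = P r (P_shift p \<beta> r + of_nat (p ^ \<beta>) * of_int k)"

definition eta_factor :: "nat \<Rightarrow> nat \<Rightarrow> int \<Rightarrow> complex \<Rightarrow> complex" where
  "eta_factor p \<beta> r \<tau> = ee (- eta_func p \<beta> r * \<tau>) * dedekind_eta (of_nat (p ^ beta_bar \<beta>) * \<tau>) powi r"

definition quotient_coeff :: "nat \<Rightarrow> nat \<Rightarrow> int \<Rightarrow> int \<Rightarrow> int \<Rightarrow> complex" where
  "quotient_coeff p \<beta> r y k = (if k \<ge> int (pi_p p) * y then a_coeff p \<beta> r y (nat (k - int (pi_p p) * y)) else 0)"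

lemma laurent_U: 
  assumes "p > 0" "24 dvd r * (int p ^ 2 - 1)"
  shows "laurent (U_coeff p \<beta> r) (\<lambda>\<tau>. eta_factor p \<beta> r \<tau> * U_ratio p \<beta> r \<tau>)"
  using laurent_U_ratio[OF assms, of \<beta>] unfolding U_coeff_def eta_factor_def by (simp add: mult.assoc)

lemma laurent_quotient:
  assumes "p > 0"
  shows "laurent (quotient_coeff p \<beta> r y) (\<lambda>\<tau>. eta_factor p \<beta> r \<tau> * hauptmodul p \<tau> powi y)"
  using laurent_eta_quotient[OF assms, of y \<beta> r]
  unfolding quotient_coeff_def eta_factor_def eta_quotient_eq hauptmodul_def by (simp add: mult.assoc)

lemma eta_factor_nonzero:
  assumes "p > 0" "Im \<tau> > 0"
  shows "eta_factor p \<beta> r \<tau> \<noteq> 0"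
  using dedekind_eta_nonzero[of "of_nat (p ^ beta_bar \<beta>) * \<tau>"] assms by (simp add: eta_factor_def flip: of_nat_power)

lemma hauptmodul_nonzero: "p > 0 \<Longrightarrow> Im \<tau> > 0 \<Longrightarrow> hauptmodul p \<tau> \<noteq> 0"
  using eta_ratio_nonzero by (simp add: hauptmodul_def)

text \<open>Both sides of (A) contain the nonvanishing factor eta^r(p^beta_bar tau). The left-hand
  sum converges by \<open>laurent_U\<close>, so the \<open>has_sum\<close> claim reduces to an
  equality of values.\<close>

lemma eta_identity_iff:
  assumes p: "p > 0" and r: "24 dvd r * (int p ^ 2 - 1)"
  shows "eta_identity p \<beta> r \<longleftrightarrow> finite {y. c_coeff p \<beta> r y \<noteq> 0} \<and>
    (\<forall>\<tau>. Im \<tau> > 0 \<longrightarrow> U_ratio p \<beta> r \<tau> = (\<Sum>y | c_coeff p \<beta> r y \<noteq> 0. c_coeff p \<beta> r y * hauptmodul p \<tau> powi y))"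
proof -
  have "((\<lambda>m. P r (of_nat (p ^ \<beta>) * m - of_int r / 24) * qpow m \<tau>) has_sum
         (\<Sum>y | c_coeff p \<beta> r y \<noteq> 0. c_coeff p \<beta> r y * eta_quotient p \<beta> r y \<tau>))
        (range (\<lambda>k::int. of_nat (p ^ beta_bar \<beta>) * of_int r / 24 + of_int k)) \<longleftrightarrow>
      U_ratio p \<beta> r \<tau> = (\<Sum>y | c_coeff p \<beta> r y \<noteq> 0. c_coeff p \<beta> r y * hauptmodul p \<tau> powi y)"
    (is "(?f has_sum ?X) (range ?h) \<longleftrightarrow> _") if \<tau>: "Im \<tau> > 0" for \<tau>
  proof -
    define s where "s = ee (eta_func p \<beta> r * \<tau>)"
    define E where "E = dedekind_eta (of_nat (p ^ beta_bar \<beta>) * \<tau>) powi r"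
    have E: "E \<noteq> 0" using eta_factor_nonzero[OF p \<tau>, of \<beta> r] by (auto simp: eta_factor_def E_def)
    have X: "?X = E * (\<Sum>y | c_coeff p \<beta> r y \<noteq> 0. c_coeff p \<beta> r y * hauptmodul p \<tau> powi y)"
      by (simp add: eta_quotient_eq hauptmodul_def E_def sum_distrib_left mult_ac)
    have "(?f has_sum ?X) (range ?h) \<longleftrightarrow> ((?f \<circ> ?h) has_sum ?X) UNIV"
      by (rule has_sum_reindex) (auto simp: inj_on_def)
    also have "?f \<circ> ?h = (\<lambda>k. s * (U_coeff p \<beta> r k * ee (of_int k * \<tau>)))"
    proof
      fix k
      have "of_nat (p ^ \<beta>) * ?h k - of_int r / 24 = P_shift p \<beta> r + of_nat (p ^ \<beta>) * of_int k"
        by (simp add: P_shift_def field_simps power_add)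
      moreover have "qpow (?h k) \<tau> = s * ee (of_int k * \<tau>)"
        by (simp add: qpow_eq s_def eta_func_def of_rat_add of_rat_divide of_rat_mult of_rat_power distrib_right ee_add)
      ultimately show "(?f \<circ> ?h) k = s * (U_coeff p \<beta> r k * ee (of_int k * \<tau>))"
        by (simp add: U_coeff_def)
    qed
    also have "((\<lambda>k. s * (U_coeff p \<beta> r k * ee (of_int k * \<tau>))) has_sum ?X) UNIV \<longleftrightarrow> ?X = s * (eta_factor p \<beta> r \<tau> * U_ratio p \<beta> r \<tau>)"
      (is "_ \<longleftrightarrow> ?X = ?Z")
    proof -
      have *: "((\<lambda>k. s * (U_coeff p \<beta> r k * ee (of_int k * \<tau>))) has_sum ?Z) UNIV"
        using laurent_U[OF p r, of \<beta>] \<tau> by (intro has_sum_cmult_right) (auto simp: laurent_def)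
      show ?thesis using has_sum_unique[OF _ *, of ?X] * by auto
    qed
    also have "?Z = E * U_ratio p \<beta> r \<tau>"
      by (simp add: s_def eta_factor_def E_def ee_minus)
    also have "?X = E * U_ratio p \<beta> r \<tau> \<longleftrightarrow>
        U_ratio p \<beta> r \<tau> = (\<Sum>y | c_coeff p \<beta> r y \<noteq> 0. c_coeff p \<beta> r y * hauptmodul p \<tau> powi y)"
      unfolding X mult_left_cancel[OF E] by (rule eq_commute)
    finally show ?thesis .
  qed
  thus ?thesis unfolding eta_identity_def by blast
qed

text \<open>The integers are not well-ordered, so \<open>LEAST\<close> needs a lower bound to be
  meaningful.\<close>

lemma int_Least:
  fixes Q :: "int \<Rightarrow> bool"
  assumes "Q y" "\<And>y. Q y \<Longrightarrow> lo \<le> y"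
  shows "Q (LEAST y. Q y)" "\<And>z. Q z \<Longrightarrow> (LEAST y. Q y) \<le> z"
proof -
  obtain x where x: "Q x" "\<And>z. Q z \<Longrightarrow> nat (x - lo) \<le> nat (z - lo)"
    using ex_has_least_nat[of Q y "\<lambda>y. nat (y - lo)"] assms(1) by blast
  have le: "x \<le> z" if "Q z" for z using x(2)[OF that] assms(2)[OF that] by linarith
  have "(LEAST y. Q y) = x" using x(1) le by (rule Least_equality)
  thus "Q (LEAST y. Q y)" "\<And>z. Q z \<Longrightarrow> (LEAST y. Q y) \<le> z" using x le by auto
qed

lemma U_coeff_lower:
  assumes p: "p > 0" and r: "24 dvd r * (int p ^ 2 - 1)"
  shows "\<exists>lo. \<forall>k. U_coeff p \<beta> r k \<noteq> 0 \<longrightarrow> lo \<le> k"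
proof -
  obtain L where L: "P_shift p \<beta> r = of_int L" using P_shift_int[OF p r] by blast
  have "U_coeff p \<beta> r k = 0" if "k < - \<bar>L\<bar>" for k
  proof -
    have "int (p ^ \<beta>) \<ge> 1" using p by simp
    hence "int (p ^ \<beta>) * k \<le> 1 * k" using that by (intro mult_right_mono_neg) auto
    hence "P r (of_int (L + int (p ^ \<beta>) * k)) = 0" using that by (intro P_of_int_neg) auto
    thus ?thesis by (simp add: U_coeff_def L)
  qed
  thus ?thesis by (meson not_le)
qed

lemma pi_p_pos: "p > 1 \<Longrightarrow> pi_p p > 0"
  unfolding pi_p_def by (simp add: div_greater_zero_iff dvd_imp_le)

lemma P_prog_U_coeff: "P_prog p \<beta> r y = U_coeff p \<beta> r (int (pi_p p) * y)"
  by (simp add: P_prog_def U_coeff_def mult.assoc)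

lemma c_coeff_below: "y < y0 p \<beta> r \<Longrightarrow> c_coeff p \<beta> r y = 0"
  by (subst c_coeff.simps) simp

lemma c_coeff_rec:
  assumes "\<exists>z. P_prog p \<beta> r z \<noteq> 0" "y \<ge> y0 p \<beta> r"
  shows "c_coeff p \<beta> r y = P_prog p \<beta> r y -
    (\<Sum>y' \<in> {y0 p \<beta> r..<y}. c_coeff p \<beta> r y' * a_coeff p \<beta> r y' (pi_p p * nat (y - y')))"
  using assms by (subst c_coeff.simps) auto

lemma y1_props:
  "y0 p \<beta> r \<le> y1 p \<beta> r" "y1_bound p \<beta> r \<le> of_int (y1 p \<beta> r)"
proof -
  define Q where "Q = (\<lambda>y::int. y \<ge> y0 p \<beta> r \<and> of_int y \<ge> y1_bound p \<beta> r)"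
  have "Q (max (y0 p \<beta> r) \<lceil>y1_bound p \<beta> r\<rceil>)"
    unfolding Q_def
  proof
    have "y1_bound p \<beta> r \<le> of_int \<lceil>y1_bound p \<beta> r\<rceil>" by (rule le_of_int_ceiling)
    also have "\<dots> \<le> of_int (max (y0 p \<beta> r) \<lceil>y1_bound p \<beta> r\<rceil>)" unfolding of_int_le_iff by (rule max.cobounded2)
    finally show "y1_bound p \<beta> r \<le> of_int (max (y0 p \<beta> r) \<lceil>y1_bound p \<beta> r\<rceil>)" .
  qed (rule max.cobounded1)
  moreover have "Q y \<Longrightarrow> y0 p \<beta> r \<le> y" for y by (simp add: Q_def)
  ultimately have "Q (LEAST y. Q y)" by (rule int_Least(1))
  thus "y0 p \<beta> r \<le> y1 p \<beta> r" "y1_bound p \<beta> r \<le> of_int (y1 p \<beta> r)"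
    by (auto simp: Q_def y1_def)
qed

text \<open>The bridge between a Laurent coefficient of a sum of c_y h^y and the right-hand side of
  (B): h^y starts at exponent pi_p y, so only y with pi_p (y - y_0) <= n contribute. W stays general
  so that it can be the support of c or an interval.\<close>

lemma coeff_identity_sum:
  fixes p \<beta> n :: nat and r :: int
  defines "y\<^sub>0 \<equiv> y0 p \<beta> r"
  assumes p: "p > 1" and W: "finite W" "\<And>y. y \<in> W \<Longrightarrow> y\<^sub>0 \<le> y"
    "\<And>y. y\<^sub>0 \<le> y \<Longrightarrow> int (pi_p p) * (y - y\<^sub>0) \<le> int n \<Longrightarrow> y \<notin> W \<Longrightarrow> c_coeff p \<beta> r y = 0"
  shows "(\<Sum>y\<in>W. c_coeff p \<beta> r y * quotient_coeff p \<beta> r y (int (pi_p p) * y\<^sub>0 + int n)) =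
    (\<Sum>y | y\<^sub>0 \<le> y \<and> (of_int y :: rat) \<le> of_int y\<^sub>0 + of_nat n / of_nat (pi_p p).
           c_coeff p \<beta> r y * a_coeff p \<beta> r y (n - pi_p p * nat (y - y\<^sub>0)))"
proof -
  define q where "q = pi_p p"
  have q: "q > 0" unfolding q_def by (rule pi_p_pos[OF p])
  define T where "T = {y. y\<^sub>0 \<le> y \<and> (of_int y :: rat) \<le> of_int y\<^sub>0 + of_nat n / of_nat q}"
  have T: "y \<in> T \<longleftrightarrow> y\<^sub>0 \<le> y \<and> int q * (y - y\<^sub>0) \<le> int n" for y
  proof -
    have "(of_int y :: rat) \<le> of_int y\<^sub>0 + of_nat n / of_nat q \<longleftrightarrow> (of_int (int q * (y - y\<^sub>0)) :: rat) \<le> of_int (int n)"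
      using q by (simp add: field_simps)
    thus ?thesis unfolding T_def by (simp only: of_int_le_iff mem_Collect_eq)
  qed
  have "T \<subseteq> {y\<^sub>0..y\<^sub>0 + int n}"
  proof
    fix y assume "y \<in> T"
    hence y: "y\<^sub>0 \<le> y" "int q * (y - y\<^sub>0) \<le> int n" by (auto simp: T)
    have "1 * (y - y\<^sub>0) \<le> int q * (y - y\<^sub>0)" using q y by (intro mult_right_mono) auto
    thus "y \<in> {y\<^sub>0..y\<^sub>0 + int n}" using y by auto
  qed
  hence finT: "finite T" by (rule finite_subset) auto
  have "(\<Sum>y\<in>W. c_coeff p \<beta> r y * quotient_coeff p \<beta> r y (int q * y\<^sub>0 + int n)) =
    (\<Sum>y\<in>W \<inter> T. c_coeff p \<beta> r y * quotient_coeff p \<beta> r y (int q * y\<^sub>0 + int n))"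
    using W(1,2) by (intro sum.mono_neutral_right) (auto simp: T quotient_coeff_def q_def algebra_simps)
  also have "\<dots> = (\<Sum>y\<in>W \<inter> T. c_coeff p \<beta> r y * a_coeff p \<beta> r y (n - q * nat (y - y\<^sub>0)))"
  proof (rule sum.cong)
    fix y assume "y \<in> W \<inter> T"
    hence y: "y\<^sub>0 \<le> y" "int q * (y - y\<^sub>0) \<le> int n" by (auto simp: T)
    have "int q * y\<^sub>0 + int n - int q * y = int n - int (q * nat (y - y\<^sub>0))" using y by (simp add: algebra_simps)
    moreover have "int (q * nat (y - y\<^sub>0)) \<le> int n" using y by simp
    \<comment> \<open>The subtraction of natural numbers is exact here, by the bound defining
      T.\<close>
    ultimately have "int q * y\<^sub>0 + int n - int q * y = int (n - q * nat (y - y\<^sub>0))" by (simp only: of_nat_le_iff of_nat_diff)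
    hence "nat (int q * y\<^sub>0 + int n - int q * y) = n - q * nat (y - y\<^sub>0)" by (simp only: nat_int)
    moreover have "int q * y \<le> int q * y\<^sub>0 + int n" using y by (simp add: algebra_simps)
    ultimately show "c_coeff p \<beta> r y * quotient_coeff p \<beta> r y (int q * y\<^sub>0 + int n) = c_coeff p \<beta> r y * a_coeff p \<beta> r y (n - q * nat (y - y\<^sub>0))"
      by (simp add: quotient_coeff_def q_def)
  qed auto
  also have "\<dots> = (\<Sum>y\<in>T. c_coeff p \<beta> r y * a_coeff p \<beta> r y (n - q * nat (y - y\<^sub>0)))"
  proof (rule sum.mono_neutral_left[OF finT _ ballI])
    fix i assume "i \<in> T - W \<inter> T"
    thus "c_coeff p \<beta> r i * a_coeff p \<beta> r i (n - q * nat (i - y\<^sub>0)) = 0"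
      using W(3)[of i] by (auto simp: T q_def)
  qed simp
  finally show ?thesis by (simp only: T_def q_def)
qed

section \<open>Holomorphy, growth and the comparison of F with powers of h\<close>

lemma dedekind_eta_holomorphic: "dedekind_eta holomorphic_on {\<tau>. Im \<tau> > 0}"
proof -
  have "(\<lambda>\<tau>. ee (\<tau> / 24) * qprod (ee \<tau>) 1) holomorphic_on {\<tau>. Im \<tau> > 0}"
    by (intro holomorphic_intros qprod_holomorphic upper_half_plane) auto
  thus ?thesis by (rule holomorphic_transform) (simp add: dedekind_eta_eq)
qed

lemma eta_ratio_holomorphic:
  assumes "n > 0"
  shows "eta_ratio n holomorphic_on {\<tau>. Im \<tau> > 0}"
proof -
  have "(\<lambda>\<tau>. dedekind_eta (of_nat n * \<tau>)) holomorphic_on {\<tau>. Im \<tau> > 0}"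
    using assms by (intro holomorphic_on_compose_gen[OF _ dedekind_eta_holomorphic, unfolded o_def] holomorphic_intros) auto
  hence "(\<lambda>\<tau>. dedekind_eta (of_nat n * \<tau>) / dedekind_eta \<tau>) holomorphic_on {\<tau>. Im \<tau> > 0}"
    using dedekind_eta_nonzero by (intro holomorphic_on_divide dedekind_eta_holomorphic) auto
  thus ?thesis by (simp add: eta_ratio_def[abs_def])
qed

lemma U_ratio_holomorphic:
  assumes "p > 0"
  shows "U_ratio p \<beta> r holomorphic_on {\<tau>. Im \<tau> > 0}"
proof -
  have "(\<lambda>\<tau>. eta_ratio n ((\<tau> + of_nat j) / of_nat (p ^ \<beta>)) powi (- r)) holomorphic_on {\<tau>. Im \<tau> > 0}" if n: "n > 0" for n j
  proof (rule holomorphic_on_power_int)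
    have pos: "Im ((\<tau> + of_nat j) / of_nat (p ^ \<beta>)) > 0" if "Im \<tau> > 0" for \<tau>
      using that assms by (simp del: of_nat_power)
    show "(\<lambda>\<tau>. eta_ratio n ((\<tau> + of_nat j) / of_nat (p ^ \<beta>))) holomorphic_on {\<tau>. Im \<tau> > 0}"
      using assms pos by (intro holomorphic_on_compose_gen[OF _ eta_ratio_holomorphic[OF n], unfolded o_def] holomorphic_intros) auto
    show "0 \<le> - r \<or> (\<forall>\<tau>\<in>{\<tau>. Im \<tau> > 0}. eta_ratio n ((\<tau> + of_nat j) / of_nat (p ^ \<beta>)) \<noteq> 0)"
      using eta_ratio_nonzero[OF pos n] by blast
  qed
  thus ?thesis unfolding U_ratio_def[abs_def] using assms
    by (intro holomorphic_on_divide holomorphic_on_sum holomorphic_on_const) auto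
qed

text \<open>The power of q taken out is exactly the decay or growth of eta^r(p^beta_bar tau) at
  infinity, so the two exponentials cancel.\<close>

lemma eta_factor_inverse_bound:
  assumes p: "p > 0"
  shows "\<exists>C. C \<ge> 0 \<and> (\<forall>\<tau>. Im \<tau> \<ge> 1 \<longrightarrow> norm (inverse (eta_factor p \<beta> r \<tau>)) \<le> C)"
proof -
  define b where "b = p ^ beta_bar \<beta>"
  have b: "b > 0" using p by (simp add: b_def)
  obtain l1 l2 where l: "l1 > 0" "l2 > 0" "\<And>\<tau>. Im \<tau> \<ge> 1 \<Longrightarrow> l1 * exp (- pi / 12 * Im \<tau>) \<le> norm (dedekind_eta \<tau>)"
    "\<And>\<tau>. Im \<tau> \<ge> 1 \<Longrightarrow> norm (dedekind_eta \<tau>) \<le> l2 * exp (- pi / 12 * Im \<tau>)"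
    using dedekind_eta_bounds[of 1] by (metis zero_less_one)
  define C where "C = max (l1 powi (- r)) (l2 powi (- r))"
  have "norm (inverse (eta_factor p \<beta> r \<tau>)) \<le> C" if \<tau>: "Im \<tau> \<ge> 1" for \<tau>
  proof -
    have "1 * 1 \<le> real b * Im \<tau>" using b \<tau> by (intro mult_mono) auto
    hence b\<tau>: "Im (of_nat b * \<tau>) \<ge> 1" by simp
    have "norm (inverse (eta_factor p \<beta> r \<tau>)) = norm (ee (eta_func p \<beta> r * \<tau>)) * norm (dedekind_eta (of_nat b * \<tau>)) powi (- r)"
      by (simp add: eta_factor_def b_def[symmetric] ee_minus norm_mult norm_power_int norm_inverse power_int_minus del: of_nat_power)
    also have "\<dots> \<le> norm (ee (eta_func p \<beta> r * \<tau>)) * (C * exp (- pi / 12 * Im (of_nat b * \<tau>)) powi (- r))"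
      unfolding C_def by (intro mult_left_mono power_int_sandwich l b\<tau>) (use l in auto)
    also have "\<dots> = C * (norm (ee (eta_func p \<beta> r * \<tau>)) * exp (- pi / 12 * Im (of_nat b * \<tau>)) powi (- r))" by simp
    also have "norm (ee (eta_func p \<beta> r * \<tau>)) * exp (- pi / 12 * Im (of_nat b * \<tau>)) powi (- r) = 1"
    proof -
      define x where "x = real b * of_int r / 24"
      have "eta_func p \<beta> r = of_real x" by (simp add: eta_func_def b_def x_def)
      hence I: "Im (eta_func p \<beta> r * \<tau>) = x * Im \<tau>" by simp
      show ?thesis unfolding norm_ee I exp_powi exp_add[symmetric] by (simp add: x_def field_simps)
    qed
    finally show ?thesis by simp
  qed
  moreover have "C \<ge> 0" using l by (auto simp: C_def le_max_iff_disj)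
  ultimately show ?thesis by blast
qed

lemma U_ratio_hauptmodul_bound:
  assumes p: "prime p" and \<beta>: "\<beta> > 0" and y: "y1_bound p \<beta> r \<le> of_int y"
  shows "\<exists>C. C \<ge> 0 \<and> (\<forall>\<tau>. Im \<tau> \<ge> 1 \<longrightarrow> norm (U_ratio p \<beta> r (fricke p \<tau>)) \<le>
     C * norm (hauptmodul p (fricke p \<tau>)) powi y)"
proof -
  define q where "q = real (pi_p p)"
  obtain C where C: "\<And>\<tau>. Im \<tau> \<ge> 1 \<Longrightarrow> norm (U_ratio p \<beta> r (fricke p \<tau>))
    \<le> C * exp (2 * pi * (q * real_of_rat (y1_bound p \<beta> r)) * Im \<tau>)"
    using U_ratio_cusp_0[OF p \<beta>, of r] unfolding q_def by blast
  obtain k1 k2 where k: "k1 > 0" "k2 > 0"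
    "\<And>\<tau>. Im \<tau> \<ge> 1 \<Longrightarrow> k1 * exp (2 * pi * q * Im \<tau>) \<le> norm (hauptmodul p (fricke p \<tau>))"
    "\<And>\<tau>. Im \<tau> \<ge> 1 \<Longrightarrow> norm (hauptmodul p (fricke p \<tau>)) \<le> k2 * exp (2 * pi * q * Im \<tau>)"
    using hauptmodul_cusp_bounds[OF p] unfolding q_def by blast
  define D where "D = max ((1 / k2) powi y) ((1 / k1) powi y)"
  have D: "D > 0" using k by (auto simp: D_def less_max_iff_disj)
  have yb: "real_of_rat (y1_bound p \<beta> r) \<le> of_int y"
    using y by (metis of_rat_less_eq of_rat_of_int_eq)
  have "norm (U_ratio p \<beta> r (fricke p \<tau>)) \<le> (\<bar>C\<bar> * D) * norm (hauptmodul p (fricke p \<tau>)) powi y"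
    if \<tau>: "Im \<tau> \<ge> 1" for \<tau>
  proof -
    define w where "w = norm (hauptmodul p (fricke p \<tau>))"
    have "0 < k1 * exp (2 * pi * q * Im \<tau>)" using k by simp
    hence w: "w > 0" using k(3)[OF \<tau>] unfolding w_def by linarith
    have "norm (U_ratio p \<beta> r (fricke p \<tau>)) \<le> C * exp (2 * pi * (q * real_of_rat (y1_bound p \<beta> r)) * Im \<tau>)"
      by (rule C[OF \<tau>])
    also have "\<dots> \<le> \<bar>C\<bar> * exp (2 * pi * (q * of_int y) * Im \<tau>)"
      using yb \<tau> by (intro mult_mono) (auto intro!: mult_right_mono mult_left_mono simp: q_def)
    also have "exp (2 * pi * (q * of_int y) * Im \<tau>) = exp (2 * pi * q * Im \<tau>) powi y"
      unfolding exp_powi by (simp add: mult_ac)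
    also have "\<bar>C\<bar> * (exp (2 * pi * q * Im \<tau>) powi y) \<le> \<bar>C\<bar> * (D * w powi y)"
    proof (rule mult_left_mono)
      show "exp (2 * pi * q * Im \<tau>) powi y \<le> D * w powi y" unfolding D_def
        by (rule power_int_sandwich) (use k w k(3,4)[OF \<tau>] in \<open>auto simp: field_simps w_def\<close>)
    qed auto
    finally show ?thesis by (simp add: w_def)
  qed
  thus ?thesis using D by (intro exI[of _ "\<bar>C\<bar> * D"]) auto
qed

text \<open>Comparison of Laurent coefficients; for uniqueness both sides must vanish below a common
  index, here pi_p y_0.\<close>

lemma U_coeff_expansion:
  assumes p: "p > 1" and r: "24 dvd r * (int p ^ 2 - 1)"
    and zero: "\<And>k. k < int (pi_p p) * y\<^sub>0 \<Longrightarrow> U_coeff p \<beta> r k = 0"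
    and W: "finite W" "\<And>y. y \<in> W \<Longrightarrow> y\<^sub>0 \<le> y"
    and U: "\<And>\<tau>. Im \<tau> > 0 \<Longrightarrow> U_ratio p \<beta> r \<tau> = (\<Sum>y\<in>W. c y * hauptmodul p \<tau> powi y)"
  shows "U_coeff p \<beta> r k = (\<Sum>y\<in>W. c y * quotient_coeff p \<beta> r y k)"
proof (rule laurent_unique)
  have p0: "p > 0" using p by simp
  show "laurent (U_coeff p \<beta> r) (\<lambda>\<tau>. eta_factor p \<beta> r \<tau> * U_ratio p \<beta> r \<tau>)" by (rule laurent_U[OF p0 r])
  show "laurent (\<lambda>k. \<Sum>y\<in>W. c y * quotient_coeff p \<beta> r y k) (\<lambda>\<tau>. \<Sum>y\<in>W. c y * (eta_factor p \<beta> r \<tau> * hauptmodul p \<tau> powi y))"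
    by (intro laurent_sum W laurent_cmult laurent_quotient p0)
  show "eta_factor p \<beta> r \<tau> * U_ratio p \<beta> r \<tau> = (\<Sum>y\<in>W. c y * (eta_factor p \<beta> r \<tau> * hauptmodul p \<tau> powi y))" if "Im \<tau> > 0" for \<tau>
    unfolding U[OF that] sum_distrib_left by (simp add: mult_ac)
  show "U_coeff p \<beta> r k = 0" if "k < int (pi_p p) * y\<^sub>0" for k using zero that by blast
  show "(\<Sum>y\<in>W. c y * quotient_coeff p \<beta> r y k) = 0" if k: "k < int (pi_p p) * y\<^sub>0" for k
  proof (rule sum.neutral, rule ballI)
    fix y assume "y \<in> W"
    hence "int (pi_p p) * y\<^sub>0 \<le> int (pi_p p) * y" using W by (intro mult_left_mono) auto
    thus "c y * quotient_coeff p \<beta> r y k = 0" using k by (simp add: quotient_coeff_def)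
  qed
qed

text \<open>The coefficients c are arbitrary here. Agreement up to exponent pi_p y_1 makes the
  difference vanish at infinity to higher order than h^(y_1), while at 0 the growth of h^(y_1)
  dominates F and every h^y with y <= y_1.\<close>

lemma U_ratio_eq_polynomial:
  assumes p: "prime p" and r: "24 dvd r * (int p ^ 2 - 1)" and \<beta>: "\<beta> > 0"
    and y1: "y1_bound p \<beta> r \<le> of_int y\<^sub>1" and W: "finite W" "\<And>y. y \<in> W \<Longrightarrow> y \<le> y\<^sub>1"
    and coeff: "\<And>k. k \<le> int (pi_p p) * y\<^sub>1 \<Longrightarrow> U_coeff p \<beta> r k = (\<Sum>y\<in>W. c y * quotient_coeff p \<beta> r y k)"
    and \<tau>: "Im \<tau> > 0"
  shows "U_ratio p \<beta> r \<tau> = (\<Sum>y\<in>W. c y * hauptmodul p \<tau> powi y)"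
proof -
  have p1: "p > 1" and p0: "p > 0" using p prime_gt_1_nat prime_gt_0_nat by blast+
  define q where "q = real (pi_p p)"
  have q: "q \<ge> 1" using pi_p_pos[OF p1] by (simp add: q_def)
  define S where "S = (\<lambda>\<tau>. U_ratio p \<beta> r \<tau> - (\<Sum>y\<in>W. c y * hauptmodul p \<tau> powi y))"
  define G where "G = (\<lambda>\<tau>. S \<tau> * hauptmodul p \<tau> powi (- y\<^sub>1))"
  have hh: "hauptmodul p holomorphic_on {\<tau>. Im \<tau> > 0}"
    unfolding hauptmodul_def[abs_def] by (intro holomorphic_intros eta_ratio_holomorphic p0)
  obtain k1 k2 where k: "k1 > 0" "k2 > 0"
    "\<And>\<tau>. Im \<tau> \<ge> 1 \<Longrightarrow> k1 * exp (2 * pi * q * Im \<tau>) \<le> norm (hauptmodul p (fricke p \<tau>))"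
    "\<And>\<tau>. Im \<tau> \<ge> 1 \<Longrightarrow> k1 * exp (- 2 * pi * q * Im \<tau>) \<le> norm (hauptmodul p \<tau>)"
    "\<And>\<tau>. Im \<tau> \<ge> 1 \<Longrightarrow> norm (hauptmodul p \<tau>) \<le> k2 * exp (- 2 * pi * q * Im \<tau>)"
    using hauptmodul_cusp_bounds[OF p] unfolding q_def by blast
  obtain C where C: "C \<ge> 0" "\<And>\<tau>. Im \<tau> \<ge> 1 \<Longrightarrow> norm (U_ratio p \<beta> r (fricke p \<tau>)) \<le>
     C * norm (hauptmodul p (fricke p \<tau>)) powi y\<^sub>1"
    using U_ratio_hauptmodul_bound[OF p \<beta> y1] by blast
  have "G \<tau> = 0"
  proof (rule level_p_zero[OF p _ _ _ _ \<tau>])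
    show "G holomorphic_on {\<tau>. Im \<tau> > 0}"
      unfolding G_def S_def using hauptmodul_nonzero[OF p0]
      by (intro holomorphic_intros U_ratio_holomorphic hh p0) auto
    show "G (mob a b (int p * c') d t) = G t" if "a * d - b * (int p * c') = 1" "Im t > 0" for a b c' d t
      unfolding G_def S_def U_ratio_mob[OF p r \<beta> that] hauptmodul_mob[OF p that] ..
    \<comment> \<open>The height 1 / k1 forces |h| >= 1 at the Fricke image, so |h|^(y - y_1) <= 1
      for every y in W.\<close>
    show "norm (G (fricke p t)) \<le> C + (\<Sum>y\<in>W. norm (c y))" if t: "Im t \<ge> max 1 (1 / k1)" for t
    proof -
      define w where "w = hauptmodul p (fricke p t)"
      have t1: "Im t \<ge> 1" using t by simp
      have "1 / k1 \<le> Im t" using t by simp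
      also have "1 * Im t \<le> (2 * pi * q) * Im t" using q t1 pi_ge_two by (intro mult_right_mono) (auto intro!: order.trans[OF _ mult_mono[of 1 "2 * pi" 1 q]])
      hence "Im t \<le> 2 * pi * q * Im t" by simp
      also have "\<dots> \<le> exp (2 * pi * q * Im t)" using exp_ge_add_one_self[of "2 * pi * q * Im t"] by linarith
      finally have "1 \<le> k1 * exp (2 * pi * q * Im t)" using k(1) by (simp add: field_simps)
      hence w1: "norm w \<ge> 1" using k(3)[OF t1] by (simp add: w_def)
      have w0: "norm w powi (- y\<^sub>1) > 0" using w1 by (intro zero_less_power_int) linarith
      have add: "norm w powi y * norm w powi (- y\<^sub>1) = norm w powi (y - y\<^sub>1)" for y
        using w1 by (subst power_int_add[symmetric]) auto
      have "norm (G (fricke p t)) = norm (U_ratio p \<beta> r (fricke p t) - (\<Sum>y\<in>W. c y * w powi y)) * norm w powi (- y\<^sub>1)"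
        by (simp add: G_def S_def w_def norm_mult norm_power_int)
      also have "\<dots> \<le> (C * norm w powi y\<^sub>1 + (\<Sum>y\<in>W. norm (c y) * norm w powi y)) * norm w powi (- y\<^sub>1)"
      proof (rule mult_right_mono)
        have "norm (\<Sum>y\<in>W. c y * w powi y) \<le> (\<Sum>y\<in>W. norm (c y) * norm w powi y)"
          by (rule sum_norm_le) (simp add: norm_mult norm_power_int)
        thus "norm (U_ratio p \<beta> r (fricke p t) - (\<Sum>y\<in>W. c y * w powi y)) \<le> C * norm w powi y\<^sub>1 + (\<Sum>y\<in>W. norm (c y) * norm w powi y)"
          using C(2)[OF t1] norm_triangle_ineq4[of "U_ratio p \<beta> r (fricke p t)" "\<Sum>y\<in>W. c y * w powi y"]
          unfolding w_def by linarith
      qed (use w0 in auto)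
      also have "\<dots> = C * norm w powi (y\<^sub>1 - y\<^sub>1) + (\<Sum>y\<in>W. norm (c y) * norm w powi (y - y\<^sub>1))"
        unfolding distrib_right sum_distrib_right mult.assoc add ..
      also have "\<dots> \<le> C + (\<Sum>y\<in>W. norm (c y))"
      proof (rule add_mono)
        show "(\<Sum>y\<in>W. norm (c y) * norm w powi (y - y\<^sub>1)) \<le> (\<Sum>y\<in>W. norm (c y))"
        proof (rule sum_mono)
          fix y assume "y \<in> W"
          hence "norm w powi (y - y\<^sub>1) \<le> norm w powi 0" using W(2) w1 by (intro power_int_increasing) auto
          thus "norm (c y) * norm w powi (y - y\<^sub>1) \<le> norm (c y)" by (simp add: mult_left_le)
        qed
      qed simp
      finally show ?thesis .
    qed
    show "tends_to_0_at_cusp G"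
    proof -
      \<comment> \<open>The first exponent at which the coefficients may differ; the surplus 1 over
        the order of h^(y_1) yields the decay exp(-2 pi Im t) of G.\<close>
      define K where "K = int (pi_p p) * y\<^sub>1 + 1"
      have "laurent (\<lambda>k. U_coeff p \<beta> r k - (\<Sum>y\<in>W. c y * quotient_coeff p \<beta> r y k))
        (\<lambda>\<tau>. eta_factor p \<beta> r \<tau> * U_ratio p \<beta> r \<tau> - (\<Sum>y\<in>W. c y * (eta_factor p \<beta> r \<tau> * hauptmodul p \<tau> powi y)))"
        by (intro laurent_diff laurent_U laurent_sum W laurent_cmult laurent_quotient p0 r)
      also have "(\<lambda>\<tau>. eta_factor p \<beta> r \<tau> * U_ratio p \<beta> r \<tau> - (\<Sum>y\<in>W. c y * (eta_factor p \<beta> r \<tau> * hauptmodul p \<tau> powi y))) =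
         (\<lambda>\<tau>. eta_factor p \<beta> r \<tau> * S \<tau>)"
        by (simp add: S_def right_diff_distrib sum_distrib_left mult_ac)
      finally obtain C1 where C1: "\<And>\<tau>. Im \<tau> \<ge> 1 \<Longrightarrow> norm (eta_factor p \<beta> r \<tau> * S \<tau>) \<le> C1 * exp (- 2 * pi * of_int K * Im \<tau>)"
        using laurent_bound[of _ _ K] coeff unfolding K_def by fastforce
      obtain C2 where C2: "C2 \<ge> 0" "\<And>\<tau>. Im \<tau> \<ge> 1 \<Longrightarrow> norm (inverse (eta_factor p \<beta> r \<tau>)) \<le> C2"
        using eta_factor_inverse_bound[OF p0] by metis
      define C3 where "C3 = max (k1 powi (- y\<^sub>1)) (k2 powi (- y\<^sub>1))"
      have C3: "C3 > 0" using k by (auto simp: C3_def less_max_iff_disj)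
      define M where "M = C2 * \<bar>C1\<bar> * C3"
      have bound: "norm (G t) \<le> M * exp (- 2 * pi * Im t)" if t: "Im t \<ge> 1" for t
      proof -
        have t0: "Im t > 0" using t by simp
        have "norm (G t) = norm (inverse (eta_factor p \<beta> r t)) * norm (eta_factor p \<beta> r t * S t) * norm (hauptmodul p t) powi (- y\<^sub>1)"
          using eta_factor_nonzero[OF p0 t0, of \<beta> r] by (simp add: G_def norm_mult norm_power_int norm_inverse)
        also have "\<dots> \<le> C2 * (\<bar>C1\<bar> * exp (- 2 * pi * of_int K * Im t)) * (C3 * exp (- 2 * pi * q * Im t) powi (- y\<^sub>1))"
        proof (intro mult_mono)
          show "norm (eta_factor p \<beta> r t * S t) \<le> \<bar>C1\<bar> * exp (- 2 * pi * of_int K * Im t)"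
            using C1[OF t] by (rule order.trans) (intro mult_right_mono, auto)
          show "norm (hauptmodul p t) powi (- y\<^sub>1) \<le> C3 * exp (- 2 * pi * q * Im t) powi (- y\<^sub>1)"
            unfolding C3_def by (intro power_int_sandwich k t) auto
        qed (use C2 t C3 in auto)
        also have "\<dots> = M * (exp (- 2 * pi * of_int K * Im t) * exp (- 2 * pi * q * Im t) powi (- y\<^sub>1))"
          by (simp add: M_def)
        also have "exp (- 2 * pi * of_int K * Im t) * exp (- 2 * pi * q * Im t) powi (- y\<^sub>1) = exp (- 2 * pi * Im t)"
          unfolding exp_powi exp_add[symmetric] by (simp add: K_def q_def algebra_simps)
        finally show ?thesis .
      qed
      show ?thesis unfolding tends_to_0_at_cusp_def
      proof (intro allI impI)
        fix \<epsilon> :: real assume \<epsilon>: "\<epsilon> > 0"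
        define Y where "Y = max 1 (\<bar>M\<bar> / \<epsilon>)"
        have "norm (G t) < \<epsilon>" if t: "Im t \<ge> Y" for t
        proof -
          have t1: "Im t \<ge> 1" and tM: "\<bar>M\<bar> / \<epsilon> \<le> Im t" using t by (auto simp: Y_def)
          have "1 * Im t \<le> (2 * pi) * Im t" using t1 pi_ge_two by (intro mult_right_mono) auto
          hence "\<bar>M\<bar> / \<epsilon> < exp (2 * pi * Im t)" using tM exp_ge_add_one_self[of "2 * pi * Im t"] by linarith
          hence "\<bar>M\<bar> * exp (- 2 * pi * Im t) < \<epsilon>" using \<epsilon> by (simp add: exp_minus field_simps)
          moreover have "M * exp (- 2 * pi * Im t) \<le> \<bar>M\<bar> * exp (- 2 * pi * Im t)" by (intro mult_right_mono) auto
          ultimately show ?thesis using bound[OF t1] by linarith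
        qed
        thus "\<exists>Y. \<forall>\<tau>. Im \<tau> \<ge> Y \<longrightarrow> norm (G \<tau>) < \<epsilon>" by blast
      qed
    qed
  qed
  hence "S \<tau> = 0" using hauptmodul_nonzero[OF p0 \<tau>] by (simp add: G_def)
  thus ?thesis by (simp add: S_def)
qed

text \<open>Divisibility of the least index by pi_p makes it equal to pi_p y_0, so no coefficient
  lies below the leading exponent of h^(y_0). Then (B) together with these zeros supplies all
  coefficients up to pi_p y_1, as \<open>U_ratio_eq_polynomial\<close> requires.\<close>

theorem eta_identity_criterion:
  fixes p \<beta> :: nat and r :: int
  assumes p: "prime p" and r: "24 dvd r * (int p ^ 2 - 1)" and \<beta>: "\<beta> > 0"
    and ex: "\<exists>y. U_coeff p \<beta> r y \<noteq> 0"
    and dvd: "int (pi_p p) dvd (LEAST y. U_coeff p \<beta> r y \<noteq> 0)"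
  shows "(eta_identity p \<beta> r \<longleftrightarrow> coeff_identities p \<beta> r) \<and>
        (eta_identity p \<beta> r \<longrightarrow>
           (\<forall>y. \<not> (y0 p \<beta> r \<le> y \<and> y \<le> y1 p \<beta> r) \<longrightarrow> c_coeff p \<beta> r y = 0))"
proof -
  have p1: "p > 1" and p0: "p > 0" using p prime_gt_1_nat prime_gt_0_nat by blast+
  define q where "q = pi_p p"
  have q: "q > 0" unfolding q_def by (rule pi_p_pos[OF p1])
  define c where "c = c_coeff p \<beta> r"
  define y\<^sub>0 where "y\<^sub>0 = y0 p \<beta> r"
  define y\<^sub>1 where "y\<^sub>1 = y1 p \<beta> r"
  have y01: "y\<^sub>0 \<le> y\<^sub>1" "y1_bound p \<beta> r \<le> of_int y\<^sub>1" using y1_props by (auto simp: y\<^sub>0_def y\<^sub>1_def)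
  obtain lo where lo: "\<And>k. U_coeff p \<beta> r k \<noteq> 0 \<Longrightarrow> lo \<le> k" using U_coeff_lower[OF p0 r] by blast
  obtain Y where Y: "U_coeff p \<beta> r Y \<noteq> 0" using ex by blast
  have least: "U_coeff p \<beta> r (LEAST y. U_coeff p \<beta> r y \<noteq> 0) \<noteq> 0"
    "\<And>k. U_coeff p \<beta> r k \<noteq> 0 \<Longrightarrow> (LEAST y. U_coeff p \<beta> r y \<noteq> 0) \<le> k"
    using int_Least[of "\<lambda>k. U_coeff p \<beta> r k \<noteq> 0" Y lo] Y lo by simp_all
  obtain z where z: "(LEAST y. U_coeff p \<beta> r y \<noteq> 0) = int q * z" using dvd unfolding q_def by blast
  have Pz: "P_prog p \<beta> r z \<noteq> 0" using least(1) unfolding P_prog_U_coeff z q_def by simp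
  have y0z: "y\<^sub>0 = z" unfolding y\<^sub>0_def y0_def
  proof (rule Least_equality)
    fix y assume "P_prog p \<beta> r y \<noteq> 0"
    hence "U_coeff p \<beta> r (int q * y) \<noteq> 0" by (simp add: P_prog_U_coeff q_def)
    from least(2)[OF this] have "int q * z \<le> int q * y" unfolding z .
    thus "z \<le> y" using q by simp
  qed (rule Pz)
  have zero: "U_coeff p \<beta> r k = 0" if "k < int (pi_p p) * y\<^sub>0" for k
  proof (rule ccontr)
    assume "U_coeff p \<beta> r k \<noteq> 0"
    from least(2)[OF this] show False using that y0z unfolding z q_def by simp
  qed
  have exP: "\<exists>z. P_prog p \<beta> r z \<noteq> 0" using Pz by blast
  have iff: "eta_identity p \<beta> r \<longleftrightarrow> finite {y. c y \<noteq> 0} \<and>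
    (\<forall>\<tau>. Im \<tau> > 0 \<longrightarrow> U_ratio p \<beta> r \<tau> = (\<Sum>y | c y \<noteq> 0. c y * hauptmodul p \<tau> powi y))"
    unfolding c_def by (rule eta_identity_iff[OF p0 r])
  have below: "c y = 0" if "y < y\<^sub>0" for y using c_coeff_below that by (simp add: c_def y\<^sub>0_def)
  have coeffs: "coeff_identities p \<beta> r \<longleftrightarrow> (\<forall>n::nat. int n \<le> int q * (y\<^sub>1 - y\<^sub>0) \<longrightarrow>
      U_coeff p \<beta> r (int q * y\<^sub>0 + int n) =
      (\<Sum>y | y\<^sub>0 \<le> y \<and> (of_int y :: rat) \<le> of_int y\<^sub>0 + of_nat n / of_nat q. c y * a_coeff p \<beta> r y (n - q * nat (y - y\<^sub>0))))"
    unfolding coeff_identities_def U_coeff_def q_def c_def y\<^sub>0_def y\<^sub>1_def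
    by (simp add: algebra_simps)
  have AB: "coeff_identities p \<beta> r" if A: "eta_identity p \<beta> r"
  proof -
    define W where "W = {y. c y \<noteq> 0}"
    have W: "finite W" and U: "\<And>\<tau>. Im \<tau> > 0 \<Longrightarrow> U_ratio p \<beta> r \<tau> = (\<Sum>y\<in>W. c y * hauptmodul p \<tau> powi y)"
      using A unfolding iff W_def by auto
    have W0: "y\<^sub>0 \<le> y" if "y \<in> W" for y using below[of y] that by (force simp: W_def)
    have expansion: "U_coeff p \<beta> r k = (\<Sum>y\<in>W. c y * quotient_coeff p \<beta> r y k)" for k
      by (rule U_coeff_expansion[OF p1 r zero W W0 U])
    have "U_coeff p \<beta> r (int q * y\<^sub>0 + int n) =
      (\<Sum>y | y\<^sub>0 \<le> y \<and> (of_int y :: rat) \<le> of_int y\<^sub>0 + of_nat n / of_nat q. c y * a_coeff p \<beta> r y (n - q * nat (y - y\<^sub>0)))" for n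
      unfolding expansion unfolding q_def c_def y\<^sub>0_def
      by (rule coeff_identity_sum[OF p1 W]) (use W0 in \<open>auto simp: y\<^sub>0_def W_def c_def\<close>)
    thus ?thesis unfolding coeffs by blast
  qed
  \<comment> \<open>The support bound is derived from (B) along with (A); starting from (A) it is
    reached through \<open>AB\<close>.\<close>
  have BA: "eta_identity p \<beta> r \<and> (\<forall>y. \<not> (y\<^sub>0 \<le> y \<and> y \<le> y\<^sub>1) \<longrightarrow> c y = 0)" if B: "coeff_identities p \<beta> r"
  proof -
    define W where "W = {y\<^sub>0..y\<^sub>1}"
    have W: "finite W" "\<And>y. y \<in> W \<Longrightarrow> y\<^sub>0 \<le> y" "\<And>y. y \<in> W \<Longrightarrow> y \<le> y\<^sub>1" by (auto simp: W_def)
    have eq: "U_coeff p \<beta> r k = (\<Sum>y\<in>W. c y * quotient_coeff p \<beta> r y k)" if k: "k \<le> int (pi_p p) * y\<^sub>1" for k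
    proof (cases "k < int (pi_p p) * y\<^sub>0")
      case True
      have "quotient_coeff p \<beta> r y k = 0" if "y \<in> W" for y
      proof -
        have "int (pi_p p) * y\<^sub>0 \<le> int (pi_p p) * y" using W(2)[OF that] by (intro mult_left_mono) auto
        thus ?thesis using True by (simp add: quotient_coeff_def)
      qed
      thus ?thesis using zero[OF True] by simp
    next
      case False
      define n where "n = nat (k - int q * y\<^sub>0)"
      have n: "k = int q * y\<^sub>0 + int n" using False by (simp add: n_def q_def)
      have nle: "int n \<le> int q * (y\<^sub>1 - y\<^sub>0)" using k n by (simp add: q_def algebra_simps)
      hence "U_coeff p \<beta> r k = (\<Sum>y | y\<^sub>0 \<le> y \<and> (of_int y :: rat) \<le> of_int y\<^sub>0 + of_nat n / of_nat q. c y * a_coeff p \<beta> r y (n - q * nat (y - y\<^sub>0)))"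
        using B unfolding coeffs n by blast
      also have "\<dots> = (\<Sum>y\<in>W. c y * quotient_coeff p \<beta> r y (int q * y\<^sub>0 + int n))"
        unfolding q_def c_def y\<^sub>0_def
      proof (rule coeff_identity_sum[OF p1 W(1), symmetric])
        fix y assume y: "y0 p \<beta> r \<le> y" "int (pi_p p) * (y - y0 p \<beta> r) \<le> int n" "y \<notin> W"
        have "int q * (y - y\<^sub>0) \<le> int q * (y\<^sub>1 - y\<^sub>0)" using y(2) nle by (simp add: q_def y\<^sub>0_def)
        hence "y \<le> y\<^sub>1" using q by simp
        thus "c_coeff p \<beta> r y = 0" using y by (simp add: W_def y\<^sub>0_def)
      qed (use W in \<open>auto simp: y\<^sub>0_def\<close>)
      finally show ?thesis unfolding n .
    qed
    have U: "U_ratio p \<beta> r \<tau> = (\<Sum>y\<in>W. c y * hauptmodul p \<tau> powi y)" if "Im \<tau> > 0" for \<tau>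
      by (rule U_ratio_eq_polynomial[OF p r \<beta> y01(2) W(1,3) eq that])
    \<comment> \<open>Above y_1 the identity already proved gives the coefficient at pi_p y as the
      sum over W. By induction this is the sum which the recursion subtracts, so the next c_y is
      0.\<close>
    have vanish: "c (y\<^sub>1 + 1 + int n) = 0" for n
    proof (induction n rule: less_induct)
      case (less n)
      define y where "y = y\<^sub>1 + 1 + int n"
      have IH: "c y' = 0" if "y\<^sub>1 < y'" "y' < y" for y'
        using less[of "nat (y' - y\<^sub>1 - 1)"] that by (simp add: y_def nat_less_iff)
      have "U_coeff p \<beta> r (int (pi_p p) * y) = (\<Sum>y'\<in>W. c y' * quotient_coeff p \<beta> r y' (int (pi_p p) * y))"
        by (rule U_coeff_expansion[OF p1 r zero W(1,2) U])
      also have "\<dots> = (\<Sum>y'\<in>W. c y' * a_coeff p \<beta> r y' (pi_p p * nat (y - y')))"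
      proof (rule sum.cong)
        fix y' assume "y' \<in> W"
        hence le: "y' \<le> y" by (auto simp: W_def y_def)
        hence "int (pi_p p) * y' \<le> int (pi_p p) * y" by (intro mult_left_mono) auto
        moreover have "nat (int (pi_p p) * y - int (pi_p p) * y') = pi_p p * nat (y - y')"
          using le by (simp add: nat_mult_distrib right_diff_distrib[symmetric])
        ultimately show "c y' * quotient_coeff p \<beta> r y' (int (pi_p p) * y) = c y' * a_coeff p \<beta> r y' (pi_p p * nat (y - y'))"
          by (simp add: quotient_coeff_def)
      qed simp
      also have "\<dots> = (\<Sum>y'\<in>{y\<^sub>0..<y}. c y' * a_coeff p \<beta> r y' (pi_p p * nat (y - y')))"
        using IH by (intro sum.mono_neutral_left) (auto simp: W_def y_def)
      finally have "P_prog p \<beta> r y = (\<Sum>y'\<in>{y\<^sub>0..<y}. c y' * a_coeff p \<beta> r y' (pi_p p * nat (y - y')))"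
        by (simp only: P_prog_U_coeff)
      moreover have "y\<^sub>0 \<le> y" using y01 by (simp add: y_def)
      ultimately have "c y = 0" using c_coeff_rec[OF exP, of y] by (simp add: c_def y\<^sub>0_def)
      thus ?case by (simp add: y_def)
    qed
    have sub: "{y. c y \<noteq> 0} \<subseteq> W"
    proof
      fix y assume "y \<in> {y. c y \<noteq> 0}"
      hence y: "c y \<noteq> 0" by simp
      have "y \<ge> y\<^sub>0" using below[of y] y by force
      moreover have "y \<le> y\<^sub>1" using vanish[of "nat (y - y\<^sub>1 - 1)"] y by (cases "y \<le> y\<^sub>1") auto
      ultimately show "y \<in> W" by (simp add: W_def)
    qed
    have "(\<Sum>y\<in>W. c y * hauptmodul p \<tau> powi y) = (\<Sum>y | c y \<noteq> 0. c y * hauptmodul p \<tau> powi y)" for \<tau>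
      using sub W(1) by (intro sum.mono_neutral_right) auto
    hence "eta_identity p \<beta> r" unfolding iff using U finite_subset[OF sub W(1)] by simp
    moreover have "c y = 0" if "\<not> (y\<^sub>0 \<le> y \<and> y \<le> y\<^sub>1)" for y using sub that by (auto simp: W_def)
    ultimately show ?thesis by blast
  qed
  show ?thesis using AB BA unfolding c_def y\<^sub>0_def y\<^sub>1_def by blast
qed

text \<open>With pi_p = 1 the progression skips no exponent: (B) at n is the recursion for c at y_0
  + n, whose own term enters with a_0 = 1.\<close>

lemma coeff_identities_pi_p_1:
  assumes p: "p > 1" and q: "pi_p p = 1" and ex: "\<exists>z. P_prog p \<beta> r z \<noteq> 0"
  shows "coeff_identities p \<beta> r"
  unfolding coeff_identities_def
proof (intro allI impI)
  fix n :: nat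
  define y\<^sub>0 where "y\<^sub>0 = y0 p \<beta> r"
  define y where "y = y\<^sub>0 + int n"
  define f where "f = (\<lambda>y'. c_coeff p \<beta> r y' * a_coeff p \<beta> r y' (nat (y - y')))"
  have T: "{y. y\<^sub>0 \<le> y \<and> (of_int y :: rat) \<le> of_int y\<^sub>0 + of_nat n / of_nat (pi_p p)} = insert y {y\<^sub>0..<y}"
  proof -
    have "(of_int y' :: rat) \<le> of_int y\<^sub>0 + of_nat n / of_nat (pi_p p) \<longleftrightarrow> y' \<le> y" for y'
    proof -
      have "(of_int y\<^sub>0 + of_nat n / of_nat (pi_p p) :: rat) = of_int y" by (simp add: q y_def)
      thus ?thesis by (simp only: of_int_le_iff)
    qed
    hence "{y. y\<^sub>0 \<le> y \<and> (of_int y :: rat) \<le> of_int y\<^sub>0 + of_nat n / of_nat (pi_p p)} = {y'. y\<^sub>0 \<le> y' \<and> y' \<le> y}"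
      by (simp only:)
    also have "\<dots> = insert y {y\<^sub>0..<y}" by (auto simp: y_def)
    finally show ?thesis .
  qed
  have "P r (P_shift p \<beta> r + of_nat (p ^ \<beta>) * of_nat (pi_p p) * of_int y\<^sub>0 + of_nat (p ^ \<beta>) * of_nat n) = P_prog p \<beta> r y"
    unfolding P_prog_def by (rule arg_cong[where f = "P r"]) (simp add: q y_def algebra_simps)
  also have "\<dots> = c_coeff p \<beta> r y + (\<Sum>y'\<in>{y\<^sub>0..<y}. f y')"
    using c_coeff_rec[OF ex, of y] by (simp add: y\<^sub>0_def y_def q f_def)
  also have "\<dots> = (\<Sum>y'\<in>insert y {y\<^sub>0..<y}. f y')"
    using p by (simp add: f_def a_coeff_0)
  also have "\<dots> = (\<Sum>y'\<in>insert y {y\<^sub>0..<y}. c_coeff p \<beta> r y' * a_coeff p \<beta> r y' (n - pi_p p * nat (y' - y\<^sub>0)))"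
  proof (rule sum.cong)
    fix y' assume "y' \<in> insert y {y\<^sub>0..<y}"
    hence "nat (y - y') = n - pi_p p * nat (y' - y\<^sub>0)" by (auto simp: q y_def)
    thus "f y' = c_coeff p \<beta> r y' * a_coeff p \<beta> r y' (n - pi_p p * nat (y' - y\<^sub>0))" by (simp add: f_def)
  qed simp
  finally show "P r (P_shift p \<beta> r + of_nat (p ^ \<beta>) * of_nat (pi_p p) * of_int (y0 p \<beta> r) + of_nat (p ^ \<beta>) * of_nat n) =
        (\<Sum>y | y0 p \<beta> r \<le> y \<and> (of_int y :: rat) \<le> of_int (y0 p \<beta> r) + of_nat n / of_nat (pi_p p).
           c_coeff p \<beta> r y * a_coeff p \<beta> r y (n - pi_p p * nat (y - y0 p \<beta> r)))"
    unfolding y\<^sub>0_def[symmetric] T .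
qed

text \<open>Here \<open>y0\<close> has no meaning: c vanishes by convention, and F vanishes because
  all its coefficients do.\<close>

lemma eta_identity_trivial:
  assumes p: "p > 0" and r: "24 dvd r * (int p ^ 2 - 1)" and zero: "\<And>k. U_coeff p \<beta> r k = 0"
  shows "eta_identity p \<beta> r"
proof -
  have c: "c_coeff p \<beta> r y = 0" for y
    by (subst c_coeff.simps) (simp add: P_prog_U_coeff zero)
  have "U_ratio p \<beta> r \<tau> = 0" if \<tau>: "Im \<tau> > 0" for \<tau>
  proof -
    have "((\<lambda>k. U_coeff p \<beta> r k * ee (of_int k * \<tau>)) has_sum (eta_factor p \<beta> r \<tau> * U_ratio p \<beta> r \<tau>)) UNIV"
      using laurent_U[OF p r, of \<beta>] \<tau> by (auto simp: laurent_def)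
    hence "((\<lambda>k::int. 0) has_sum (eta_factor p \<beta> r \<tau> * U_ratio p \<beta> r \<tau>)) UNIV" by (simp add: zero)
    hence "eta_factor p \<beta> r \<tau> * U_ratio p \<beta> r \<tau> = 0" using has_sum_unique has_sum_0_simp by blast
    thus ?thesis using eta_factor_nonzero[OF p \<tau>] by simp
  qed
  thus ?thesis unfolding eta_identity_iff[OF p r] by (simp add: c)
qed

text \<open>The primes with p - 1 dividing 12, which are those for which X_0(p) has genus 0.\<close>

lemma pi_p_genus_0:
  assumes "p \<in> {2, 3, 5, 7, 13}"
  shows "pi_p p = 1"
proof -
  have "gcd 12 (1::nat) = 1" "gcd 12 (2::nat) = 2" "gcd 12 (4::nat) = 4" "gcd 12 (6::nat) = 6" "gcd 12 (12::nat) = 12"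
    by code_simp+
  thus ?thesis using assms by (auto simp: pi_p_def)
qed

theorem theorem6p6:
  fixes p \<beta> :: nat and r :: int
  assumes "prime p" and "24 dvd r * (int p ^ 2 - 1)" and "\<beta> > 0"
  shows
    "((\<exists>y::int. P r (P_shift p \<beta> r + of_nat (p ^ \<beta>) * of_int y) \<noteq> 0) \<and>
      int (pi_p p) dvd (LEAST y::int. P r (P_shift p \<beta> r + of_nat (p ^ \<beta>) * of_int y) \<noteq> 0)
      \<longrightarrow>
        (eta_identity p \<beta> r \<longleftrightarrow> coeff_identities p \<beta> r) \<and>
        (eta_identity p \<beta> r \<longrightarrow>
           (\<forall>y. \<not> (y0 p \<beta> r \<le> y \<and> y \<le> y1 p \<beta> r) \<longrightarrow> c_coeff p \<beta> r y = 0)))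
     \<and>
     (p \<in> {2, 3, 5, 7, 13} \<longrightarrow> eta_identity p \<beta> r)"
proof (intro conjI[OF impI impI], goal_cases)
  case 1
  thus ?case using eta_identity_criterion[OF assms] unfolding U_coeff_def by blast
next
  case 2
  have p1: "p > 1" using assms(1) prime_gt_1_nat by blast
  hence p0: "p > 0" by simp
  have q: "pi_p p = 1" by (rule pi_p_genus_0[OF 2])
  show ?case
  \<comment> \<open>If some coefficient is nonzero, the divisibility condition of (i) is automatic,
    as pi_p = 1; otherwise the identity is 0 = 0.\<close>
  proof (cases "\<exists>y. U_coeff p \<beta> r y \<noteq> 0")
    case True
    hence "\<exists>z. P_prog p \<beta> r z \<noteq> 0" by (simp add: P_prog_U_coeff q)
    thus ?thesis using eta_identity_criterion[OF assms True] coeff_identities_pi_p_1[OF p1 q] by (simp add: q)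
  next
    case False
    thus ?thesis using eta_identity_trivial[OF p0 assms(2)] by blast
  qed
qed

end
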